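(* Let $E/\mathbb{Q}$ be an elliptic curve with complex multiplication by the ring of integers of $\mathbb{Q}(\sqrt{-11})$, and let $k$ be a positive integer. If $6\mid k$, then the $k$-th Lattès map $L_k$ attached to $E$ is not arithmetically exceptional.
   Context: Let $E/\mathbb{Q}$ be an elliptic curve given by a Weierstrass equation over $\mathbb{Q}$, and let $\mathrm{proj}:E\to\mathbb{P}^1$ be the $x$-coordinate projection (sending the point at infinity to $\infty$). For a positive integer $k$, the $k$-th Lattès map $L_k\in\mathbb{Q}(x)$ attached to $E$ is the unique rational function with $\mathrm{proj}\circ[k]=L_k\circ\mathrm{proj}$, where $[k]$ is multiplication by $k$ on $E$. A rational function $r(x)\in\mathbb{Q}(x)$ is called arithmetically exceptional if its reduction modulo $p$ (defined for all but finitely many primes $p$) induces a permutation of $\mathbb{P}^1(\mathbb{F}_p)$ for infinitely many primes $p$. "CM by an order $\mathcal{O}$" means that the endomorphism ring of $E$ over $\overline{\mathbb{Q}}$ is isomorphic to $\mathcal{O}$. *)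

theory Defs
  imports
    Complex_Main
    "HOL-Computational_Algebra.Computational_Algebra"
    "HOL-Computational_Algebra.Field_as_Ring"
    "HOL-Number_Theory.Modular_Inverse"
    "HOL-Algebra.QuotRing"
    "HOL-Algebra.Algebraic_Closure_Type"
    "HOL-Library.FuncSet"
begin

section \<open>Weierstrass curves and the chord-tangent group law\<close>

text \<open>The curve \<open>y\<^sup>2 + a1 x y + a3 y = x\<^sup>3 + a2 x\<^sup>2 + a4 x + a6\<close>.\<close>

datatype 'a weierstrass =
  Weierstrass (a1: 'a) (a2: 'a) (a3: 'a) (a4: 'a) (a6: 'a)

definition discriminant :: "'a::field weierstrass \<Rightarrow> 'a" where
  "discriminant E =
     (let b2 = a1 E ^ 2 + 4 * a2 E;
          b4 = 2 * a4 E + a1 E * a3 E;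
          b6 = a3 E ^ 2 + 4 * a6 E;
          b8 = a1 E ^ 2 * a6 E + 4 * a2 E * a6 E - a1 E * a3 E * a4 E
               + a2 E * a3 E ^ 2 - a4 E ^ 2
      in - (b2 ^ 2) * b8 - 8 * b4 ^ 3 - 27 * b6 ^ 2 + 9 * b2 * b4 * b6)"

definition elliptic_curve :: "'a::field weierstrass \<Rightarrow> bool" where
  "elliptic_curve E \<longleftrightarrow> discriminant E \<noteq> 0"

datatype 'a point = Infinity | Affine 'a 'a

fun on_curve :: "'a::field weierstrass \<Rightarrow> 'a point \<Rightarrow> bool" where
  "on_curve E Infinity \<longleftrightarrow> True"
| "on_curve E (Affine x y) \<longleftrightarrow>
     y ^ 2 + a1 E * x * y + a3 E * y = x ^ 3 + a2 E * x ^ 2 + a4 E * x + a6 E"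

definition points :: "'a::field weierstrass \<Rightarrow> 'a point set" where
  "points E = {P. on_curve E P}"

text \<open>In the tangent case \<open>x1 = x2\<close>, two points of the curve that are not opposite to each
  other are equal, so the slope may be computed from the first one.\<close>

fun ec_add :: "'a::field weierstrass \<Rightarrow> 'a point \<Rightarrow> 'a point \<Rightarrow> 'a point" where
  "ec_add E Infinity Q = Q"
| "ec_add E P Infinity = P"
| "ec_add E (Affine x1 y1) (Affine x2 y2) =
     (if x1 = x2 \<and> y1 + y2 + a1 E * x2 + a3 E = 0 then Infinity
      else
        let l = (if x1 = x2
                 then (3 * x1 ^ 2 + 2 * a2 E * x1 + a4 E - a1 E * y1) / (2 * y1 + a1 E * x1 + a3 E)
                 else (y2 - y1) / (x2 - x1));
            x3 = l ^ 2 + a1 E * l - a2 E - x1 - x2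
        in Affine x3 (- (y1 + l * (x3 - x1)) - a1 E * x3 - a3 E))"

definition ec_mult :: "'a::field weierstrass \<Rightarrow> nat \<Rightarrow> 'a point \<Rightarrow> 'a point" where
  "ec_mult E k P = (ec_add E P ^^ k) Infinity"


section \<open>The endomorphism ring\<close>

text \<open>A ternary form of degree \<open>d\<close>, given by the coefficients \<open>c i j\<close> of the monomials
  \<open>x\<^sup>i y\<^sup>j z\<^bsup>d-i-j\<^esup>\<close> (entries with \<open>i + j > d\<close> are ignored).\<close>

fun ternary_form :: "nat \<Rightarrow> (nat \<Rightarrow> nat \<Rightarrow> 'a) \<Rightarrow> 'a \<times> 'a \<times> 'a \<Rightarrow> 'a::field" where
  "ternary_form d c (x, y, z) = (\<Sum>i\<le>d. \<Sum>j\<le>d - i. c i j * x ^ i * y ^ j * z ^ (d - i - j))"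

fun proj_coords :: "'a::field point \<Rightarrow> 'a \<times> 'a \<times> 'a" where
  "proj_coords Infinity = (0, 1, 0)"
| "proj_coords (Affine x y) = (x, y, 1)"

fun same_proj_point :: "'a::field \<times> 'a \<times> 'a \<Rightarrow> 'a \<times> 'a \<times> 'a \<Rightarrow> bool" where
  "same_proj_point (u, v, w) (u', v', w') \<longleftrightarrow>
     (\<exists>c. c \<noteq> 0 \<and> u = c * u' \<and> v = c * v' \<and> w = c * w')"

text \<open>Morphisms of projective varieties \<open>E \<rightarrow> E\<close>, as maps on points over an algebraically closed
  ground field: around every point the map is given by three forms of the same degree that do
  not all vanish there.\<close>

definition ec_morphism :: "'a::alg_closed_field weierstrass \<Rightarrow> ('a point \<Rightarrow> 'a point) \<Rightarrow> bool" where
  "ec_morphism E f \<longleftrightarrow> f \<in> points E \<rightarrow> points E \<and>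
     (\<forall>P\<in>points E. \<exists>d c0 c1 c2.
        let F = (\<lambda>Q. (ternary_form d c0 (proj_coords Q),
                      ternary_form d c1 (proj_coords Q),
                      ternary_form d c2 (proj_coords Q)))
        in F P \<noteq> (0, 0, 0) \<and>
           (\<forall>Q\<in>points E. F Q \<noteq> (0, 0, 0) \<longrightarrow> same_proj_point (F Q) (proj_coords (f Q))))"

text \<open>Endomorphisms of the algebraic group \<open>E\<close>. They are extensional (undefined off the curve), so
  that equality of functions is equality of endomorphisms.\<close>

definition ec_endomorphisms :: "'a::alg_closed_field weierstrass \<Rightarrow> ('a point \<Rightarrow> 'a point) set" where
  "ec_endomorphisms E =
     {f \<in> extensional (points E).
        ec_morphism E f \<and>
        (\<forall>P\<in>points E. \<forall>Q\<in>points E. f (ec_add E P Q) = ec_add E (f P) (f Q))}"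

definition End_ring :: "'a::alg_closed_field weierstrass \<Rightarrow> ('a point \<Rightarrow> 'a point) ring" where
  "End_ring E =
     \<lparr>carrier = ec_endomorphisms E,
      mult = compose (points E),
      one = restrict id (points E),
      zero = restrict (\<lambda>P. Infinity) (points E),
      add = (\<lambda>f g. restrict (\<lambda>P. ec_add E (f P) (g P)) (points E))\<rparr>"


section \<open>Complex multiplication\<close>

text \<open>\<open>rat alg_closure\<close> plays the role of \<open>\<rat>\<close>-bar, with embedding \<open>to_ac\<close> of the rationals.\<close>

definition geometric :: "rat weierstrass \<Rightarrow> rat alg_closure weierstrass" where
  "geometric E = map_weierstrass to_ac E"

definition has_CM_by :: "rat weierstrass \<Rightarrow> complex ring \<Rightarrow> bool" where
  "has_CM_by E R \<longleftrightarrow> End_ring (geometric E) \<simeq> R"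

definition quadratic_field :: "int \<Rightarrow> complex set" where
  "quadratic_field d = {of_rat a + of_rat b * csqrt (of_int d) | a b. True}"

definition ring_of_integers :: "complex set \<Rightarrow> complex ring" where
  "ring_of_integers K =
     \<lparr>carrier = {z \<in> K. algebraic_int z}, mult = (*), one = 1, zero = 0, add = (+)\<rparr>"


section \<open>Rational functions on the projective line and Lattes maps\<close>

datatype 'a P1 = Finite 'a | At_Infinity

fun proj :: "'a point \<Rightarrow> 'a P1" where
  "proj Infinity = At_Infinity"
| "proj (Affine x y) = Finite x"

text \<open>The map on the projective line induced by \<open>n / d\<close> for coprime \<open>n\<close>, \<open>d\<close>. At infinity one
  compares the coefficients of degree \<open>max (degree n) (degree d)\<close>, i.e. homogenises.\<close>

fun P1_map :: "'a::field poly \<Rightarrow> 'a poly \<Rightarrow> 'a P1 \<Rightarrow> 'a P1" where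
  "P1_map n d (Finite x) = (if poly d x = 0 then At_Infinity else Finite (poly n x / poly d x))"
| "P1_map n d At_Infinity =
     (let m = max (degree n) (degree d)
      in if coeff d m = 0 then At_Infinity else Finite (coeff n m / coeff d m))"

definition eval_geometric :: "rat poly fract \<Rightarrow> rat alg_closure P1 \<Rightarrow> rat alg_closure P1" where
  "eval_geometric r =
     (let (n, d) = quot_of_fract r in P1_map (map_poly to_ac n) (map_poly to_ac d))"

text \<open>The equation \<open>proj \<circ> [k] = r \<circ> proj\<close> on the points over \<open>\<rat>\<close>-bar. It determines \<open>r\<close>, since
  \<open>proj\<close> is surjective there.\<close>

definition is_lattes_map :: "rat weierstrass \<Rightarrow> nat \<Rightarrow> rat poly fract \<Rightarrow> bool" where
  "is_lattes_map E k r \<longleftrightarrow>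
     (\<forall>P\<in>points (geometric E).
        proj (ec_mult (geometric E) k P) = eval_geometric r (proj P))"


section \<open>Reduction modulo primes and arithmetical exceptionality\<close>

text \<open>Writing \<open>r = n / d\<close> with \<open>n\<close>, \<open>d\<close> coprime in \<open>\<int>[x]\<close> determines the pair up to a common
  sign; in particular \<open>n\<close> and \<open>d\<close> have no common integer factor.\<close>

definition primitive_form :: "rat poly fract \<Rightarrow> int poly \<Rightarrow> int poly \<Rightarrow> bool" where
  "primitive_form r n d \<longleftrightarrow> d \<noteq> 0 \<and> coprime n d \<and>
     r = to_fract (map_poly of_int n) / to_fract (map_poly of_int d)"

text \<open>The homogenised reductions of \<open>n\<close>, \<open>d\<close> modulo \<open>p\<close> have no common zero over the algebraic
  closure of \<open>F\<^sub>p\<close>: neither at infinity (first conjunct) nor at a finite point, i.e. \<open>n\<close> and \<open>d\<close>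
  generate the unit ideal modulo \<open>p\<close>. This fails for only finitely many \<open>p\<close>.\<close>

definition good_reduction :: "nat \<Rightarrow> int poly \<Rightarrow> int poly \<Rightarrow> bool" where
  "good_reduction p n d \<longleftrightarrow>
     (let m = max (degree n) (degree d)
      in \<not> (int p dvd coeff n m \<and> int p dvd coeff d m)) \<and>
     (\<exists>u v. [:int p:] dvd u * n + v * d - 1)"

definition P1_mod :: "nat \<Rightarrow> int P1 set" where
  "P1_mod p = insert At_Infinity (Finite ` {0..<int p})"

fun P1_map_mod :: "nat \<Rightarrow> int poly \<Rightarrow> int poly \<Rightarrow> int P1 \<Rightarrow> int P1" where
  "P1_map_mod p n d (Finite x) =
     (if int p dvd poly d x then At_Infinity
      else Finite (poly n x * modular_inverse (int p) (poly d x) mod int p))"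
| "P1_map_mod p n d At_Infinity =
     (let m = max (degree n) (degree d)
      in if int p dvd coeff d m then At_Infinity
         else Finite (coeff n m * modular_inverse (int p) (coeff d m) mod int p))"

definition arithmetically_exceptional :: "rat poly fract \<Rightarrow> bool" where
  "arithmetically_exceptional r \<longleftrightarrow>
     (\<exists>n d. primitive_form r n d \<and>
        infinite {p. Factorial_Ring.prime p \<and> good_reduction p n d \<and>
                     bij_betw (P1_map_mod p n d) (P1_mod p) (P1_mod p)})"

end

theory Submission
  imports Defs "HOL-Library.Set_Algebras"
begin

text \<open>
  The Lattes map sends \<infinity> to \<infinity>, and it sends the x-coordinate of every affine point killed by k
  to \<infinity>. If 6 divides k, these points include the points of order 2 and of order 3. For every
  sufficiently large prime p one of their x-coordinates reduces to an element of the field with p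
  elements. Then two points of the projective line over that field have the image \<infinity>, so the
  reduction is not a permutation (proposition11).

  Such a point exists because complex multiplication by \<omega> = (1 + sqrt(-11))/2 determines the
  curve up to twist: in short form it is y^2 = x^3 - 264 s^2 x + 1694 s^3 with a rational s
  (CM_short_parameter; these are the curves with j-invariant -32768). The cubic on the right, whose
  roots belong to the points of order 2, has discriminant -11 (594 s^3)^2. The 3-division polynomial
  has the factor x^2 - 22 s x + 132 s^2, whose roots belong to the kernels of \<omega> and of its
  conjugate, and whose discriminant is -11 (2 s)^2. If -11 is a square modulo p, the quadratic has
  a root. If it is not, the discriminant of the cubic is not a square, and such a cubic is the
  product of a linear and an irreducible quadratic factor (cubic_root_mod_prime,
  torsion_root_mod_prime).

  The equation of the curve is found from \<omega> alone. Let f and g be the endomorphisms that correspond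
  to \<omega> and 1 - \<omega>, so f + g = 1 and g f = 3 (CM_endomorphisms). Near the point at infinity every
  nonzero endomorphism (x, y) \<mapsto> (R(x), y S(x)) behaves as R(x)/x \<rightarrow> 1/c^2 and S(x) \<rightarrow> 1/c^3, where
  c is its multiplier, that is, its action on the invariant differential dx/y. Multipliers add and
  multiply as the endomorphisms do, so those of f and g are c and 1 - c with c (1 - c) = 3
  (CM_multiplier). The degrees of the x-coordinate maps of f and g have the product 9, the degree
  for [3], and neither of them is 1. So R has degree 3 with a single double pole z besides \<infinity>
  (degree_3). That f multiplies dx/y by c is then an identity between polynomials of degree 9
  (isogeny_equation), and its coefficients determine z and give 539 a^3 + 3456 b^2 = 0
  (isogeny_coefficients).

  A ring isomorphism with the endomorphism ring speaks only about maps that are already known to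
  be endomorphisms. To translate f + g = 1 into a statement about points, the pointwise sum of two
  endomorphisms has to be an endomorphism. That it is additive rests on the associativity of the
  group law (ec_add_assoc), which is proved by the identification of points with ideal classes of
  the coordinate ring. That it is given by forms near every point rests on a pair of addition laws
  that never vanish together (ec_morphism_add).
\<close>

section \<open>The group law on a short Weierstrass curve\<close>

abbreviation short :: "'a::field \<Rightarrow> 'a \<Rightarrow> 'a weierstrass" where
  "short a b \<equiv> Weierstrass 0 0 0 a b"

fun ec_neg :: "'a::field point \<Rightarrow> 'a point" where
  "ec_neg Infinity = Infinity"
| "ec_neg (Affine x y) = Affine x (- y)"

lemma ec_neg_neg [simp]: "ec_neg (ec_neg P) = P"
  by (cases P) auto

lemma on_short_iff [simp]:
  "on_curve (short a b) (Affine x y) \<longleftrightarrow> y ^ 2 = x ^ 3 + a * x + b"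
  by simp

lemma on_curve_neg [simp]: "on_curve (short a b) (ec_neg P) \<longleftrightarrow> on_curve (short a b) P"
  by (cases P) auto

lemma ec_add_Infinity_right [simp]: "ec_add E P Infinity = P"
  by (cases P) auto

lemma ec_add_neg [simp]: "ec_add (short a b) P (ec_neg P) = Infinity"
  by (cases P) auto

lemma ec_add_eq_Infinity:
  "ec_add (short a b) P Q = Infinity \<Longrightarrow> Q = ec_neg P"
  by (cases P; cases Q) (auto simp: Let_def eq_neg_iff_add_eq_0 add.commute split: if_splits)

text \<open>
  If x1 \<noteq> x2, the second equation is the first one multiplied by (y1 + y2)/(x2 - x1); for x1 = x2 it
  is the formula for the slope of a tangent. With both of them, chords and tangents need no separate
  treatment.
\<close>

lemma ec_add_slope:
  fixes a b :: "'a::field_char_0"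
  assumes P: "on_curve (short a b) (Affine x1 y1)" and Q: "on_curve (short a b) (Affine x2 y2)"
    and ne: "Affine x2 y2 \<noteq> ec_neg (Affine x1 y1)"
  obtains l where
    "l * (x2 - x1) = y2 - y1"
    "l * (y1 + y2) = x1 ^ 2 + x1 * x2 + x2 ^ 2 + a"
    "ec_add (short a b) (Affine x1 y1) (Affine x2 y2) =
       Affine (l ^ 2 - x1 - x2) (- (y1 + l * (l ^ 2 - x1 - x2 - x1)))"
proof (cases "x1 = x2")
  case True
  from P Q True have "(y1 - y2) * (y1 + y2) = 0" by (simp add: algebra_simps power2_eq_square)
  with ne True have y: "y1 = y2" "y1 + y2 \<noteq> 0"
    by (auto simp: eq_neg_iff_add_eq_0 add.commute)
  then have y0: "y1 \<noteq> 0" by auto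
  define l where "l = (3 * x1 ^ 2 + a) / (2 * y1)"
  have "l * (y1 + y1) = x1 ^ 2 + x1 * x1 + x1 ^ 2 + a"
    using y0 by (simp add: l_def power2_eq_square flip: mult_2)
  moreover have "ec_add (short a b) (Affine x1 y1) (Affine x1 y1) =
       Affine (l ^ 2 - x1 - x1) (- (y1 + l * (l ^ 2 - x1 - x1 - x1)))"
    using y0 by (simp add: l_def Let_def)
  ultimately show ?thesis using that[of l] True y by simp
next
  case False
  have "y2 ^ 2 - y1 ^ 2 = (x2 - x1) * (x1 ^ 2 + x1 * x2 + x2 ^ 2 + a)"
    using P Q by (simp add: algebra_simps power2_eq_square power3_eq_cube)
  then have "(y2 - y1) / (x2 - x1) * (y1 + y2) = x1 ^ 2 + x1 * x2 + x2 ^ 2 + a"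
    using False by (simp add: divide_simps) (simp add: algebra_simps power2_eq_square)
  then show ?thesis
    using that[of "(y2 - y1) / (x2 - x1)"] False by (simp add: Let_def)
qed

text \<open>
  A monic cubic that vanishes at x1 and x2 has as its third root the sum of all roots, read off from
  the coefficient l^2, minus x1 and x2. The second equation on l makes this also true for a
  double root.
\<close>

lemma line_meets_cubic:
  fixes l :: "'a::comm_ring_1"
  assumes "y1 ^ 2 = x1 ^ 3 + a * x1 + b" "l * (x2 - x1) = y2 - y1"
    "l * (y1 + y2) = x1 ^ 2 + x1 * x2 + x2 ^ 2 + a"
  shows "x ^ 3 + a * x + b - (y1 + l * (x - x1)) ^ 2 =
           (x - x1) * (x - x2) * (x - (l ^ 2 - x1 - x2))"
proof -
  have y2: "y2 = y1 + l * (x2 - x1)" using assms(2) by simp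
  have a: "a = l * (2 * y1 + l * (x2 - x1)) - x1 ^ 2 - x1 * x2 - x2 ^ 2"
    using assms(3) unfolding y2 by (simp add: algebra_simps)
  have b: "b = y1 ^ 2 - x1 ^ 3 - a * x1" using assms(1) by (simp add: algebra_simps)
  show ?thesis unfolding b a by (simp add: algebra_simps power2_eq_square power3_eq_cube)
qed

lemma on_curve_add:
  fixes a b :: "'a::field_char_0"
  assumes P: "on_curve (short a b) P" and Q: "on_curve (short a b) Q"
  shows "on_curve (short a b) (ec_add (short a b) P Q)"
proof (cases "P = Infinity \<or> Q = Infinity \<or> Q = ec_neg P")
  case True
  then show ?thesis using P Q by auto
next
  case False
  then obtain x1 y1 x2 y2 where PQ: "P = Affine x1 y1" "Q = Affine x2 y2"
    by (meson point.exhaust)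
  obtain l where l: "l * (x2 - x1) = y2 - y1"
    "l * (y1 + y2) = x1 ^ 2 + x1 * x2 + x2 ^ 2 + a"
    "ec_add (short a b) (Affine x1 y1) (Affine x2 y2) =
       Affine (l ^ 2 - x1 - x2) (- (y1 + l * (l ^ 2 - x1 - x2 - x1)))"
    using ec_add_slope P Q False unfolding PQ by metis
  have y1: "y1 ^ 2 = x1 ^ 3 + a * x1 + b" using P unfolding PQ by simp
  show ?thesis
    unfolding PQ l(3) using line_meets_cubic[OF y1 l(1,2), of "l ^ 2 - x1 - x2"]
    unfolding on_short_iff power2_minus by simp
qed

lemma ec_add_commute:
  fixes a b :: "'a::field_char_0"
  assumes P: "on_curve (short a b) P" and Q: "on_curve (short a b) Q"
  shows "ec_add (short a b) P Q = ec_add (short a b) Q P"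
proof (cases "P = Infinity \<or> Q = Infinity \<or> Q = ec_neg P")
  case True
  then show ?thesis by (metis ec_add_Infinity_right ec_add_neg ec_neg_neg ec_add.simps(1))
next
  case False
  then obtain x1 y1 x2 y2 where PQ: "P = Affine x1 y1" "Q = Affine x2 y2"
    by (meson point.exhaust)
  obtain l where l: "l * (x2 - x1) = y2 - y1"
    "l * (y1 + y2) = x1 ^ 2 + x1 * x2 + x2 ^ 2 + a"
    "ec_add (short a b) (Affine x1 y1) (Affine x2 y2) =
       Affine (l ^ 2 - x1 - x2) (- (y1 + l * (l ^ 2 - x1 - x2 - x1)))"
    using ec_add_slope P Q False unfolding PQ by metis
  have "Affine x1 y1 \<noteq> ec_neg (Affine x2 y2)" using False PQ by auto
  then obtain m where m: "m * (x1 - x2) = y1 - y2"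
    "m * (y2 + y1) = x2 ^ 2 + x2 * x1 + x1 ^ 2 + a"
    "ec_add (short a b) (Affine x2 y2) (Affine x1 y1) =
       Affine (m ^ 2 - x2 - x1) (- (y2 + m * (m ^ 2 - x2 - x1 - x2)))"
    using ec_add_slope P Q unfolding PQ by metis
  have "m * (x2 - x1) = - (m * (x1 - x2))" by (simp add: algebra_simps)
  then have "(m - l) * (x2 - x1) = 0" unfolding m(1) using l(1) by (simp add: left_diff_distrib)
  moreover have "(m - l) * (y1 + y2) = 0" using l(2) m(2) by (simp add: left_diff_distrib add.commute mult.commute)
  ultimately have "m = l" using False unfolding PQ by (auto simp: eq_neg_iff_add_eq_0 add.commute)
  then show ?thesis unfolding PQ l(3) m(3) using l(1) by (simp add: algebra_simps)
qed

section \<open>Associativity of the group law\<close>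

text \<open>
  The coordinate ring of the curve is realised inside an algebraic closure of the field of rational
  functions in x, where the cubic has a square root.
\<close>

definition emb :: "'a::field poly \<Rightarrow> 'a poly fract alg_closure" where
  "emb p = to_ac (to_fract p)"

lemma emb_simps [simp]:
  "emb 0 = 0" "emb 1 = 1" "emb (p + q) = emb p + emb q" "emb (p - q) = emb p - emb q"
  "emb (- p) = - emb p" "emb (p * q) = emb p * emb q" "emb p = emb q \<longleftrightarrow> p = q" "emb p = 0 \<longleftrightarrow> p = 0"
  "emb (p ^ n) = emb p ^ n"
  by (simp_all add: emb_def) (induction n, simp_all)

definition curve_poly :: "'a::field \<Rightarrow> 'a \<Rightarrow> 'a poly" where
  "curve_poly a b = [:b, a, 0, 1:]"

lemma poly_curve_poly [simp]: "poly (curve_poly a b) x = x ^ 3 + a * x + b"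
  by (simp add: curve_poly_def algebra_simps power3_eq_cube)

lemma degree_curve_poly [simp]: "degree (curve_poly a b) = 3"
  by (simp add: curve_poly_def)

lemma curve_poly_nz [simp]: "curve_poly a b \<noteq> 0"
  by (simp add: curve_poly_def)

text \<open>
  The degree of the left side is even, that of the right side is odd. So the cubic is not a square
  in the field of rational functions, and 1 and y are independent over it.
\<close>

lemma square_eq_cubic_mult_square:
  fixes A B :: "'a::field poly"
  assumes "A ^ 2 = curve_poly a b * B ^ 2"
  shows "A = 0 \<and> B = 0"
proof (rule ccontr)
  assume "\<not> ?thesis"
  then have "B \<noteq> 0" "A \<noteq> 0" using assms by auto
  then have "2 * degree A = 3 + 2 * degree B"
    using arg_cong[OF assms, of degree] by (simp add: degree_mult_eq degree_power_eq)
  then show False by presburger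
qed

context
  fixes a b :: "'a::field_char_0"
begin

definition gen_y :: "'a poly fract alg_closure" where
  "gen_y = (SOME y. y ^ 2 = emb (curve_poly a b))"

lemma gen_y_square: "gen_y ^ 2 = emb (curve_poly a b)"
  unfolding gen_y_def by (rule someI_ex) (rule nth_root_exists, simp)

definition coord_ring :: "'a poly fract alg_closure set" where
  "coord_ring = {emb A + gen_y * emb B | A B. True}"

lemma coord_ring_emb: "emb A \<in> coord_ring"
  unfolding coord_ring_def by (rule CollectI, rule exI[of _ A], rule exI[of _ 0]) simp

lemma coord_ring_gen_y: "gen_y \<in> coord_ring"
  unfolding coord_ring_def by (rule CollectI, rule exI[of _ 0], rule exI[of _ 1]) simp

lemma coord_ring_add: "u \<in> coord_ring \<Longrightarrow> v \<in> coord_ring \<Longrightarrow> u + v \<in> coord_ring"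
  unfolding coord_ring_def
proof clarify
  fix A B A' B'
  show "\<exists>C D. emb A + gen_y * emb B + (emb A' + gen_y * emb B') = emb C + gen_y * emb D \<and> True"
    by (rule exI[of _ "A + A'"], rule exI[of _ "B + B'"]) (simp add: algebra_simps)
qed

lemma coord_ring_mult: "u \<in> coord_ring \<Longrightarrow> v \<in> coord_ring \<Longrightarrow> u * v \<in> coord_ring"
  unfolding coord_ring_def
proof clarify
  fix A B A' B'
  have "(emb A + gen_y * emb B) * (emb A' + gen_y * emb B') =
    emb A * emb A' + gen_y ^ 2 * (emb B * emb B') + gen_y * (emb A * emb B' + emb A' * emb B)"
    by (simp add: algebra_simps power2_eq_square)
  then show "\<exists>C D. (emb A + gen_y * emb B) * (emb A' + gen_y * emb B') = emb C + gen_y * emb D \<and> True"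
    by (intro exI[of _ "A * A' + curve_poly a b * (B * B')"] exI[of _ "A * B' + A' * B"])
       (simp add: gen_y_square)
qed

lemma coord_ring_diff: "u \<in> coord_ring \<Longrightarrow> v \<in> coord_ring \<Longrightarrow> u - v \<in> coord_ring"
  using coord_ring_add[of u "emb (-1) * v"] coord_ring_mult[of "emb (-1)" v] coord_ring_emb[of "-1"]
  by simp

lemma coord_ring_unique:
  assumes "emb A + gen_y * emb B = emb A' + gen_y * emb B'"
  shows "A = A'" "B = B'"
proof -
  have "emb (A - A') = gen_y * emb (B' - B)" using assms by (simp add: algebra_simps)
  then have "emb ((A - A') ^ 2) = emb (curve_poly a b * (B' - B) ^ 2)"
    by (simp add: power_mult_distrib gen_y_square del: emb_simps(4))
  then have "A - A' = 0 \<and> B' - B = 0" using square_eq_cubic_mult_square emb_simps(7) by blast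
  then show "A = A'" "B = B'" by auto
qed

text \<open>
  The module over the coordinate ring that S generates. For subsets of the ring it is an ideal.
\<close>

inductive_set rspan for S where
  rspan_0: "0 \<in> rspan S"
| rspan_step: "g \<in> coord_ring \<Longrightarrow> s \<in> S \<Longrightarrow> t \<in> rspan S \<Longrightarrow> g * s + t \<in> rspan S"

lemma rspan_add: "u \<in> rspan S \<Longrightarrow> v \<in> rspan S \<Longrightarrow> u + v \<in> rspan S"
  by (induction rule: rspan.induct) (auto intro: rspan.intros simp: add.assoc)

lemma rspan_mult: "u \<in> rspan S \<Longrightarrow> g \<in> coord_ring \<Longrightarrow> g * u \<in> rspan S"
proof (induction rule: rspan.induct)
  case (rspan_step h s t)
  then have "(g * h) * s + g * t \<in> rspan S"
    by (intro rspan.intros coord_ring_mult)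
  then show ?case by (simp add: algebra_simps)
qed (auto intro: rspan.intros)

lemma rspan_base: "s \<in> S \<Longrightarrow> s \<in> rspan S"
  using rspan_step[OF coord_ring_emb[of 1], of s S 0] by (simp add: rspan_0)

lemma rspan_diff: "u \<in> rspan S \<Longrightarrow> v \<in> rspan S \<Longrightarrow> u - v \<in> rspan S"
  using rspan_add[of u S "emb (-1) * v"] rspan_mult[of v S "emb (-1)"] coord_ring_emb[of "-1"] by simp

lemma rspan_least:
  assumes "S \<subseteq> rspan T"
  shows "rspan S \<subseteq> rspan T"
proof
  fix u assume "u \<in> rspan S"
  then show "u \<in> rspan T"
    using assms by (induction rule: rspan.induct) (auto intro: rspan_0 rspan_add rspan_mult)
qed

lemma rspan_eqI: "S \<subseteq> rspan T \<Longrightarrow> T \<subseteq> rspan S \<Longrightarrow> rspan S = rspan T"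
  using rspan_least by blast

lemma rspan_times_mono:
  assumes "S \<subseteq> rspan T"
  shows "S * U \<subseteq> rspan (T * U)"
proof
  fix z assume "z \<in> S * U"
  then obtain s u where z: "z = s * u" "s \<in> S" "u \<in> U" by (auto elim: set_times_elim)
  have "s \<in> rspan T" using z assms by auto
  then have "s * u \<in> rspan (T * U)"
  proof (induction rule: rspan.induct)
    case (rspan_step g s t)
    then have "g * (s * u) + t * u \<in> rspan (T * U)"
      by (intro rspan.intros set_times_intro z)
    then show ?case by (simp add: algebra_simps)
  qed (auto intro: rspan_0)
  then show "z \<in> rspan (T * U)" using z by simp
qed

lemma rspan_times_cong:
  assumes "rspan S = rspan T"
  shows "rspan (S * U) = rspan (T * U)"
proof (rule rspan_eqI)
  have "S \<subseteq> rspan T" "T \<subseteq> rspan S" using assms rspan_base by blast+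
  then show "S * U \<subseteq> rspan (T * U)" "T * U \<subseteq> rspan (S * U)"
    using rspan_times_mono by blast+
qed

text \<open>
  Equality of classes of fractional ideals, expressed on generators: products of ideals are then
  products of sets, which are associative and commutative.
\<close>

definition same_class where
  "same_class S T \<longleftrightarrow> (\<exists>t. t \<noteq> 0 \<and> rspan ({t} * S) = rspan T)"

lemma same_class_refl: "same_class S S"
  unfolding same_class_def
  by (rule exI[of _ 1]) (simp add: set_times_def)

lemma singleton_times: "{s} * {t :: 'b :: times} = {s * t}"
  by (simp add: set_times_def)

lemma singleton_one_times: "{1 :: 'b :: monoid_mult} * S = S"
  by (simp add: set_times_def)

lemma same_class_sym:
  assumes "same_class S T"
  shows "same_class T S"
proof -
  obtain t where t: "t \<noteq> 0" "rspan ({t} * S) = rspan T"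
    using assms unfolding same_class_def by blast
  have "rspan ({t} * S * {inverse t}) = rspan (T * {inverse t})"
    by (rule rspan_times_cong) (rule t)
  moreover have "{t} * S * {inverse t} = {t} * {inverse t} * S"
    by (simp only: ac_simps)
  ultimately have "rspan (T * {inverse t}) = rspan S"
    using t(1) by (simp add: singleton_times singleton_one_times)
  then have "rspan ({inverse t} * T) = rspan S" by (simp only: mult.commute)
  then show ?thesis unfolding same_class_def using t(1) by (intro exI[of _ "inverse t"]) auto
qed

lemma same_class_trans:
  assumes "same_class S T" "same_class T U"
  shows "same_class S U"
proof -
  obtain t where t: "t \<noteq> 0" "rspan ({t} * S) = rspan T"
    using assms unfolding same_class_def by blast
  obtain u where u: "u \<noteq> 0" "rspan ({u} * T) = rspan U"
    using assms unfolding same_class_def by blast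
  have "rspan ({t} * S * {u}) = rspan (T * {u})"
    by (rule rspan_times_cong) (rule t)
  moreover have "{t} * S * {u} = {t} * {u} * S" by (simp only: ac_simps)
  ultimately have "rspan ({t * u} * S) = rspan U"
    using u by (simp add: singleton_times mult.commute)
  then show ?thesis unfolding same_class_def using t(1) u(1) by (intro exI[of _ "t * u"]) auto
qed

lemma same_class_times:
  assumes "same_class S T"
  shows "same_class (S * U) (T * U)"
proof -
  obtain t where t: "t \<noteq> 0" "rspan ({t} * S) = rspan T"
    using assms unfolding same_class_def by blast
  have "rspan ({t} * S * U) = rspan (T * U)"
    by (rule rspan_times_cong) (rule t)
  then show ?thesis unfolding same_class_def using t(1) by (intro exI[of _ t]) (simp add: mult.assoc)
qed

lemma same_class_rspanI: "rspan S = rspan T \<Longrightarrow> same_class S T"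
  unfolding same_class_def by (rule exI[of _ 1]) (simp add: singleton_one_times)

text \<open>
  Generators of the maximal ideal of functions that vanish at the point. The point at infinity is not
  on the affine curve and corresponds to the unit ideal.
\<close>

fun ideal_gens :: "'a point \<Rightarrow> 'a poly fract alg_closure set" where
  "ideal_gens Infinity = {1}"
| "ideal_gens (Affine p q) = {emb [:- p, 1:], gen_y - emb [:q:]}"

lemma times_singleton_one: "S * {1 :: 'b :: monoid_mult} = S"
  by (simp add: set_times_def)

lemma insert_times_insert:
  "{s, t :: 'b :: times} * {u, v} = {s * u, s * v, t * u, t * v}"
  by (auto simp: set_times_def)

lemmas rspan_rules = rspan_add rspan_diff rspan_mult rspan_base coord_ring_emb coord_ring_gen_y
  coord_ring_add coord_ring_diff coord_ring_mult

lemma rspan_const_cancel: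
  assumes "emb [:c:] * u \<in> rspan S" "c \<noteq> 0"
  shows "u \<in> rspan S"
proof -
  have "emb [:inverse c:] * (emb [:c:] * u) = (emb ([:inverse c:] * [:c:])) * u"
    by (simp only: emb_simps mult.assoc)
  also have "[:inverse c:] * [:c:] = 1" using assms(2) by (simp add: one_pCons)
  also have "emb 1 * u = u" by simp
  finally show ?thesis using rspan_mult[OF assms(1) coord_ring_emb, of "[:inverse c:]"] by (simp only:)
qed

text \<open>
  Instead of y - q, the equation of any line through the point can serve as the second generator.
\<close>

lemma rspan_ideal_gens_line:
  "rspan {emb [:- p, 1:], gen_y - emb [:q - l * p, l:]} = rspan (ideal_gens (Affine p q))"
proof (rule rspan_eqI)
  have 1: "gen_y - emb [:q - l * p, l:] = (gen_y - emb [:q:]) - emb [:l:] * emb [:- p, 1:]"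
    by (simp add: mult.commute flip: emb_simps)
  have 2: "gen_y - emb [:q:] = (gen_y - emb [:q - l * p, l:]) + emb [:l:] * emb [:- p, 1:]"
    unfolding 1 by simp
  let ?G = "ideal_gens (Affine p q)" and ?H = "{emb [:- p, 1:], gen_y - emb [:q - l * p, l:]}"
  have "emb [:- p, 1:] \<in> rspan ?G" "gen_y - emb [:q:] \<in> rspan ?G"
    by (rule rspan_base, simp)+
  then show "?H \<subseteq> rspan ?G"
    unfolding 1 by (simp only: insert_subset empty_subsetI rspan_diff rspan_mult coord_ring_emb simp_thms)
  have "emb [:- p, 1:] \<in> rspan ?H" "gen_y - emb [:q - l * p, l:] \<in> rspan ?H"
    by (rule rspan_base, blast)+
  then show "?G \<subseteq> rspan ?H"
    unfolding ideal_gens.simps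
    by (subst 2) (simp only: insert_subset empty_subsetI rspan_add rspan_mult coord_ring_emb simp_thms)
qed

text \<open>
  The functions x - p and y^2 - q^2 are both divisible by x - p, and the vertical line meets the curve
  in P and its negative only: the product of their ideals is generated by x - p. That x - p itself
  lies in the product follows from (y + q) - (y - q) = 2 q, or, at a point of order 2, from the fact
  that p is a simple root of the cubic.
\<close>

lemma ideal_gens_times_neg:
  assumes "4 * a ^ 3 + 27 * b ^ 2 \<noteq> 0" "on_curve (short a b) P"
  shows "same_class (ideal_gens P * ideal_gens (ec_neg P)) {1}"
proof (cases P)
  case Infinity
  then show ?thesis by (simp add: singleton_times same_class_refl)
next
  case (Affine p q)
  define Z where "Z = emb [:- p, 1:]"
  define c where "c = emb [:p ^ 2 + a, p, 1:]"
  let ?u = "gen_y - emb [:q:]" and ?v = "gen_y + emb [:q:]"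
  have q: "q ^ 2 = p ^ 3 + a * p + b" using assms(2) unfolding Affine by simp
  have "curve_poly a b - [:q:] ^ 2 = [:- p, 1:] * [:p ^ 2 + a, p, 1:]"
    by (rule poly_eq_poly_eq_iff[THEN iffD1])
       (use q in \<open>auto simp: fun_eq_iff algebra_simps power2_eq_square power3_eq_cube\<close>)
  then have uv: "?u * ?v = Z * c"
    unfolding Z_def c_def by (simp add: algebra_simps gen_y_square flip: power2_eq_square emb_simps(6,9,4))
  have ideal_gens: "ideal_gens P * ideal_gens (ec_neg P) = {Z * Z, Z * ?v, ?u * Z, ?u * ?v}"
  proof -
    have "emb [:- q:] = - emb [:q:]" by (simp flip: emb_simps)
    then show ?thesis unfolding Affine by (simp add: Z_def insert_times_insert)
  qed
  have sub: "{Z * Z, Z * ?v, ?u * Z, Z * c} \<subseteq> rspan {Z}"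
  proof -
    have Z: "Z \<in> rspan {Z}" by (rule rspan_base) simp
    have "Z * Z \<in> rspan {Z}" "?v * Z \<in> rspan {Z}" "?u * Z \<in> rspan {Z}" "c * Z \<in> rspan {Z}"
      by (rule rspan_mult[OF Z], simp add: Z_def c_def coord_ring_emb coord_ring_gen_y coord_ring_add coord_ring_diff)+
    then show ?thesis by (simp add: mult.commute)
  qed
  let ?S = "{Z * Z, Z * ?v, ?u * Z, Z * c}"
  have "Z \<in> rspan ?S"
  proof (cases "q = 0")
    case False
    have "emb [:2 * q:] * Z = Z * ?v - ?u * Z"
    proof -
      have "emb [:2 * q:] = emb [:q:] + emb [:q:]" by (simp flip: emb_simps(3))
      then show ?thesis by (simp add: algebra_simps)
    qed
    also have "\<dots> \<in> rspan ?S" by (intro rspan_diff rspan_base) auto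
    finally show ?thesis by (rule rspan_const_cancel) (use False in simp)
  next
    case True
    have "3 * p ^ 2 + a \<noteq> 0"
    proof
      assume "3 * p ^ 2 + a = 0"
      then have "a = - 3 * p ^ 2" by (simp add: add_eq_0_iff2)
      moreover from this have "b = 2 * p ^ 3" using q True by (simp add: power2_eq_square power3_eq_cube)
      ultimately show False using assms(1) by (simp add: power2_eq_square power3_eq_cube)
    qed
    moreover have "emb [:3 * p ^ 2 + a:] * Z = Z * c - emb [:2 * p, 1:] * (Z * Z)"
    proof -
      have "[:3 * p ^ 2 + a:] = [:p ^ 2 + a, p, 1:] - [:2 * p, 1:] * [:- p, 1:]"
        by (simp add: power2_eq_square)
      then show ?thesis unfolding Z_def c_def by (simp only: emb_simps) (simp add: algebra_simps)
    qed
    moreover have "Z * c - emb [:2 * p, 1:] * (Z * Z) \<in> rspan ?S"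
      by (intro rspan_diff rspan_mult rspan_base coord_ring_emb) auto
    ultimately show ?thesis using rspan_const_cancel by metis
  qed
  then have "rspan {Z} = rspan ?S" using sub by (intro rspan_eqI) auto
  then have "rspan ({Z} * {1}) = rspan (ideal_gens P * ideal_gens (ec_neg P))"
    unfolding ideal_gens uv by (simp add: singleton_times)
  moreover have "Z \<noteq> 0" by (simp add: Z_def)
  ultimately have "same_class {1} (ideal_gens P * ideal_gens (ec_neg P))"
    unfolding same_class_def by blast
  then show ?thesis by (rule same_class_sym)
qed

text \<open>
  Let m = y - l(x) be the line through P and Q, n = y + l(x) its mirror image, and X1, X2, X3 the
  functions x - x1, x - x2, x - x3, with x3 the coordinate of the third point of intersection. Then
  m n = X1 X2 X3. The ideals of P, Q and P + Q are (X1, m), (X2, m) and (X3, n), and the computation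
  X3 (X1, m) (X2, m) = m (X3, n) gives the claim.
\<close>

lemma ideal_gens_add:
  assumes ns: "4 * a ^ 3 + 27 * b ^ 2 \<noteq> 0"
    and P: "on_curve (short a b) P" and Q: "on_curve (short a b) Q"
  shows "same_class (ideal_gens P * ideal_gens Q) (ideal_gens (ec_add (short a b) P Q))"
proof (cases "P = Infinity \<or> Q = Infinity \<or> Q = ec_neg P")
  case True
  then show ?thesis
    using ideal_gens_times_neg[OF ns P] same_class_refl
    by (elim disjE) (simp_all add: singleton_one_times times_singleton_one)
next
  case False
  then obtain x1 y1 x2 y2 where PQ: "P = Affine x1 y1" "Q = Affine x2 y2"
    by (meson point.exhaust)
  obtain l where l: "l * (x2 - x1) = y2 - y1"
    "l * (y1 + y2) = x1 ^ 2 + x1 * x2 + x2 ^ 2 + a"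
    "ec_add (short a b) (Affine x1 y1) (Affine x2 y2) =
       Affine (l ^ 2 - x1 - x2) (- (y1 + l * (l ^ 2 - x1 - x2 - x1)))"
    using ec_add_slope P Q False unfolding PQ by metis
  define x3 where "x3 = l ^ 2 - x1 - x2"
  define L where "L = [:y1 - l * x1, l:]"
  define X1 X2 X3 where X: "X1 = emb [:- x1, 1:]" "X2 = emb [:- x2, 1:]" "X3 = emb [:- x3, 1:]"
  define m n where mn: "m = gen_y - emb L" "n = gen_y + emb L"
  have y1: "y1 ^ 2 = x1 ^ 3 + a * x1 + b" using P unfolding PQ by simp
  have "curve_poly a b - L ^ 2 = [:- x1, 1:] * [:- x2, 1:] * [:- x3, 1:]"
  proof (rule poly_eq_poly_eq_iff[THEN iffD1], rule ext)
    fix x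
    show "poly (curve_poly a b - L ^ 2) x = poly ([:- x1, 1:] * [:- x2, 1:] * [:- x3, 1:]) x"
      using line_meets_cubic[OF y1 l(1,2), of x] unfolding L_def x3_def
      by (simp add: algebra_simps)
  qed
  then have prod: "m * n = X1 * X2 * X3"
    unfolding X mn by (simp add: algebra_simps gen_y_square flip: power2_eq_square emb_simps(6,9,4))
  have "L = [:y2 - l * x2, l:]" using l(1) by (simp add: L_def algebra_simps)
  then have g1: "rspan {X1, m} = rspan (ideal_gens P)" and g2: "rspan {X2, m} = rspan (ideal_gens Q)"
    using rspan_ideal_gens_line[of x1 y1 l] rspan_ideal_gens_line[of x2 y2 l] unfolding PQ X mn L_def by auto
  have "- emb L = emb [:- (y1 + l * (x3 - x1)) - (- l) * x3, - l:]"
    unfolding L_def by (simp add: algebra_simps flip: emb_simps)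
  then have g3: "rspan {X3, n} = rspan (ideal_gens (ec_add (short a b) P Q))"
    using rspan_ideal_gens_line[of x3 "- (y1 + l * (x3 - x1))" "- l"]
    unfolding PQ l(3) X mn x3_def[symmetric] by (metis diff_minus_eq_add)
  let ?S = "{X3 * (X1 * X2), X3 * (X1 * m), X3 * (m * X2), X3 * (m * m)}"
  let ?T = "{m * X3, m * n}"
  have in_ring: "X1 \<in> coord_ring" "X2 \<in> coord_ring" "m \<in> coord_ring" "X3 \<in> coord_ring"
    unfolding X mn by (auto intro: rspan_rules)
  have "?S \<subseteq> rspan ?T"
  proof -
    have T: "m * n \<in> rspan ?T" "m * X3 \<in> rspan ?T" by (auto intro: rspan_base)
    then have "X1 * (m * X3) \<in> rspan ?T" "X2 * (m * X3) \<in> rspan ?T" "m * (m * X3) \<in> rspan ?T"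
      using in_ring rspan_mult by blast+
    with T(1) have "X3 * (X1 * X2) \<in> rspan ?T" "X3 * (X1 * m) \<in> rspan ?T"
      "X3 * (m * X2) \<in> rspan ?T" "X3 * (m * m) \<in> rspan ?T"
      unfolding prod by (simp_all only: ac_simps)
    then show ?thesis by simp
  qed
  moreover have "?T \<subseteq> rspan ?S"
  proof -
    have 1: "m * n \<in> rspan ?S" unfolding prod by (rule rspan_base) (simp add: ac_simps)
    have 2: "X3 * (X1 * m) \<in> rspan ?S" "X3 * (m * X2) \<in> rspan ?S" "X3 * (m * m) \<in> rspan ?S"
      by (auto intro: rspan_base)
    have "m * X3 \<in> rspan ?S"
    proof (cases "x1 = x2")
      case False
      have "emb [:x2 - x1:] * (m * X3) = X3 * (X1 * m) - X3 * (m * X2)"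
      proof -
        have "emb [:x2 - x1:] = X1 - X2" unfolding X by (simp flip: emb_simps)
        then show ?thesis by (simp only: left_diff_distrib right_diff_distrib ac_simps)
      qed
      then show ?thesis using rspan_const_cancel[of "x2 - x1" "m * X3" ?S] rspan_diff[OF 2(1,2)] False by simp
    next
      case True
      then have y12: "y1 = y2" using l(1) by simp
      then have "y1 \<noteq> 0" using False True unfolding PQ by auto
      \<comment> \<open>For a tangent, n - m = 2 l(x) is congruent to the nonzero constant 2 y1 modulo X1.\<close>
      have "emb [:2 * y1:] * (m * X3) = X3 * (m * n) - X3 * (m * m) - emb [:2 * l:] * (X3 * (X1 * m))"
      proof -
        have "emb [:2 * y1:] = n - m - emb [:2 * l:] * X1"
        proof -
          have "[:2 * y1:] = L + L - [:2 * l:] * [:- x1, 1:]" by (simp add: L_def)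
          then have "emb [:2 * y1:] = emb L + emb L - emb [:2 * l:] * X1" unfolding X by (simp only: emb_simps)
          moreover have "n - m = emb L + emb L" unfolding mn by simp
          ultimately show ?thesis by (simp only:)
        qed
        then show ?thesis by (simp only: left_diff_distrib right_diff_distrib ac_simps)
      qed
      also have "\<dots> \<in> rspan ?S"
        by (intro rspan_diff rspan_mult 1 2 in_ring coord_ring_emb)
      finally show ?thesis by (rule rspan_const_cancel) (use \<open>y1 \<noteq> 0\<close> in simp)
    qed
    then show ?thesis using 1 by auto
  qed
  ultimately have ST: "rspan ?S = rspan ?T" by (rule rspan_eqI)
  have "rspan ({X3} * (ideal_gens P * ideal_gens Q)) = rspan ({X3} * ({X1, m} * {X2, m}))"
  proof -
    have "rspan (ideal_gens P * (ideal_gens Q * {X3})) = rspan ({X1, m} * (ideal_gens Q * {X3}))"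
      by (rule rspan_times_cong) (rule g1[symmetric])
    also have "\<dots> = rspan (ideal_gens Q * ({X1, m} * {X3}))" by (simp only: ac_simps)
    also have "\<dots> = rspan ({X2, m} * ({X1, m} * {X3}))"
      by (rule rspan_times_cong) (rule g2[symmetric])
    finally show ?thesis by (simp only: ac_simps)
  qed
  also have "\<dots> = rspan ?T"
  proof -
    have "{X3} * {X1 * X2, X1 * m, m * X2, m * m} = ?S" by (auto simp: set_times_def)
    then show ?thesis using ST unfolding insert_times_insert by simp
  qed
  also have "?T = {X3, n} * {m}" by (auto simp: set_times_def)
  also have "rspan \<dots> = rspan (ideal_gens (ec_add (short a b) P Q) * {m})"
    by (rule rspan_times_cong) (rule g3)
  finally have eq: "rspan ({X3} * (ideal_gens P * ideal_gens Q)) = rspan ({m} * ideal_gens (ec_add (short a b) P Q))"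
    by (simp only: ac_simps)
  have "m \<noteq> 0"
  proof
    assume "m = 0"
    then have "emb 0 + gen_y * emb 1 = emb L + gen_y * emb 0" unfolding mn by simp
    then show False using coord_ring_unique(2) zero_neq_one by metis
  qed
  moreover have "X3 \<noteq> 0" unfolding X by simp
  moreover note same_class_rspanI[OF eq]
  moreover have "s \<noteq> 0 \<Longrightarrow> same_class S ({s} * S)" for s S unfolding same_class_def by auto
  ultimately show ?thesis by (meson same_class_trans same_class_sym)
qed

text \<open>
  The norm of A + y B is A^2 - (x^3 + a x + b) B^2, and its degree is at least 3 if B \<noteq> 0. The norm of
  x - p has degree 2, so a generator of the ideal, which divides x - p, is a polynomial A in x. It is
  not constant, because the ideal is proper, and a polynomial that is not constant does not divide
  y - q.
\<close>

lemma ideal_gens_not_principal: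
  assumes "on_curve (short a b) (Affine p q)"
  shows "\<not> same_class (ideal_gens (Affine p q)) {1}"
proof
  have q: "q ^ 2 = p ^ 3 + a * p + b" using assms by simp
  assume "same_class (ideal_gens (Affine p q)) {1}"
  then have "same_class {1} (ideal_gens (Affine p q))" by (rule same_class_sym)
  then obtain s where s: "s \<noteq> 0" "rspan {s} = rspan (ideal_gens (Affine p q))"
    unfolding same_class_def by (auto simp: singleton_times)
  have mult: "\<exists>h\<in>coord_ring. u = s * h" if "u \<in> rspan {s}" for u
    using that
  proof (induction rule: rspan.induct)
    case rspan_0
    then show ?case using coord_ring_emb[of 0] by force
  next
    case (rspan_step g s' t)
    then obtain h where "h \<in> coord_ring" "t = s * h" by blast
    then show ?case using rspan_step coord_ring_add
      by (intro bexI[of _ "g + h"]) (auto simp: algebra_simps)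
  qed
  have ideal_sub: "rspan (ideal_gens (Affine p q)) \<subseteq> {emb [:- p, 1:] * g + (gen_y - emb [:q:]) * h | g h. g \<in> coord_ring \<and> h \<in> coord_ring}"
    (is "_ \<subseteq> ?M")
  proof
    fix u assume "u \<in> rspan (ideal_gens (Affine p q))"
    then show "u \<in> ?M"
    proof (induction rule: rspan.induct)
      case rspan_0
      then show ?case using coord_ring_emb[of 0] by force
    next
      case (rspan_step k s' t)
      then obtain g h where gh: "g \<in> coord_ring" "h \<in> coord_ring"
        "t = emb [:- p, 1:] * g + (gen_y - emb [:q:]) * h" by blast
      from rspan_step(2) consider "s' = emb [:- p, 1:]" | "s' = gen_y - emb [:q:]" by auto
      then show ?case
      proof cases
        case 1
        then have "k * s' + t = emb [:- p, 1:] * (k + g) + (gen_y - emb [:q:]) * h"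
          using gh by (simp add: algebra_simps)
        then show ?thesis using gh rspan_step coord_ring_add by blast
      next
        case 2
        then have "k * s' + t = emb [:- p, 1:] * g + (gen_y - emb [:q:]) * (k + h)"
          unfolding gh(3) 2 by (simp only: algebra_simps)
        then show ?thesis using gh rspan_step coord_ring_add by blast
      qed
    qed
  qed
  \<comment> \<open>Evaluation at the point (p, q), carried out on the coefficients of 1 and y.\<close>
  have one: "1 \<notin> rspan (ideal_gens (Affine p q))"
  proof
    assume "1 \<in> rspan (ideal_gens (Affine p q))"
    then obtain A B C D where
      "1 = emb [:- p, 1:] * (emb A + gen_y * emb B) + (gen_y - emb [:q:]) * (emb C + gen_y * emb D)"
      using ideal_sub unfolding coord_ring_def by blast
    also have "\<dots> = emb ([:- p, 1:] * A - [:q:] * C) + gen_y ^ 2 * emb D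
       + gen_y * emb ([:- p, 1:] * B + C - [:q:] * D)"
      unfolding emb_simps by (simp only: algebra_simps power2_eq_square)
    finally have "emb 1 + gen_y * emb 0 = emb ([:- p, 1:] * A - [:q:] * C + curve_poly a b * D)
       + gen_y * emb ([:- p, 1:] * B + C - [:q:] * D)"
      by (simp add: gen_y_square)
    from coord_ring_unique[OF this]
    have "poly 1 p = poly ([:- p, 1:] * A - [:q:] * C + curve_poly a b * D) p"
      "poly 0 p = poly ([:- p, 1:] * B + C - [:q:] * D) p"
      by simp_all
    then have "1 = - q * poly C p + q ^ 2 * poly D p" "poly C p = q * poly D p"
      by (simp_all add: q)
    then show False by (simp add: power2_eq_square)
  qed
  have "s \<in> rspan (ideal_gens (Affine p q))" using s(2) rspan_base[of s "{s}"] by auto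
  then have "s \<in> coord_ring"
    using ideal_sub by (auto intro!: rspan_rules)
  then obtain A B where sAB: "s = emb A + gen_y * emb B" unfolding coord_ring_def by blast
  have mem: "emb [:- p, 1:] \<in> rspan {s}" "gen_y - emb [:q:] \<in> rspan {s}"
    unfolding s(2) by (rule rspan_base; simp)+
  obtain C D where CD: "emb [:- p, 1:] = s * (emb C + gen_y * emb D)"
    using mult[OF mem(1)] unfolding coord_ring_def by blast
  have expand: "s * (emb C + gen_y * emb D) = emb (A * C + curve_poly a b * (B * D)) + gen_y * emb (A * D + B * C)" for C D
  proof -
    have "s * (emb C + gen_y * emb D) = emb A * emb C + gen_y ^ 2 * (emb B * emb D)
       + gen_y * (emb A * emb D + emb B * emb C)"
      unfolding sAB by (simp add: algebra_simps power2_eq_square)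
    then show ?thesis by (simp add: gen_y_square)
  qed
  have "emb [:- p, 1:] + gen_y * emb 0 = emb (A * C + curve_poly a b * (B * D)) + gen_y * emb (A * D + B * C)"
    using CD unfolding expand by simp
  note 1 = coord_ring_unique[OF this]
  \<comment> \<open>Norms are multiplicative, and x - p has the norm (x - p)^2.\<close>
  have norm: "[:- p, 1:] ^ 2 = (A ^ 2 - curve_poly a b * B ^ 2) * (C ^ 2 - curve_poly a b * D ^ 2)"
  proof -
    have "(A ^ 2 - curve_poly a b * B ^ 2) * (C ^ 2 - curve_poly a b * D ^ 2) =
      (A * C + curve_poly a b * (B * D)) ^ 2 - curve_poly a b * (A * D + B * C) ^ 2"
      by (simp add: algebra_simps power2_eq_square)
    then show ?thesis using 1 by simp
  qed
  \<comment> \<open>No cancellation of leading terms can occur, as 2 deg U is even and 3 + 2 deg V is odd.\<close>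
  have deg_norm: "degree (U ^ 2 - curve_poly a b * V ^ 2) = max (2 * degree U) (3 + 2 * degree V)"
    if "V \<noteq> 0" for U V
  proof -
    have "degree (curve_poly a b * V ^ 2) = 3 + 2 * degree V"
      using that by (simp add: degree_mult_eq degree_power_eq)
    moreover have "degree (U ^ 2) = 2 * degree U"
      by (cases "U = 0") (auto simp: degree_power_eq)
    moreover have "2 * degree U \<noteq> 3 + 2 * degree V" by presburger
    ultimately consider "degree (U ^ 2) < degree (curve_poly a b * V ^ 2)"
        "max (2 * degree U) (3 + 2 * degree V) = degree (curve_poly a b * V ^ 2)"
      | "degree (curve_poly a b * V ^ 2) < degree (U ^ 2)"
        "max (2 * degree U) (3 + 2 * degree V) = degree (U ^ 2)"
      by linarith
    then show ?thesis
      using degree_add_eq_right[of "U ^ 2" "- (curve_poly a b * V ^ 2)"]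
        degree_add_eq_left[of "- (curve_poly a b * V ^ 2)" "U ^ 2"]
      by cases simp_all
  qed
  have nz: "A ^ 2 - curve_poly a b * B ^ 2 \<noteq> 0" "C ^ 2 - curve_poly a b * D ^ 2 \<noteq> 0"
    using norm by auto
  have deg2: "degree (A ^ 2 - curve_poly a b * B ^ 2) + degree (C ^ 2 - curve_poly a b * D ^ 2) = 2"
    using arg_cong[OF norm, of degree] nz by (simp add: degree_mult_eq degree_power_eq)
  then have BD: "B = 0" "D = 0" using deg_norm by force+
  then have deg: "degree A + degree C = 1"
    using deg2 nz by (simp add: degree_power_eq)
  have "degree A \<noteq> 0"
  proof
    assume "degree A = 0"
    then obtain k where k: "A = [:k:]" by (rule degree_eq_zeroE)
    then have "k \<noteq> 0" using nz BD by auto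
    then have "1 = emb [:inverse k:] * s"
    proof -
      have "[:inverse k:] * [:k:] = 1" using \<open>k \<noteq> 0\<close> by (simp add: one_pCons)
      then have "emb [:inverse k:] * emb [:k:] = 1" by (simp only: emb_simps flip: emb_simps(6))
      then show ?thesis using k BD sAB by simp
    qed
    moreover have "emb [:inverse k:] * s \<in> rspan {s}"
      by (intro rspan_mult rspan_base coord_ring_emb) auto
    ultimately show False using one s(2) by simp
  qed
  then have "degree A = 1" using deg by simp
  obtain U V where "gen_y - emb [:q:] = s * (emb U + gen_y * emb V)"
    using mult[OF mem(2)] unfolding coord_ring_def by blast
  then have "emb (- [:q:]) + gen_y * emb 1 = emb (A * U + curve_poly a b * (B * V)) + gen_y * emb (A * V + B * U)"
    unfolding expand by (simp del: minus_pCons)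
  from coord_ring_unique(2)[OF this] have "1 = A * V" using BD by simp
  then show False using \<open>degree A = 1\<close> by (metis degree_mult_eq degree_1 add_is_0 mult_zero_left mult_zero_right zero_neq_one one_neq_zero)
qed

text \<open>
  Points with the same ideal class are equal, because otherwise the ideal of their difference would
  be principal and belong to an affine point. Both sides of the equation have the class of the
  product of the three ideals.
\<close>

lemma ec_add_assoc:
  assumes ns: "4 * a ^ 3 + 27 * b ^ 2 \<noteq> 0"
    and PQR: "on_curve (short a b) P" "on_curve (short a b) Q" "on_curve (short a b) R"
  shows "ec_add (short a b) (ec_add (short a b) P Q) R = ec_add (short a b) P (ec_add (short a b) Q R)"
proof -
  let ?add = "ec_add (short a b)"
  have inj: "U = V" if U: "on_curve (short a b) U" and V: "on_curve (short a b) V"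
    and UV: "same_class (ideal_gens U) (ideal_gens V)" for U V
  proof -
    have nV: "on_curve (short a b) (ec_neg V)" using V by simp
    have "same_class (ideal_gens (?add U (ec_neg V))) (ideal_gens U * ideal_gens (ec_neg V))"
      by (rule same_class_sym) (rule ideal_gens_add[OF ns U nV])
    moreover have "same_class (ideal_gens U * ideal_gens (ec_neg V)) (ideal_gens V * ideal_gens (ec_neg V))"
      by (rule same_class_times[OF UV])
    moreover have "same_class (ideal_gens V * ideal_gens (ec_neg V)) {1}" by (rule ideal_gens_times_neg[OF ns V])
    ultimately have "same_class (ideal_gens (?add U (ec_neg V))) {1}" by (meson same_class_trans)
    then have "?add U (ec_neg V) = Infinity"
      using ideal_gens_not_principal on_curve_add[OF U nV] by (metis point.exhaust)
    then show ?thesis using ec_add_eq_Infinity ec_neg_neg by metis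
  qed
  have triple: "same_class (ideal_gens P' * ideal_gens Q' * ideal_gens R') (ideal_gens (?add (?add P' Q') R'))"
    if "on_curve (short a b) P'" "on_curve (short a b) Q'" "on_curve (short a b) R'" for P' Q' R'
    using same_class_trans[OF same_class_times[OF ideal_gens_add[OF ns that(1,2)]]
      ideal_gens_add[OF ns on_curve_add[OF that(1,2)] that(3)]] .
  have "?add P (?add Q R) = ?add (?add Q R) P"
    using ec_add_commute PQR on_curve_add by blast
  moreover have "ideal_gens Q * ideal_gens R * ideal_gens P = ideal_gens P * ideal_gens Q * ideal_gens R" by (simp only: ac_simps)
  ultimately have "same_class (ideal_gens P * ideal_gens Q * ideal_gens R) (ideal_gens (?add P (?add Q R)))"
    using triple[OF PQR(2,3,1)] by simp
  then have "same_class (ideal_gens (?add (?add P Q) R)) (ideal_gens (?add P (?add Q R)))"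
    by (rule same_class_trans[OF same_class_sym[OF triple[OF PQR]]])
  then show ?thesis by (intro inj on_curve_add PQR)
qed
end

section \<open>Ternary forms and morphisms\<close>

definition is_form :: "nat \<Rightarrow> ('a \<times> 'a \<times> 'a \<Rightarrow> 'a::field) \<Rightarrow> bool" where
  "is_form d g \<longleftrightarrow> (\<exists>c. g = ternary_form d c)"

lemma is_form_monomial:
  assumes "i + j + k = d"
  shows "is_form d (\<lambda>(x, y, z). s * x ^ i * y ^ j * z ^ k)"
proof -
  define c where "c = (\<lambda>i' j'. if j' = j then if i' = i then s else 0 else 0)"
  have "ternary_form d c (x, y, z) = s * x ^ i * y ^ j * z ^ k" for x y z
  proof -
    have "(\<Sum>j'\<le>d - i'. c i' j' * x ^ i' * y ^ j' * z ^ (d - i' - j')) =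
        (if i' = i then s * x ^ i * y ^ j * z ^ k else 0)" if "i' \<le> d" for i'
    proof (cases "i' = i")
      case True
      have "(\<Sum>j'\<le>d - i. c i j' * x ^ i * y ^ j' * z ^ (d - i - j')) =
        (\<Sum>j'\<le>d - i. if j' = j then s * x ^ i * y ^ j * z ^ (d - i - j) else 0)"
        by (rule sum.cong) (auto simp: c_def)
      also have "\<dots> = s * x ^ i * y ^ j * z ^ (d - i - j)" using assms by (subst sum.delta) auto
      also have "d - i - j = k" using assms by auto
      finally show ?thesis using True by simp
    qed (auto simp: c_def)
    then have "ternary_form d c (x, y, z) = (\<Sum>i'\<le>d. if i' = i then s * x ^ i * y ^ j * z ^ k else 0)"
      by simp
    also have "\<dots> = s * x ^ i * y ^ j * z ^ k" using assms by (subst sum.delta) auto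
    finally show ?thesis .
  qed
  then show ?thesis unfolding is_form_def by (intro exI[of _ c]) (auto simp del: ternary_form.simps)
qed

lemma is_form_zero: "is_form d (\<lambda>v. 0)"
proof -
  have "(\<lambda>v. 0) = ternary_form d (\<lambda>_ _. 0 :: 'a::field)" by (auto simp: fun_eq_iff)
  then show ?thesis unfolding is_form_def by blast
qed

lemma is_form_add:
  assumes "is_form d f" "is_form d g"
  shows "is_form d (\<lambda>v. f v + g v)"
proof -
  obtain c c' where c: "f = ternary_form d c" "g = ternary_form d c'"
    using assms unfolding is_form_def by blast
  have "(\<lambda>v. f v + g v) = ternary_form d (\<lambda>i j. c i j + c' i j)"
    unfolding c by (auto simp: fun_eq_iff sum.distrib ring_distribs)
  then show ?thesis unfolding is_form_def by blast
qed

lemma is_form_scale: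
  assumes "is_form d f"
  shows "is_form d (\<lambda>v. k * f v)"
proof -
  obtain c where c: "f = ternary_form d c"
    using assms unfolding is_form_def by blast
  have "(\<lambda>v. k * f v) = ternary_form d (\<lambda>i j. k * c i j)"
    unfolding c by (auto simp: fun_eq_iff sum_distrib_left mult.assoc)
  then show ?thesis unfolding is_form_def by blast
qed

lemma is_form_diff:
  "is_form d f \<Longrightarrow> is_form d g \<Longrightarrow> is_form d (\<lambda>v. f v - g v)"
  using is_form_add[of d f "\<lambda>v. (-1) * g v"] is_form_scale[of d g "-1"] by simp

lemma is_form_sum:
  "(\<And>i. i \<in> A \<Longrightarrow> is_form d (f i)) \<Longrightarrow> is_form d (\<lambda>v. \<Sum>i\<in>A. f i v)"
  by (induction A rule: infinite_finite_induct) (auto intro: is_form_zero is_form_add)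

text \<open>
  Multiplication by a monomial only shifts the coefficients, and every form is a sum of monomials.
  This is the basis for products and compositions.
\<close>

lemma is_form_monomial_mult:
  assumes "is_form e g" "d = i + j + k"
  shows "is_form (d + e) (\<lambda>v. (case v of (x, y, z) \<Rightarrow> s * x ^ i * y ^ j * z ^ k) * g v)"
proof -
  obtain c where c: "g = ternary_form e c"
    using assms unfolding is_form_def by blast
  have "(\<lambda>v. (case v of (x, y, z) \<Rightarrow> s * x ^ i * y ^ j * z ^ k) * g v) = (\<lambda>v. \<Sum>i'\<le>e. \<Sum>j'\<le>e - i'.
     (case v of (x, y, z) \<Rightarrow> (s * c i' j') * x ^ (i + i') * y ^ (j + j') * z ^ (k + (e - i' - j'))))"
  proof
    fix v :: "'a \<times> 'a \<times> 'a"
    obtain x y z where v: "v = (x, y, z)" by (cases v)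
    have "(s * x ^ i * y ^ j * z ^ k) * (\<Sum>i'\<le>e. \<Sum>j'\<le>e - i'. c i' j' * x ^ i' * y ^ j' * z ^ (e - i' - j')) =
      (\<Sum>i'\<le>e. \<Sum>j'\<le>e - i'. (s * c i' j') * x ^ (i + i') * y ^ (j + j') * z ^ (k + (e - i' - j')))"
      unfolding sum_distrib_left power_add by (simp only: ac_simps)
    then show "(case v of (x, y, z) \<Rightarrow> s * x ^ i * y ^ j * z ^ k) * g v = (\<Sum>i'\<le>e. \<Sum>j'\<le>e - i'.
     (case v of (x, y, z) \<Rightarrow> (s * c i' j') * x ^ (i + i') * y ^ (j + j') * z ^ (k + (e - i' - j'))))"
      unfolding v c by simp
  qed
  moreover have "is_form (d + e) \<dots>"
    by (intro is_form_sum is_form_monomial) (auto simp: assms)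
  ultimately show ?thesis by simp
qed

lemma is_form_mult:
  assumes "is_form d f" "is_form e g"
  shows "is_form (d + e) (\<lambda>v. f v * g v)"
proof -
  obtain c where c: "f = ternary_form d c"
    using assms unfolding is_form_def by blast
  have "(\<lambda>v. f v * g v) = (\<lambda>v. \<Sum>i\<le>d. \<Sum>j\<le>d - i.
     (case v of (x, y, z) \<Rightarrow> c i j * x ^ i * y ^ j * z ^ (d - i - j)) * g v)"
    unfolding c by (auto simp: fun_eq_iff sum_distrib_right)
  moreover have "is_form (d + e) \<dots>"
    by (intro is_form_sum is_form_monomial_mult assms) auto
  ultimately show ?thesis by simp
qed

lemma is_form_power: "is_form d f \<Longrightarrow> is_form (n * d) (\<lambda>v. f v ^ n)"
proof (induction n)
  case 0
  have "is_form 0 (\<lambda>(x, y, z). 1 * x ^ 0 * y ^ 0 * z ^ 0 :: 'a)" by (rule is_form_monomial) simp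
  moreover have "(\<lambda>(x, y, z). 1 * x ^ 0 * y ^ 0 * z ^ 0 :: 'a) = (\<lambda>v. 1)" by auto
  ultimately show ?case by simp
next
  case (Suc n)
  then show ?case using is_form_mult[of d f "n * d" "\<lambda>v. f v ^ n"] by simp
qed

lemma is_form_compose:
  assumes "is_form e h" "is_form d g0" "is_form d g1" "is_form d g2"
  shows "is_form (e * d) (\<lambda>v. h (g0 v, g1 v, g2 v))"
proof -
  obtain c where c: "h = ternary_form e c"
    using assms unfolding is_form_def by blast
  have "is_form (e * d) (\<lambda>v. c i j * g0 v ^ i * g1 v ^ j * g2 v ^ (e - i - j))"
    if "i \<le> e" "j \<le> e - i" for i j
  proof -
    have "is_form (i * d + j * d + (e - i - j) * d) (\<lambda>v. g0 v ^ i * g1 v ^ j * g2 v ^ (e - i - j))"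
      by (intro is_form_mult is_form_power assms)
    moreover have "i * d + j * d + (e - i - j) * d = e * d"
      using that by (simp flip: add_mult_distrib)
    ultimately show ?thesis using is_form_scale[of "e * d" _ "c i j"] by (simp add: mult.assoc)
  qed
  then show ?thesis unfolding c by (simp, intro is_form_sum) auto
qed

definition is_form3 :: "nat \<Rightarrow> ('a \<times> 'a \<times> 'a \<Rightarrow> 'a::field \<times> 'a \<times> 'a) \<Rightarrow> bool" where
  "is_form3 d F \<longleftrightarrow> (\<exists>g0 g1 g2. is_form d g0 \<and> is_form d g1 \<and> is_form d g2 \<and> F = (\<lambda>v. (g0 v, g1 v, g2 v)))"

fun smul :: "'a::field \<Rightarrow> 'a \<times> 'a \<times> 'a \<Rightarrow> 'a \<times> 'a \<times> 'a" where
  "smul k (x, y, z) = (k * x, k * y, k * z)"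

lemma same_proj_iff: "same_proj_point u v \<longleftrightarrow> (\<exists>c. c \<noteq> 0 \<and> u = smul c v)"
  by (cases u; cases v) auto

lemma smul_smul [simp]: "smul k (smul l v) = smul (k * l) v"
  by (cases v) (simp add: mult.assoc)

lemma smul_1 [simp]: "smul 1 v = v" by (cases v) auto

lemma smul_eq_0 [simp]: "smul k v = (0, 0, 0) \<longleftrightarrow> k = 0 \<or> v = (0, 0, 0)"
  by (cases v) auto

lemma proj_coords_nz [simp]: "proj_coords P \<noteq> (0, 0, 0)"
  by (cases P) auto

lemma is_form_homogeneous:
  assumes "is_form d g"
  shows "g (smul k v) = k ^ d * g v"
proof -
  obtain c where c: "g = ternary_form d c"
    using assms unfolding is_form_def by blast
  obtain x y z where v: "v = (x, y, z)" by (cases v)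
  have "k ^ d * x ^ i * y ^ j * z ^ (d - i - j) = (k * x) ^ i * (k * y) ^ j * (k * z) ^ (d - i - j)"
    if "i \<le> d" "j \<le> d - i" for i j
  proof -
    have "k ^ d = k ^ i * k ^ j * k ^ (d - i - j)" using that by (simp flip: power_add)
    then show ?thesis by (simp add: power_mult_distrib)
  qed
  then show ?thesis unfolding c v
    by (auto simp: sum_distrib_left ac_simps intro!: sum.cong)
qed

lemma is_form3_homogeneous: "is_form3 d F \<Longrightarrow> F (smul k v) = smul (k ^ d) (F v)"
  unfolding is_form3_def by (auto simp: is_form_homogeneous)

lemma is_form3_compose:
  assumes "is_form3 e H" "is_form3 d F"
  shows "is_form3 (e * d) (\<lambda>v. H (F v))"
proof -
  obtain g0 g1 g2 where g: "is_form d g0" "is_form d g1" "is_form d g2" "F = (\<lambda>v. (g0 v, g1 v, g2 v))"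
    using assms(2) unfolding is_form3_def by blast
  obtain h0 h1 h2 where h: "is_form e h0" "is_form e h1" "is_form e h2" "H = (\<lambda>v. (h0 v, h1 v, h2 v))"
    using assms(1) unfolding is_form3_def by blast
  show ?thesis
    unfolding is_form3_def using is_form_compose[OF h(1) g(1-3)] is_form_compose[OF h(2) g(1-3)] is_form_compose[OF h(3) g(1-3)]
    unfolding g(4) h(4) by blast
qed

text \<open>
  The forms may vanish at some points of the curve, where they say nothing. A morphism needs for
  each point a choice of forms that do not vanish there.
\<close>

definition locally_given :: "'a::field weierstrass \<Rightarrow> ('a point \<Rightarrow> 'a point) \<Rightarrow> nat \<Rightarrow> ('a \<times> 'a \<times> 'a \<Rightarrow> 'a \<times> 'a \<times> 'a) \<Rightarrow> bool" where
  "locally_given E f d F \<longleftrightarrow> is_form3 d F \<and>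
     (\<forall>Q\<in>points E. \<exists>k. F (proj_coords Q) = smul k (proj_coords (f Q)))"

lemma ec_morphism_iff:
  "ec_morphism E f \<longleftrightarrow> f \<in> points E \<rightarrow> points E \<and>
     (\<forall>P\<in>points E. \<exists>d F. locally_given E f d F \<and> F (proj_coords P) \<noteq> (0, 0, 0))"
proof -
  have eq: "(u \<noteq> (0, 0, 0) \<longrightarrow> same_proj_point u (proj_coords R)) \<longleftrightarrow> (\<exists>k. u = smul k (proj_coords R))"
    for u and R :: "'a point"
    unfolding same_proj_iff by (metis smul_eq_0 mult_zero_left smul.simps surj_pair)
  have form3: "is_form3 d F \<longleftrightarrow> (\<exists>c0 c1 c2. F = (\<lambda>v. (ternary_form d c0 v, ternary_form d c1 v, ternary_form d c2 v)))"
    for d and F :: "'a \<times> 'a \<times> 'a \<Rightarrow> 'a \<times> 'a \<times> 'a"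
    unfolding is_form3_def is_form_def by blast
  have "(\<exists>d c0 c1 c2. (ternary_form d c0 (proj_coords P), ternary_form d c1 (proj_coords P),
           ternary_form d c2 (proj_coords P)) \<noteq> (0, 0, 0) \<and>
          (\<forall>Q\<in>points E. \<exists>k. (ternary_form d c0 (proj_coords Q), ternary_form d c1 (proj_coords Q),
           ternary_form d c2 (proj_coords Q)) = smul k (proj_coords (f Q)))) \<longleftrightarrow>
        (\<exists>d F. locally_given E f d F \<and> F (proj_coords P) \<noteq> (0, 0, 0))" for P
    unfolding locally_given_def form3 by (rule iffI; elim exE conjE; (hypsubst?)) (blast | fast)+
  then show ?thesis unfolding ec_morphism_def Let_def eq by (simp only:)
qed

lemma ec_morphism_compose:
  assumes f: "ec_morphism E f" and g: "ec_morphism E g" and fg: "\<And>P. P \<in> points E \<Longrightarrow> fg P = f (g P)"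
  shows "ec_morphism E fg"
  unfolding ec_morphism_iff
proof (intro conjI ballI)
  show "fg \<in> points E \<rightarrow> points E" using f g fg unfolding ec_morphism_iff by auto
  fix P assume P: "P \<in> points E"
  then have gP: "g P \<in> points E" using g unfolding ec_morphism_iff by auto
  obtain d F where F: "locally_given E g d F" "F (proj_coords P) \<noteq> (0, 0, 0)"
    using g P unfolding ec_morphism_iff by blast
  obtain e H where H: "locally_given E f e H" "H (proj_coords (g P)) \<noteq> (0, 0, 0)"
    using f gP unfolding ec_morphism_iff by blast
  have HF: "is_form3 e H" "is_form3 d F" using F H unfolding locally_given_def by auto
  have "\<exists>k. H (F (proj_coords Q)) = smul k (proj_coords (fg Q))" if Q: "Q \<in> points E" for Q
  proof -
    have gQ: "g Q \<in> points E" using g Q unfolding ec_morphism_iff by auto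
    obtain k where k: "F (proj_coords Q) = smul k (proj_coords (g Q))"
      using F Q unfolding locally_given_def by blast
    obtain l where l: "H (proj_coords (g Q)) = smul l (proj_coords (f (g Q)))"
      using H gQ unfolding locally_given_def by blast
    show ?thesis unfolding k is_form3_homogeneous[OF HF(1)] l fg[OF Q] by auto
  qed
  moreover have "H (F (proj_coords P)) \<noteq> (0, 0, 0)"
  proof -
    obtain k where k: "F (proj_coords P) = smul k (proj_coords (g P))"
      using F P unfolding locally_given_def by blast
    then have "k \<noteq> 0" using F by auto
    then show ?thesis unfolding k is_form3_homogeneous[OF HF(1)] using H by simp
  qed
  ultimately show "\<exists>d F. locally_given E fg d F \<and> F (proj_coords P) \<noteq> (0, 0, 0)"
    using is_form3_compose[OF HF] unfolding locally_given_def by blast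
qed

section \<open>Complete addition laws\<close>

text \<open>
  Two addition laws of degree 2 in each of the two points, in the style of Bosma and Lenstra. The first
  is the chord formula, scaled so that its last coordinate is -(x1 - x2)^3 and reduced by the
  equations of the curve; it vanishes if the points coincide. Over an algebraically closed
  field no law of this degree is free of exceptions, so a second one is needed.
\<close>

fun add_law1 :: "'a \<Rightarrow> 'a \<Rightarrow> 'a \<times> 'a \<times> 'a \<Rightarrow> 'a \<times> 'a \<times> 'a \<Rightarrow> 'a::field \<times> 'a \<times> 'a" where
  "add_law1 a b (X1, Y1, Z1) (X2, Y2, Z2) =
    ((X1*Y2 - X2*Y1)*(Y1*Z2 + Y2*Z1) + (X1*Z2 - X2*Z1)*(Y1*Y2)
       - a*((X1*Z2 + X2*Z1)*(X1*Z2 - X2*Z1)) - (3*b)*((X1*Z2 - X2*Z1)*(Z1*Z2)),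
     a*((X1*Z2 + X2*Z1)*(Y1*Z2 - Y2*Z1)) - 3*((X1*X2)*(X1*Y2 - X2*Y1)) - (Y1*Y2)*(Y1*Z2 - Y2*Z1)
       - a*((X1*Y2 - X2*Y1)*(Z1*Z2)) + (3*b)*((Y1*Z2 - Y2*Z1)*(Z1*Z2)),
     3*((X1*X2)*(X1*Z2 - X2*Z1)) - (Y1*Z2 + Y2*Z1)*(Y1*Z2 - Y2*Z1) + a*((X1*Z2 - X2*Z1)*(Z1*Z2)))"

fun add_law2 :: "'a \<Rightarrow> 'a \<Rightarrow> 'a \<times> 'a \<times> 'a \<Rightarrow> 'a \<times> 'a \<times> 'a \<Rightarrow> 'a::field \<times> 'a \<times> 'a" where
  "add_law2 a b (X1, Y1, Z1) (X2, Y2, Z2) =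
    ((X1*Y2 + X2*Y1)*(Y1*Y2 - a*(X1*Z2 + X2*Z1) - (3*b)*(Z1*Z2))
       - (Y1*Z2 + Y2*Z1)*(a*(X1*X2) + (3*b)*(X1*Z2 + X2*Z1) - a^2*(Z1*Z2)),
     (3*(X1*X2) + a*(Z1*Z2))*(a*(X1*X2) + (3*b)*(X1*Z2 + X2*Z1) - a^2*(Z1*Z2))
       + (Y1*Y2 + a*(X1*Z2 + X2*Z1) + (3*b)*(Z1*Z2))*(Y1*Y2 - a*(X1*Z2 + X2*Z1) - (3*b)*(Z1*Z2)),
     (Y1*Z2 + Y2*Z1)*(Y1*Y2 + a*(X1*Z2 + X2*Z1) + (3*b)*(Z1*Z2))
       + (X1*Y2 + X2*Y1)*(3*(X1*X2) + a*(Z1*Z2)))"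

lemma add_law_homogeneous:
  "add_law1 a b (smul k u) (smul l v) = smul (k ^ 2 * l ^ 2) (add_law1 a b u v)"
  "add_law2 a b (smul k u) (smul l v) = smul (k ^ 2 * l ^ 2) (add_law2 a b u v)"
  by (cases u; cases v; simp add: algebra_simps power2_eq_square)+

lemma add_law_is_form3:
  assumes "is_form3 d F" "is_form3 e G"
  shows "is_form3 ((d + e) + (d + e)) (\<lambda>v. add_law1 a b (F v) (G v))"
    and "is_form3 ((d + e) + (d + e)) (\<lambda>v. add_law2 a b (F v) (G v))"
proof -
  obtain f0 f1 f2 where f: "is_form d f0" "is_form d f1" "is_form d f2" "F = (\<lambda>v. (f0 v, f1 v, f2 v))"
    using assms(1) unfolding is_form3_def by blast
  obtain g0 g1 g2 where g: "is_form e g0" "is_form e g1" "is_form e g2" "G = (\<lambda>v. (g0 v, g1 v, g2 v))"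
    using assms(2) unfolding is_form3_def by blast
  have fg: "is_form (d + e) (\<lambda>v. x v * y v)" "is_form (d + e) (\<lambda>v. y v * x v)"
    if "is_form d x" "is_form e y" for x y
    using is_form_mult[OF that] by (simp_all add: mult.commute)
  note bilinear = fg[OF f(1) g(1)] fg[OF f(1) g(2)] fg[OF f(1) g(3)] fg[OF f(2) g(1)] fg[OF f(2) g(2)]
    fg[OF f(2) g(3)] fg[OF f(3) g(1)] fg[OF f(3) g(2)] fg[OF f(3) g(3)]
  show "is_form3 ((d + e) + (d + e)) (\<lambda>v. add_law1 a b (F v) (G v))"
    unfolding is_form3_def f(4) g(4) add_law1.simps
    by (intro exI conjI; (rule refl)?)
       (rule bilinear | rule is_form_scale | rule is_form_add | rule is_form_diff
         | rule is_form_mult[of "d + e" _ "d + e"])+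
  show "is_form3 ((d + e) + (d + e)) (\<lambda>v. add_law2 a b (F v) (G v))"
    unfolding is_form3_def f(4) g(4) add_law2.simps
    by (intro exI conjI; (rule refl)?)
       (rule bilinear | rule is_form_scale | rule is_form_add | rule is_form_diff
         | rule is_form_mult[of "d + e" _ "d + e"])+
qed

text \<open>
  Elimination of y2, a and b by the two equations for the slope l turns both claims into identities
  between polynomials in x1, y1, x2 and l.
\<close>

lemma add_law_affine:
  fixes a b :: "'a::field_char_0"
  assumes P: "on_curve (short a b) (Affine x1 y1)" and Q: "on_curve (short a b) (Affine x2 y2)"
  shows "\<exists>k. add_law1 a b (x1, y1, 1) (x2, y2, 1) =
           smul k (proj_coords (ec_add (short a b) (Affine x1 y1) (Affine x2 y2)))"
    and "\<exists>k. add_law2 a b (x1, y1, 1) (x2, y2, 1) =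
           smul k (proj_coords (ec_add (short a b) (Affine x1 y1) (Affine x2 y2)))"
proof -
  have "(\<exists>k. add_law1 a b (x1, y1, 1) (x2, y2, 1) =
           smul k (proj_coords (ec_add (short a b) (Affine x1 y1) (Affine x2 y2)))) \<and>
     (\<exists>k. add_law2 a b (x1, y1, 1) (x2, y2, 1) =
           smul k (proj_coords (ec_add (short a b) (Affine x1 y1) (Affine x2 y2))))"
  proof (cases "Affine x2 y2 = ec_neg (Affine x1 y1)")
    case True
    then have Q: "x2 = x1" "y2 = - y1" by auto
    have "add_law1 a b (x1, y1, 1) (x2, y2, 1) = smul (fst (snd (add_law1 a b (x1, y1, 1) (x2, y2, 1)))) (0, 1, 0)"
      "add_law2 a b (x1, y1, 1) (x2, y2, 1) = smul (fst (snd (add_law2 a b (x1, y1, 1) (x2, y2, 1)))) (0, 1, 0)"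
      unfolding Q by (simp_all add: algebra_simps)
    moreover have "ec_add (short a b) (Affine x1 y1) (Affine x2 y2) = Infinity" unfolding Q by simp
    ultimately show ?thesis by (metis proj_coords.simps(1))
  next
    case False
    then obtain l where l: "l * (x2 - x1) = y2 - y1"
      "l * (y1 + y2) = x1 ^ 2 + x1 * x2 + x2 ^ 2 + a"
      "ec_add (short a b) (Affine x1 y1) (Affine x2 y2) =
         Affine (l ^ 2 - x1 - x2) (- (y1 + l * (l ^ 2 - x1 - x2 - x1)))"
      using ec_add_slope P Q by metis
    have y2: "y2 = y1 + l * (x2 - x1)" using l(1) by simp
    have a: "a = l * (2 * y1 + l * (x2 - x1)) - x1 ^ 2 - x1 * x2 - x2 ^ 2"
      using l(2) unfolding y2 by (simp add: algebra_simps)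
    have b: "b = y1 ^ 2 - x1 ^ 3 - a * x1" using P by (simp add: algebra_simps)
    define k1 k2 where "k1 = snd (snd (add_law1 a b (x1, y1, 1) (x2, y2, 1)))"
      and "k2 = snd (snd (add_law2 a b (x1, y1, 1) (x2, y2, 1)))"
    have "add_law1 a b (x1, y1, 1) (x2, y2, 1) = smul k1 (l ^ 2 - x1 - x2, - (y1 + l * (l ^ 2 - x1 - x2 - x1)), 1)"
      unfolding k1_def add_law1.simps smul.simps snd_conv prod.inject b
      by (intro conjI) (unfold a y2, simp_all add: algebra_simps power2_eq_square power3_eq_cube)
    moreover have "add_law2 a b (x1, y1, 1) (x2, y2, 1) = smul k2 (l ^ 2 - x1 - x2, - (y1 + l * (l ^ 2 - x1 - x2 - x1)), 1)"
      unfolding k2_def add_law2.simps smul.simps snd_conv prod.inject b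
      by (intro conjI) (unfold a y2, simp_all add: algebra_simps power2_eq_square power3_eq_cube)
    ultimately show ?thesis unfolding l(3) proj_coords.simps by blast
  qed
  then show "\<exists>k. add_law1 a b (x1, y1, 1) (x2, y2, 1) =
           smul k (proj_coords (ec_add (short a b) (Affine x1 y1) (Affine x2 y2)))"
    "\<exists>k. add_law2 a b (x1, y1, 1) (x2, y2, 1) =
           smul k (proj_coords (ec_add (short a b) (Affine x1 y1) (Affine x2 y2)))" by blast+
qed

lemma add_law_correct:
  fixes a b :: "'a::field_char_0"
  assumes P: "on_curve (short a b) P" and Q: "on_curve (short a b) Q"
  shows "\<exists>k. add_law1 a b (proj_coords P) (proj_coords Q) = smul k (proj_coords (ec_add (short a b) P Q))"
    and "\<exists>k. add_law2 a b (proj_coords P) (proj_coords Q) = smul k (proj_coords (ec_add (short a b) P Q))"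
proof -
  have inf1: "\<exists>k. smul (- 1) (x, y, z) = smul k (x, y, z)" for x y z :: 'a by blast
  have inf2: "\<exists>k. smul m (x, y, z) = smul k (x, y, z)" for x y z m :: 'a by blast
  consider "P = Infinity" "Q = Infinity" | x y where "P = Affine x y" "Q = Infinity"
    | x y where "P = Infinity" "Q = Affine x y"
    | x1 y1 x2 y2 where "P = Affine x1 y1" "Q = Affine x2 y2"
    by (meson point.exhaust)
  then have "(\<exists>k. add_law1 a b (proj_coords P) (proj_coords Q) = smul k (proj_coords (ec_add (short a b) P Q))) \<and>
    (\<exists>k. add_law2 a b (proj_coords P) (proj_coords Q) = smul k (proj_coords (ec_add (short a b) P Q)))"
  proof cases
    case 2
    show ?thesis unfolding 2
      by (intro conjI, rule exI[of _ 1], simp, rule exI[of _ y], simp add: power2_eq_square)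
  next
    case 3
    show ?thesis unfolding 3
      by (intro conjI, rule exI[of _ "-1"], simp, rule exI[of _ y], simp add: power2_eq_square)
  next
    case 4
    show ?thesis using add_law_affine P Q unfolding 4 proj_coords.simps by blast
  qed auto
  then show "\<exists>k. add_law1 a b (proj_coords P) (proj_coords Q) = smul k (proj_coords (ec_add (short a b) P Q))"
    "\<exists>k. add_law2 a b (proj_coords P) (proj_coords Q) = smul k (proj_coords (ec_add (short a b) P Q))"
    by blast+
qed

text \<open>
  The first law vanishes only if P = Q. On the diagonal the second law is the doubling formula: its
  last coordinate is (2 y)^3, and at a point of order 2 its first coordinate is, up to the sign, the
  cube of the derivative of the cubic.
\<close>

lemma add_law_complete:
  fixes a b :: "'a::field_char_0"
  assumes ns: "4 * a ^ 3 + 27 * b ^ 2 \<noteq> 0"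
    and P: "on_curve (short a b) P" and Q: "on_curve (short a b) Q"
    and zero: "add_law1 a b (proj_coords P) (proj_coords Q) = (0, 0, 0)"
  shows "add_law2 a b (proj_coords P) (proj_coords Q) \<noteq> (0, 0, 0)"
proof -
  have PQ: "P = Q"
  proof (cases "P = Infinity \<or> Q = Infinity")
    case True
    then show ?thesis using zero by (cases P; cases Q) auto
  next
    case False
    then obtain x1 y1 x2 y2 where PQ: "P = Affine x1 y1" "Q = Affine x2 y2"
      by (meson point.exhaust)
    have on: "y1 ^ 2 = x1 ^ 3 + a * x1 + b" "y2 ^ 2 = x2 ^ 3 + a * x2 + b"
      using P Q unfolding PQ by auto
    have "snd (snd (add_law1 a b (proj_coords P) (proj_coords Q))) = - ((x1 - x2) ^ 3)"
    proof -
      have "snd (snd (add_law1 a b (proj_coords P) (proj_coords Q))) =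
          3 * (x1 * x2) * (x1 - x2) - (y1 ^ 2 - y2 ^ 2) + a * (x1 - x2)"
        unfolding PQ by (simp add: algebra_simps power2_eq_square)
      then show ?thesis unfolding on by (simp add: algebra_simps power3_eq_cube power2_eq_square)
    qed
    then have x: "x1 = x2" using zero by simp
    then have "(y1 - y2) * (y1 + y2) = 0" using on by (simp add: algebra_simps power2_eq_square)
    moreover have "y1 = 0" if "y2 = - y1"
    proof -
      have "fst (snd (add_law1 a b (proj_coords P) (proj_coords Q))) =
         2 * y1 * (3 * (x1 ^ 3 + a * x1 + b) + y1 ^ 2 * 1)"
        unfolding PQ x that by (simp add: algebra_simps power2_eq_square power3_eq_cube)
      also have "\<dots> = 8 * y1 ^ 3" unfolding on(1)[symmetric] by (simp add: power2_eq_square power3_eq_cube)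
      finally show ?thesis using zero by simp
    qed
    ultimately show ?thesis unfolding PQ using x by (auto simp: add_eq_0_iff)
  qed
  show ?thesis
  proof (cases P)
    case (Affine x y)
    have on: "y ^ 2 = x ^ 3 + a * x + b" using P unfolding Affine by auto
    show ?thesis
    proof (cases "y = 0")
      case False
      have "snd (snd (add_law2 a b (proj_coords P) (proj_coords P))) =
         2 * y * (y ^ 2 + 3 * (x ^ 3 + a * x + b))"
        unfolding Affine by (simp add: algebra_simps power2_eq_square power3_eq_cube)
      also have "\<dots> = 8 * y ^ 3" unfolding on[symmetric] by (simp add: power2_eq_square power3_eq_cube)
      finally show ?thesis using False PQ by auto
    next
      case True
      then have b: "b = - (x ^ 3) - a * x" using on by (simp add: algebra_simps eq_neg_iff_add_eq_0)
      have "fst (snd (add_law2 a b (proj_coords P) (proj_coords P))) = - ((3 * x ^ 2 + a) ^ 3)"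
        unfolding Affine True b by (simp add: algebra_simps power2_eq_square power3_eq_cube)
      moreover have "3 * x ^ 2 + a \<noteq> 0"
      proof
        assume "3 * x ^ 2 + a = 0"
        then have "a = - 3 * x ^ 2" by (simp add: add_eq_0_iff2)
        then show False using ns unfolding b by (simp add: power2_eq_square power3_eq_cube)
      qed
      ultimately show ?thesis using PQ by auto
    qed
  qed (use PQ in auto)
qed

lemma ec_morphism_add:
  fixes a b :: "'a::{alg_closed_field, field_char_0}"
  assumes ns: "4 * a ^ 3 + 27 * b ^ 2 \<noteq> 0"
    and f: "ec_morphism (short a b) f" and g: "ec_morphism (short a b) g"
    and fg: "\<And>P. P \<in> points (short a b) \<Longrightarrow> fg P = ec_add (short a b) (f P) (g P)"
  shows "ec_morphism (short a b) fg"
  unfolding ec_morphism_iff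
proof (intro conjI ballI)
  let ?E = "short a b"
  have fE: "on_curve ?E (f P)" and gE: "on_curve ?E (g P)" if "P \<in> points ?E" for P
    using f g that unfolding ec_morphism_iff points_def by auto
  show "fg \<in> points ?E \<rightarrow> points ?E"
    using fE gE fg by (auto simp: points_def simp del: ec_add.simps on_curve.simps intro!: on_curve_add)
  fix P assume P: "P \<in> points ?E"
  obtain d F where F: "locally_given ?E f d F" "F (proj_coords P) \<noteq> (0, 0, 0)"
    using f P unfolding ec_morphism_iff by blast
  obtain e G where G: "locally_given ?E g e G" "G (proj_coords P) \<noteq> (0, 0, 0)"
    using g P unfolding ec_morphism_iff by blast
  have FG: "is_form3 d F" "is_form3 e G" using F G unfolding locally_given_def by auto
  have ex: "\<exists>k l. F (proj_coords Q) = smul k (proj_coords (f Q)) \<and> G (proj_coords Q) = smul l (proj_coords (g Q))"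
    if "Q \<in> points ?E" for Q
    using F G that unfolding locally_given_def by blast
  have 1: "locally_given ?E fg ((d + e) + (d + e)) (\<lambda>v. add_law1 a b (F v) (G v))"
  proof -
    have "\<exists>k. add_law1 a b (F (proj_coords Q)) (G (proj_coords Q)) = smul k (proj_coords (fg Q))"
      if Q: "Q \<in> points ?E" for Q
    proof -
      obtain k l where kl: "F (proj_coords Q) = smul k (proj_coords (f Q))" "G (proj_coords Q) = smul l (proj_coords (g Q))"
        using ex[OF Q] by blast
      obtain m where "add_law1 a b (proj_coords (f Q)) (proj_coords (g Q)) = smul m (proj_coords (fg Q))"
        using add_law_correct(1)[OF fE[OF Q] gE[OF Q]] unfolding fg[OF Q] by blast
      then show ?thesis unfolding kl add_law_homogeneous by auto
    qed
    then show ?thesis using add_law_is_form3[OF FG] unfolding locally_given_def by blast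
  qed
  have 2: "locally_given ?E fg ((d + e) + (d + e)) (\<lambda>v. add_law2 a b (F v) (G v))"
  proof -
    have "\<exists>k. add_law2 a b (F (proj_coords Q)) (G (proj_coords Q)) = smul k (proj_coords (fg Q))"
      if Q: "Q \<in> points ?E" for Q
    proof -
      obtain k l where kl: "F (proj_coords Q) = smul k (proj_coords (f Q))" "G (proj_coords Q) = smul l (proj_coords (g Q))"
        using ex[OF Q] by blast
      obtain m where "add_law2 a b (proj_coords (f Q)) (proj_coords (g Q)) = smul m (proj_coords (fg Q))"
        using add_law_correct(2)[OF fE[OF Q] gE[OF Q]] unfolding fg[OF Q] by blast
      then show ?thesis unfolding kl add_law_homogeneous by auto
    qed
    then show ?thesis using add_law_is_form3[OF FG] unfolding locally_given_def by blast
  qed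
  obtain k l where kl: "F (proj_coords P) = smul k (proj_coords (f P))" "G (proj_coords P) = smul l (proj_coords (g P))"
    using ex[OF P] by blast
  then have nz: "k \<noteq> 0" "l \<noteq> 0" using F G by auto
  have "add_law1 a b (F (proj_coords P)) (G (proj_coords P)) \<noteq> (0, 0, 0) \<or>
        add_law2 a b (F (proj_coords P)) (G (proj_coords P)) \<noteq> (0, 0, 0)"
    using add_law_complete[OF ns fE[OF P] gE[OF P]] nz unfolding kl add_law_homogeneous by auto
  then show "\<exists>d F. locally_given ?E fg d F \<and> F (proj_coords P) \<noteq> (0, 0, 0)"
    using 1 2 by blast
qed

section \<open>Passing to the short form\<close>

text \<open>
  A linear change of coordinates between Weierstrass equations: \<phi> and \<psi> act on the points and the
  linear forms \<Phi> and \<Psi> on their homogeneous coordinates. Conjugation with it carries one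
  endomorphism ring to the other.
\<close>

locale ec_linear_iso =
  fixes E1 E2 :: "'a::alg_closed_field weierstrass"
    and \<phi> \<psi> :: "'a point \<Rightarrow> 'a point" and \<Phi> \<Psi> :: "'a \<times> 'a \<times> 'a \<Rightarrow> 'a \<times> 'a \<times> 'a"
  assumes phi_points: "P \<in> points E1 \<Longrightarrow> \<phi> P \<in> points E2"
    and psi_points: "P \<in> points E2 \<Longrightarrow> \<psi> P \<in> points E1"
    and psi_phi [simp]: "\<psi> (\<phi> P) = P" and phi_psi [simp]: "\<phi> (\<psi> P) = P"
    and forms: "is_form3 1 \<Phi>" "is_form3 1 \<Psi>"
    and Psi_Phi: "\<Psi> (\<Phi> v) = v" and Phi_Psi: "\<Phi> (\<Psi> v) = v"
    and proj_coords_phi: "proj_coords (\<phi> P) = \<Phi> (proj_coords P)"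
    and add_points: "P \<in> points E1 \<Longrightarrow> Q \<in> points E1 \<Longrightarrow> ec_add E1 P Q \<in> points E1"
    and phi_add: "P \<in> points E1 \<Longrightarrow> Q \<in> points E1 \<Longrightarrow> \<phi> (ec_add E1 P Q) = ec_add E2 (\<phi> P) (\<phi> Q)"
begin

lemma psi_add:
  assumes "P \<in> points E2" "Q \<in> points E2"
  shows "\<psi> (ec_add E2 P Q) = ec_add E1 (\<psi> P) (\<psi> Q)"
  using phi_add[OF psi_points[OF assms(1)] psi_points[OF assms(2)]] by (metis phi_psi psi_phi)

lemma ec_linear_iso_sym: "ec_linear_iso E2 E1 \<psi> \<phi> \<Psi> \<Phi>"
proof
  show "proj_coords (\<psi> P) = \<Psi> (proj_coords P)" for P
    using proj_coords_phi[of "\<psi> P"] Psi_Phi by simp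
  show "ec_add E2 P Q \<in> points E2" if "P \<in> points E2" "Q \<in> points E2" for P Q
    using phi_points[OF add_points[OF psi_points psi_points]] psi_add that by (metis phi_psi)
qed (use phi_points psi_points forms Psi_Phi Phi_Psi psi_add in auto)

definition conj_endo :: "('a point \<Rightarrow> 'a point) \<Rightarrow> 'a point \<Rightarrow> 'a point" where
  "conj_endo f = restrict (\<lambda>P. \<phi> (f (\<psi> P))) (points E2)"

lemma ec_morphism_conj:
  assumes "ec_morphism E1 f"
  shows "ec_morphism E2 (conj_endo f)"
  unfolding ec_morphism_iff
proof (intro conjI ballI)
  interpret s: ec_linear_iso E2 E1 \<psi> \<phi> \<Psi> \<Phi> by (rule ec_linear_iso_sym)
  have fE: "f P \<in> points E1" if "P \<in> points E1" for P
    using assms that unfolding ec_morphism_iff by auto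
  show "conj_endo f \<in> points E2 \<rightarrow> points E2"
    using fE by (auto simp: conj_endo_def phi_points psi_points)
  fix P assume P: "P \<in> points E2"
  obtain d F where F: "locally_given E1 f d F" "F (proj_coords (\<psi> P)) \<noteq> (0, 0, 0)"
    using assms psi_points[OF P] unfolding ec_morphism_iff by blast
  have "is_form3 (1 * (d * 1)) (\<lambda>v. \<Phi> (F (\<Psi> v)))"
    using F forms unfolding locally_given_def by (intro is_form3_compose) auto
  moreover have "\<exists>k. \<Phi> (F (\<Psi> (proj_coords Q))) = smul k (proj_coords (conj_endo f Q))"
    if Q: "Q \<in> points E2" for Q
  proof -
    obtain k where "F (proj_coords (\<psi> Q)) = smul k (proj_coords (f (\<psi> Q)))"
      using F(1) psi_points[OF Q] unfolding locally_given_def by blast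
    then show ?thesis using Q
      by (auto simp: s.proj_coords_phi proj_coords_phi conj_endo_def is_form3_homogeneous[OF forms(1)])
  qed
  moreover have "\<Phi> (F (\<Psi> (proj_coords P))) \<noteq> (0, 0, 0)"
  proof
    assume "\<Phi> (F (\<Psi> (proj_coords P))) = (0, 0, 0)"
    then have "F (\<Psi> (proj_coords P)) = \<Psi> (smul 0 (0, 0, 0))" by (metis Psi_Phi smul_eq_0)
    then have "F (\<Psi> (proj_coords P)) = (0, 0, 0)"
      unfolding is_form3_homogeneous[OF forms(2)] by (cases "\<Psi> (0, 0, 0)") simp
    then show False using F(2) by (simp add: s.proj_coords_phi)
  qed
  ultimately show "\<exists>d F. locally_given E2 (conj_endo f) d F \<and> F (proj_coords P) \<noteq> (0, 0, 0)"
    unfolding locally_given_def by blast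
qed

lemma ec_endomorphisms_conj:
  assumes "f \<in> ec_endomorphisms E1"
  shows "conj_endo f \<in> ec_endomorphisms E2"
  unfolding ec_endomorphisms_def
proof (intro CollectI conjI ballI)
  interpret s: ec_linear_iso E2 E1 \<psi> \<phi> \<Psi> \<Phi> by (rule ec_linear_iso_sym)
  show "conj_endo f \<in> extensional (points E2)" by (simp add: conj_endo_def)
  show "ec_morphism E2 (conj_endo f)" using assms ec_morphism_conj unfolding ec_endomorphisms_def by blast
  fix P Q assume PQ: "P \<in> points E2" "Q \<in> points E2"
  have f: "f P \<in> points E1" if "P \<in> points E1" for P
    using assms that unfolding ec_endomorphisms_def ec_morphism_def by auto
  have hom: "f (ec_add E1 P Q) = ec_add E1 (f P) (f Q)" if "P \<in> points E1" "Q \<in> points E1" for P Q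
    using assms that unfolding ec_endomorphisms_def by auto
  have "conj_endo f (ec_add E2 P Q) = \<phi> (f (ec_add E1 (\<psi> P) (\<psi> Q)))"
    using s.add_points[OF PQ] psi_add[OF PQ] by (simp add: conj_endo_def)
  also have "\<dots> = ec_add E2 (\<phi> (f (\<psi> P))) (\<phi> (f (\<psi> Q)))"
    using PQ psi_points f hom phi_add by simp
  finally show "conj_endo f (ec_add E2 P Q) = ec_add E2 (conj_endo f P) (conj_endo f Q)"
    using PQ by (simp add: conj_endo_def)
qed

lemma conj_endo_ring_iso: "conj_endo \<in> ring_iso (End_ring E1) (End_ring E2)"
proof (rule ring_iso_memI)
  interpret s: ec_linear_iso E2 E1 \<psi> \<phi> \<Psi> \<Phi> by (rule ec_linear_iso_sym)
  have E1: "f P \<in> points E1" if "f \<in> carrier (End_ring E1)" "P \<in> points E1" for f P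
    using that unfolding End_ring_def ec_endomorphisms_def ec_morphism_def by auto
  show "conj_endo f \<in> carrier (End_ring E2)" if "f \<in> carrier (End_ring E1)" for f
    using that ec_endomorphisms_conj by (simp add: End_ring_def)
  show "conj_endo (f \<otimes>\<^bsub>End_ring E1\<^esub> g) = conj_endo f \<otimes>\<^bsub>End_ring E2\<^esub> conj_endo g"
    if "f \<in> carrier (End_ring E1)" "g \<in> carrier (End_ring E1)" for f g
    using E1[OF that(2)] psi_points phi_points
    by (auto simp: End_ring_def conj_endo_def compose_def fun_eq_iff restrict_def)
  show "conj_endo (f \<oplus>\<^bsub>End_ring E1\<^esub> g) = conj_endo f \<oplus>\<^bsub>End_ring E2\<^esub> conj_endo g"
    if "f \<in> carrier (End_ring E1)" "g \<in> carrier (End_ring E1)" for f g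
    using E1[OF that(1)] E1[OF that(2)] psi_points phi_points phi_add
    by (auto simp: End_ring_def conj_endo_def fun_eq_iff restrict_def)
  show "conj_endo \<one>\<^bsub>End_ring E1\<^esub> = \<one>\<^bsub>End_ring E2\<^esub>"
    using psi_points by (auto simp: End_ring_def conj_endo_def fun_eq_iff restrict_def)
  have inv: "s.conj_endo (conj_endo f) = f" if "f \<in> carrier (End_ring E1)" for f
    using that phi_points by (auto simp: End_ring_def ec_endomorphisms_def s.conj_endo_def conj_endo_def
        fun_eq_iff restrict_def extensional_def)
  have inv': "conj_endo (s.conj_endo f) = f" if "f \<in> carrier (End_ring E2)" for f
    using that psi_points by (auto simp: End_ring_def ec_endomorphisms_def s.conj_endo_def conj_endo_def
        fun_eq_iff restrict_def extensional_def)
  show "bij_betw conj_endo (carrier (End_ring E1)) (carrier (End_ring E2))"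
    by (rule bij_betw_byWitness[of _ s.conj_endo])
       (use inv inv' ec_endomorphisms_conj s.ec_endomorphisms_conj in \<open>auto simp: End_ring_def\<close>)
qed

end

text \<open>
  Completing the square shifts y by (a1 x + a3)/2, and completing the cube shifts x by shift_r. The
  pair short_a, short_b consists of the coefficients that result.
\<close>

definition shift_r :: "'a::field weierstrass \<Rightarrow> 'a" where
  "shift_r E = (a1 E ^ 2 + 4 * a2 E) / 12"

definition short_a :: "'a::field weierstrass \<Rightarrow> 'a" where
  "short_a E = a4 E + a1 E * a3 E / 2 - 3 * shift_r E ^ 2"

definition short_b :: "'a::field weierstrass \<Rightarrow> 'a" where
  "short_b E = a6 E + a3 E ^ 2 / 4 - (a4 E + a1 E * a3 E / 2) * shift_r E + 2 * shift_r E ^ 3"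

fun to_short :: "'a::field weierstrass \<Rightarrow> 'a point \<Rightarrow> 'a point" where
  "to_short E Infinity = Infinity"
| "to_short E (Affine x y) = Affine (x + shift_r E) (y + a1 E / 2 * x + a3 E / 2)"

fun of_short :: "'a::field weierstrass \<Rightarrow> 'a point \<Rightarrow> 'a point" where
  "of_short E Infinity = Infinity"
| "of_short E (Affine x y) = Affine (x - shift_r E) (y - a1 E / 2 * (x - shift_r E) - a3 E / 2)"

lemma shift_r_eq: "12 * shift_r E = a1 E ^ 2 + 4 * a2 (E :: 'a::field_char_0 weierstrass)"
  by (simp add: shift_r_def)

lemma discriminant_short:
  "discriminant E = - 16 * (4 * short_a E ^ 3 + 27 * short_b E ^ 2)" for E :: "'a::field_char_0 weierstrass"
proof -
  have a2: "a2 E = 3 * shift_r E - a1 E ^ 2 / 4"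
    using shift_r_eq[of E] by (simp add: field_simps)
  have e: "discriminant (Weierstrass (2 * u) (3 * r - u ^ 2) (2 * v) (c - 2 * u * v) (d - v ^ 2)) =
     - 16 * (4 * (c - 3 * r ^ 2) ^ 3 + 27 * (d - c * r + 2 * r ^ 3) ^ 2)" for u v r c d :: 'a
    unfolding discriminant_def Let_def by (simp add: algebra_simps power2_eq_square power3_eq_cube)
  define u v r c d where "u = a1 E / 2" "v = a3 E / 2" "r = shift_r E"
    "c = a4 E + a1 E * a3 E / 2" "d = a6 E + a3 E ^ 2 / 4"
  note defs = this
  have "E = Weierstrass (2 * u) (3 * r - u ^ 2) (2 * v) (c - 2 * u * v) (d - v ^ 2)"
    by (cases E) (use a2 in \<open>auto simp: defs power2_eq_square\<close>)
  then show ?thesis using e[of u r v c d] unfolding short_a_def short_b_def defs by simp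
qed

lemma on_curve_to_short:
  fixes E :: "'a::field_char_0 weierstrass"
  shows "on_curve (short (short_a E) (short_b E)) (to_short E P) \<longleftrightarrow> on_curve E P"
proof (cases P)
  case (Affine x y)
  define s t r where "s = a1 E / 2" "t = a3 E / 2" "r = shift_r E"
  have st: "a1 E = 2 * s" "a3 E = 2 * t" "a2 E = 3 * r - s ^ 2"
    using shift_r_eq[of E] by (simp_all add: s_t_r_def power2_eq_square field_simps)
  have AB: "short_a E = a4 E + 2 * s * t - 3 * r ^ 2" "short_b E = a6 E + t ^ 2 - (a4 E + 2 * s * t) * r + 2 * r ^ 3"
    unfolding short_a_def short_b_def s_t_r_def(3)[symmetric] st by (simp_all add: power2_eq_square)
  have "(y + s * x + t) ^ 2 - ((x + r) ^ 3 + short_a E * (x + r) + short_b E) =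
    (y ^ 2 + a1 E * x * y + a3 E * y) - (x ^ 3 + a2 E * x ^ 2 + a4 E * x + a6 E)"
    unfolding AB st by (simp add: algebra_simps power2_eq_square power3_eq_cube)
  then show ?thesis unfolding Affine to_short.simps on_short_iff unfolding on_curve.simps s_t_r_def[symmetric]
    by (rule diff_eq_diff_eq)
qed auto

lemma of_short_to_short [simp]: "of_short E (to_short E P) = P"
  by (cases P) auto

lemma to_short_of_short [simp]: "to_short E (of_short E P) = P"
  by (cases P) auto

lemma to_short_add:
  fixes E :: "'a::field_char_0 weierstrass"
  assumes P: "on_curve E P" and Q: "on_curve E Q"
  shows "to_short E (ec_add E P Q) = ec_add (short (short_a E) (short_b E)) (to_short E P) (to_short E Q)"
proof (cases "P = Infinity \<or> Q = Infinity")
  case True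
  then show ?thesis by auto
next
  case False
  then obtain x1 y1 x2 y2 where PQ: "P = Affine x1 y1" "Q = Affine x2 y2"
    by (meson point.exhaust)
  have a2: "a2 E = 3 * shift_r E - a1 E ^ 2 / 4"
    using shift_r_eq[of E] by (simp add: field_simps)
  define s t r where "s = a1 E / 2" "t = a3 E / 2" "r = shift_r E"
  have st: "a1 E = 2 * s" "a3 E = 2 * t" "a2 E = 3 * r - s ^ 2"
    unfolding s_t_r_def a2 by (simp_all add: power2_eq_square)
  show ?thesis
  proof (cases "x1 = x2 \<and> y1 + y2 + a1 E * x2 + a3 E = 0")
    case True
    then show ?thesis unfolding PQ by (simp add: st field_simps)
  next
    case False
    define l where "l = (if x1 = x2
                 then (3 * x1 ^ 2 + 2 * a2 E * x1 + a4 E - a1 E * y1) / (2 * y1 + a1 E * x1 + a3 E)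
                 else (y2 - y1) / (x2 - x1))"
    define Y1 Y2 where "Y1 = y1 + s * x1 + t" "Y2 = y2 + s * x2 + t"
    note Y = this
    have sum: "y1 + y2 + a1 E * x2 + a3 E = Y1 + Y2" if "x1 = x2"
      unfolding Y st that by (simp add: algebra_simps)
    have onP: "Y1 ^ 2 = (x1 + r) ^ 3 + short_a E * (x1 + r) + short_b E"
      and onQ: "Y2 ^ 2 = (x2 + r) ^ 3 + short_a E * (x2 + r) + short_b E"
      using P Q on_curve_to_short[of E P] on_curve_to_short[of E Q] unfolding PQ
      by (simp_all add: Y s_t_r_def)
    have L: "(if x1 + r = x2 + r then (3 * (x1 + r) ^ 2 + short_a E) / (2 * Y1)
              else (Y2 - Y1) / ((x2 + r) - (x1 + r))) = l + s"
    proof (cases "x1 = x2")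
      case True
      then have "(Y1 - Y2) * (Y1 + Y2) = 0" using onP onQ by (simp add: algebra_simps power2_eq_square)
      then have "Y1 = Y2" using False True sum[OF True] by auto
      then have Y1: "Y1 \<noteq> 0" using False True sum[OF True] by auto
      have "2 * y1 + a1 E * x1 + a3 E = 2 * Y1" unfolding Y st by (simp add: algebra_simps)
      then have l: "l = (3 * x1 ^ 2 + 2 * a2 E * x1 + a4 E - a1 E * y1) / (2 * Y1)" using True l_def by simp
      have "3 * (x1 + r) ^ 2 + short_a E = 3 * x1 ^ 2 + 2 * a2 E * x1 + a4 E - a1 E * y1 + s * (2 * Y1)"
        unfolding short_a_def st Y s_t_r_def(3)[symmetric] by (simp add: algebra_simps power2_eq_square)
      then show ?thesis using True Y1 unfolding l by (simp add: add_divide_distrib)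
    next
      case False
      then show ?thesis unfolding l_def Y by (simp add: field_simps)
    qed
    have ne: "\<not> (x1 + r = x2 + r \<and> Y1 + Y2 = 0)" using False sum by auto
    have 1: "ec_add E P Q = Affine (l ^ 2 + a1 E * l - a2 E - x1 - x2)
       (- (y1 + l * ((l ^ 2 + a1 E * l - a2 E - x1 - x2) - x1)) - a1 E * (l ^ 2 + a1 E * l - a2 E - x1 - x2) - a3 E)"
      unfolding PQ ec_add.simps l_def[symmetric] Let_def using False by auto
    have 2: "ec_add (short (short_a E) (short_b E)) (Affine (x1 + r) Y1) (Affine (x2 + r) Y2) =
       Affine ((l + s) ^ 2 - (x1 + r) - (x2 + r)) (- (Y1 + (l + s) * (((l + s) ^ 2 - (x1 + r) - (x2 + r)) - (x1 + r))))"
      unfolding L[symmetric] using ne by (auto simp: Let_def)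
    have 3: "to_short E P = Affine (x1 + r) Y1" "to_short E Q = Affine (x2 + r) Y2"
      unfolding PQ by (simp_all add: Y s_t_r_def)
    show ?thesis unfolding 1 2 3 to_short.simps s_t_r_def[symmetric] unfolding st Y
      by (simp add: algebra_simps power2_eq_square)
  qed
qed

fun lin_short :: "'a::field weierstrass \<Rightarrow> 'a \<times> 'a \<times> 'a \<Rightarrow> 'a \<times> 'a \<times> 'a" where
  "lin_short E (x, y, z) = (x + shift_r E * z, y + a1 E / 2 * x + a3 E / 2 * z, z)"

fun lin_of_short :: "'a::field weierstrass \<Rightarrow> 'a \<times> 'a \<times> 'a \<Rightarrow> 'a \<times> 'a \<times> 'a" where
  "lin_of_short E (x, y, z) = (x - shift_r E * z, y + (- (a1 E / 2)) * (x - shift_r E * z) + (- (a3 E / 2)) * z, z)"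

lemma is_form_coords:
  "is_form 1 (\<lambda>v :: 'a \<times> 'a \<times> 'a. fst v)" "is_form 1 (\<lambda>v :: 'a \<times> 'a \<times> 'a. fst (snd v))"
  "is_form 1 (\<lambda>v :: 'a::field \<times> 'a \<times> 'a. snd (snd v))"
proof -
  have "(\<lambda>v. fst v) = (\<lambda>(x, y, z). 1 * x ^ 1 * y ^ 0 * z ^ 0 :: 'a)"
    "(\<lambda>v. fst (snd v)) = (\<lambda>(x, y, z). 1 * x ^ 0 * y ^ 1 * z ^ 0 :: 'a)"
    "(\<lambda>v. snd (snd v)) = (\<lambda>(x, y, z). 1 * x ^ 0 * y ^ 0 * z ^ 1 :: 'a)"
    by auto
  then show "is_form 1 (\<lambda>v. fst v :: 'a)" "is_form 1 (\<lambda>v. fst (snd v) :: 'a)" "is_form 1 (\<lambda>v. snd (snd v) :: 'a)"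
    using is_form_monomial[of 1 0 0 1 "1::'a"] is_form_monomial[of 0 1 0 1 "1::'a"] is_form_monomial[of 0 0 1 1 "1::'a"]
    by simp_all
qed

lemma ec_linear_iso_short:
  fixes E :: "'a::{alg_closed_field, field_char_0} weierstrass"
  shows "ec_linear_iso (short (short_a E) (short_b E)) E (of_short E) (to_short E) (lin_of_short E) (lin_short E)"
proof
  let ?S = "short (short_a E) (short_b E)"
  show "of_short E P \<in> points E" if "P \<in> points ?S" for P
    using that on_curve_to_short[of E "of_short E P"] by (simp add: points_def del: on_curve.simps)
  show "to_short E P \<in> points ?S" if "P \<in> points E" for P
    using that on_curve_to_short[of E P] by (simp add: points_def del: on_curve.simps)
  show "ec_add ?S P Q \<in> points ?S" if "P \<in> points ?S" "Q \<in> points ?S" for P Q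
    using that on_curve_add unfolding points_def by blast
  show "of_short E (ec_add ?S P Q) = ec_add E (of_short E P) (of_short E Q)"
    if "P \<in> points ?S" "Q \<in> points ?S" for P Q
  proof -
    have "on_curve E (of_short E P)" "on_curve E (of_short E Q)"
      using that on_curve_to_short[of E "of_short E P"] on_curve_to_short[of E "of_short E Q"]
      by (simp_all add: points_def del: on_curve.simps)
    from to_short_add[OF this] show ?thesis by (metis of_short_to_short to_short_of_short)
  qed
  show "proj_coords (of_short E P) = lin_of_short E (proj_coords P)" for P
    by (cases P) auto
  have "lin_of_short E = (\<lambda>v. (fst v - shift_r E * snd (snd v),
     fst (snd v) + (- (a1 E / 2)) * (fst v - shift_r E * snd (snd v)) + (- (a3 E / 2)) * snd (snd v), snd (snd v)))"
    by auto
  then show "is_form3 1 (lin_of_short E)"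
    unfolding is_form3_def
    by (intro exI[of _ "\<lambda>v. fst v - shift_r E * snd (snd v)"]
        exI[of _ "\<lambda>v. fst (snd v) + (- (a1 E / 2)) * (fst v - shift_r E * snd (snd v)) + (- (a3 E / 2)) * snd (snd v)"]
        exI[of _ "\<lambda>v. snd (snd v)"] conjI is_form_add is_form_diff is_form_scale is_form_coords)
  have "lin_short E = (\<lambda>v. (fst v + shift_r E * snd (snd v),
     fst (snd v) + a1 E / 2 * fst v + a3 E / 2 * snd (snd v), snd (snd v)))"
    by auto
  then show "is_form3 1 (lin_short E)"
    unfolding is_form3_def
    by (intro exI[of _ "\<lambda>v. fst v + shift_r E * snd (snd v)"]
        exI[of _ "\<lambda>v. fst (snd v) + a1 E / 2 * fst v + a3 E / 2 * snd (snd v)"]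
        exI[of _ "\<lambda>v. snd (snd v)"] conjI is_form_add is_form_diff is_form_scale is_form_coords)
  show "lin_short E (lin_of_short E v) = v" "lin_of_short E (lin_short E v) = v" for v
    by (cases v, simp)+
qed auto

section \<open>The endomorphism ring\<close>

context
  fixes a b :: "'a::{alg_closed_field, field_char_0}"
begin

lemma endo_on_curve: "f \<in> ec_endomorphisms (short a b) \<Longrightarrow> on_curve (short a b) P \<Longrightarrow> on_curve (short a b) (f P)"
  unfolding ec_endomorphisms_def ec_morphism_def points_def by auto

lemma endo_morphism: "f \<in> ec_endomorphisms (short a b) \<Longrightarrow> ec_morphism (short a b) f"
  unfolding ec_endomorphisms_def by blast

lemma endo_add:
  "f \<in> ec_endomorphisms (short a b) \<Longrightarrow> on_curve (short a b) P \<Longrightarrow> on_curve (short a b) Q \<Longrightarrow>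
    f (ec_add (short a b) P Q) = ec_add (short a b) (f P) (f Q)"
  unfolding ec_endomorphisms_def points_def by auto

lemma endo_compose:
  assumes f: "f \<in> ec_endomorphisms (short a b)" and g: "g \<in> ec_endomorphisms (short a b)"
  shows "compose (points (short a b)) f g \<in> ec_endomorphisms (short a b)"
proof -
  have "ec_morphism (short a b) (compose (points (short a b)) f g)"
    by (rule ec_morphism_compose[OF endo_morphism[OF f] endo_morphism[OF g]]) (simp only: compose_eq)
  moreover have "compose (points (short a b)) f g (ec_add (short a b) P Q) =
      ec_add (short a b) (compose (points (short a b)) f g P) (compose (points (short a b)) f g Q)"
    if "P \<in> points (short a b)" "Q \<in> points (short a b)" for P Q
  proof -
    have on: "on_curve (short a b) P" "on_curve (short a b) Q" using that by (auto simp: points_def)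
    then have mem: "ec_add (short a b) P Q \<in> points (short a b)" unfolding points_def using on_curve_add by blast
    show ?thesis using that mem
      by (simp add: compose_def endo_add[OF g on] endo_add[OF f] endo_on_curve[OF g] on del: ec_add.simps on_curve.simps)
  qed
  ultimately show ?thesis unfolding ec_endomorphisms_def using compose_extensional by blast
qed

lemma locally_given_id: "locally_given (short a b) (restrict id (points (short a b))) 1 (\<lambda>v. v)"
  unfolding locally_given_def is_form3_def
proof (intro conjI ballI)
  show "\<exists>g0 g1 g2. is_form 1 g0 \<and> is_form 1 g1 \<and> is_form 1 g2 \<and> (\<lambda>v :: 'a \<times> 'a \<times> 'a. v) = (\<lambda>v. (g0 v, g1 v, g2 v))"
    by (intro exI[of _ "\<lambda>v. fst v"] exI[of _ "\<lambda>v. fst (snd v)"] exI[of _ "\<lambda>v. snd (snd v)"] conjI is_form_coords) auto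
qed (auto intro: exI[of _ 1])

lemma endo_id: "restrict id (points (short a b)) \<in> ec_endomorphisms (short a b)"
proof -
  have "ec_morphism (short a b) (restrict id (points (short a b)))"
    unfolding ec_morphism_iff using locally_given_id proj_coords_nz by fastforce
  moreover have "ec_add (short a b) P Q \<in> points (short a b)"
    if "P \<in> points (short a b)" "Q \<in> points (short a b)" for P Q
    using that on_curve_add unfolding points_def by blast
  ultimately show ?thesis unfolding ec_endomorphisms_def by auto
qed

end

text \<open>
  Both numbers are roots of x^2 - x + 3.
\<close>

lemma algebraic_int_omega:
  "algebraic_int ((1 + csqrt (- 11)) / 2)" (is "algebraic_int ?w") "algebraic_int ((1 - csqrt (- 11)) / 2)" (is "algebraic_int ?w'")
proof -
  have "algebraic_int ((1 + e * csqrt (- 11)) / 2)" if "e ^ 2 = 1" for e :: complex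
  proof -
    define r where "r = e * csqrt (- 11)"
    have "csqrt (- 11) ^ 2 = - 11" by (rule power2_csqrt)
    then have r: "r * r = - 11" using that by (simp add: r_def power_mult_distrib flip: power2_eq_square del: csqrt_minus)
    have "poly [:3, -1, 1:] ((1 + r) / 2) = 0"
      by (simp add: field_simps r)
    then show ?thesis unfolding r_def[symmetric]
      by (intro algebraic_int.intros[of "[:3, -1, 1:]"]) (auto simp: coeff_pCons split: nat.splits)
  qed
  from this[of 1] this[of "-1"] show "algebraic_int ?w" "algebraic_int ?w'" by (simp_all del: csqrt_minus)
qed

context
  fixes a b :: "'a::{alg_closed_field, field_char_0}"
  assumes ns: "4 * a ^ 3 + 27 * b ^ 2 \<noteq> 0"
begin

lemma ec_add_interchange:
  assumes "on_curve (short a b) P" "on_curve (short a b) Q" "on_curve (short a b) R" "on_curve (short a b) S"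
  shows "ec_add (short a b) (ec_add (short a b) P Q) (ec_add (short a b) R S) =
         ec_add (short a b) (ec_add (short a b) P R) (ec_add (short a b) Q S)"
proof -
  let ?add = "ec_add (short a b)"
  note on = assms on_curve_add[OF assms(3,4)] on_curve_add[OF assms(2,4)] on_curve_add[OF assms(2,3)]
    on_curve_add[OF assms(3,2)]
  have "?add (?add P Q) (?add R S) = ?add P (?add Q (?add R S))"
    by (intro ec_add_assoc ns on)
  also have "?add Q (?add R S) = ?add (?add Q R) S"
    by (intro ec_add_assoc[symmetric] ns on)
  also have "?add Q R = ?add R Q" by (intro ec_add_commute on)
  also have "?add (?add R Q) S = ?add R (?add Q S)" by (intro ec_add_assoc ns on)
  also have "?add P \<dots> = ?add (?add P R) (?add Q S)" by (intro ec_add_assoc[symmetric] ns on)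
  finally show ?thesis .
qed

text \<open>
  The ring End_ring is defined with pointwise addition as an operation; that the operation stays in
  the carrier is what makes the ring isomorphism usable. Additivity of the sum is commutativity and
  associativity of the group law, and regularity is provided by the addition laws.
\<close>

lemma endo_sum:
  assumes f: "f \<in> ec_endomorphisms (short a b)" and g: "g \<in> ec_endomorphisms (short a b)"
  shows "restrict (\<lambda>P. ec_add (short a b) (f P) (g P)) (points (short a b)) \<in> ec_endomorphisms (short a b)" (is "?fg \<in> _")
proof -
  have "ec_morphism (short a b) ?fg"
    by (rule ec_morphism_add[OF ns endo_morphism[OF f] endo_morphism[OF g]]) (simp only: restrict_apply')
  moreover have "?fg (ec_add (short a b) P Q) = ec_add (short a b) (?fg P) (?fg Q)"
    if "P \<in> points (short a b)" "Q \<in> points (short a b)" for P Q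
  proof -
    have on: "on_curve (short a b) P" "on_curve (short a b) Q" using that by (auto simp: points_def)
    then have mem: "ec_add (short a b) P Q \<in> points (short a b)" unfolding points_def using on_curve_add by blast
    show ?thesis using that mem
      by (simp add: endo_add[OF f on] endo_add[OF g on] del: ec_add.simps)
         (intro ec_add_interchange endo_on_curve[OF f] endo_on_curve[OF g] on)
  qed
  ultimately show ?thesis unfolding ec_endomorphisms_def using restrict_extensional by blast
qed

lemma ec_neg_add:
  assumes "on_curve (short a b) P" "on_curve (short a b) Q"
  shows "ec_neg (ec_add (short a b) P Q) = ec_add (short a b) (ec_neg P) (ec_neg Q)"
proof -
  have on: "on_curve (short a b) (ec_neg P)" "on_curve (short a b) (ec_neg Q)" using assms by auto
  have "ec_add (short a b) (ec_add (short a b) P Q) (ec_add (short a b) (ec_neg P) (ec_neg Q)) = Infinity"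
    by (subst ec_add_interchange[OF assms on]) simp
  then show ?thesis using ec_add_eq_Infinity by metis
qed

lemma endo_neg: "restrict ec_neg (points (short a b)) \<in> ec_endomorphisms (short a b)"
proof -
  let ?F = "\<lambda>v :: 'a \<times> 'a \<times> 'a. (fst v, (-1) * fst (snd v), snd (snd v))"
  have pc: "\<exists>k. ?F (proj_coords Q) = smul k (proj_coords (ec_neg Q))" for Q
  proof (cases Q)
    case Infinity
    then show ?thesis by (intro exI[of _ "-1"]) simp
  next
    case (Affine x y)
    then show ?thesis by (intro exI[of _ 1]) simp
  qed
  have F: "locally_given (short a b) (restrict ec_neg (points (short a b))) 1 ?F"
    unfolding locally_given_def is_form3_def
  proof (intro conjI ballI)
    show "\<exists>g0 g1 g2. is_form 1 g0 \<and> is_form 1 g1 \<and> is_form 1 g2 \<and> ?F = (\<lambda>v. (g0 v, g1 v, g2 v))"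
      by (intro exI[of _ "\<lambda>v. fst v"] exI[of _ "\<lambda>v. (-1) * fst (snd v)"] exI[of _ "\<lambda>v. snd (snd v)"]
        conjI is_form_coords is_form_scale) auto
  qed (use pc in auto)
  have nz: "?F (proj_coords P) \<noteq> (0, 0, 0)" for P by (cases P) auto
  have "restrict ec_neg (points (short a b)) \<in> points (short a b) \<rightarrow> points (short a b)"
    by (auto simp: points_def simp del: on_curve.simps)
  then have "ec_morphism (short a b) (restrict ec_neg (points (short a b)))"
    unfolding ec_morphism_iff using F nz by blast
  moreover have "ec_add (short a b) P Q \<in> points (short a b)"
    if "P \<in> points (short a b)" "Q \<in> points (short a b)" for P Q
    using that on_curve_add unfolding points_def by blast
  ultimately show ?thesis using ec_neg_add unfolding ec_endomorphisms_def points_def by auto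
qed

lemma endo_zero: "restrict (\<lambda>P. Infinity) (points (short a b)) \<in> ec_endomorphisms (short a b)"
proof -
  have "restrict (\<lambda>P. Infinity) (points (short a b)) =
    restrict (\<lambda>P. ec_add (short a b) (restrict id (points (short a b)) P)
        (restrict ec_neg (points (short a b)) P)) (points (short a b))"
    by (auto simp: restrict_def fun_eq_iff)
  then show ?thesis using endo_sum[OF endo_id endo_neg] by simp
qed

text \<open>
  The preimages of \<omega> and 1 - \<omega> under the ring isomorphism. All three equations hold in the ring
  of integers, and transfer because the isomorphism is injective. The equations f = 1 - g and
  g = 1 - f are stated both, since later one of them is used according to the multipliers.
\<close>

lemma CM_endomorphisms:
  assumes h: "h \<in> ring_iso (End_ring (short a b)) (ring_of_integers (quadratic_field (- 11)))"
  obtains f g where "f \<in> ec_endomorphisms (short a b)" "g \<in> ec_endomorphisms (short a b)"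
    "\<And>P. on_curve (short a b) P \<Longrightarrow> g (f P) = ec_add (short a b) (ec_add (short a b) P P) P"
    "\<And>P. on_curve (short a b) P \<Longrightarrow> g P = ec_add (short a b) P (ec_neg (f P))"
    "\<And>P. on_curve (short a b) P \<Longrightarrow> f P = ec_add (short a b) P (ec_neg (g P))"
proof -
  let ?E = "points (short a b)"
  define plus where "plus = (\<lambda>f g. restrict (\<lambda>P. ec_add (short a b) (f P) (g P)) ?E)"
  define one where "one = restrict id ?E"
  define neg where "neg = restrict ec_neg ?E"
  define zero where "zero = restrict (\<lambda>P. Infinity :: 'a point) ?E"
  define C where "C = ec_endomorphisms (short a b)"
  have C: "one \<in> C" "neg \<in> C" "zero \<in> C" "\<And>f g. f \<in> C \<Longrightarrow> g \<in> C \<Longrightarrow> plus f g \<in> C"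
     "\<And>f g. f \<in> C \<Longrightarrow> g \<in> C \<Longrightarrow> compose ?E f g \<in> C"
    using endo_id endo_neg endo_zero endo_sum endo_compose unfolding C_def one_def neg_def zero_def plus_def by blast+
  have h_one: "h one = 1" and h_mult: "\<And>f g. f \<in> C \<Longrightarrow> g \<in> C \<Longrightarrow> h (compose ?E f g) = h f * h g"
    and h_add: "\<And>f g. f \<in> C \<Longrightarrow> g \<in> C \<Longrightarrow> h (plus f g) = h f + h g"
    and bij: "bij_betw h C (carrier (ring_of_integers (quadratic_field (- 11))))"
    using ring_iso_memE[OF h] by (auto simp: End_ring_def ring_of_integers_def one_def plus_def C_def)
  have inj: "f = g" if "f \<in> C" "g \<in> C" "h f = h g" for f g
    using bij that unfolding bij_betw_def inj_on_def by blast
  define w :: complex where "w = (1 + csqrt (- 11)) / 2"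
  have w2: "(1 - w) * w = 3"
  proof -
    define r where "r = csqrt (- 11)"
    have "r ^ 2 = - 11" unfolding r_def by (rule power2_csqrt)
    then show ?thesis unfolding w_def r_def[symmetric] by (simp add: field_simps power2_eq_square)
  qed
  have w': "1 - w = (1 - csqrt (- 11)) / 2" unfolding w_def by (simp add: field_simps)
  have "w \<in> quadratic_field (- 11)" unfolding quadratic_field_def w_def
    by (rule CollectI, rule exI[of _ "1/2"], rule exI[of _ "1/2"]) (simp add: of_rat_divide add_divide_distrib)
  moreover have "1 - w \<in> quadratic_field (- 11)" unfolding quadratic_field_def w'
    by (rule CollectI, rule exI[of _ "1/2"], rule exI[of _ "-1/2"]) (simp add: of_rat_divide of_rat_minus diff_divide_distrib)
  ultimately have "w \<in> carrier (ring_of_integers (quadratic_field (- 11)))"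
    "1 - w \<in> carrier (ring_of_integers (quadratic_field (- 11)))"
    using algebraic_int_omega unfolding w' unfolding ring_of_integers_def w_def by auto
  then obtain f g where f: "f \<in> C" "h f = w" and g: "g \<in> C" "h g = 1 - w"
    using bij unfolding bij_betw_def by (metis imageE)
  have pts: "f P \<in> ?E" "g P \<in> ?E" if "P \<in> ?E" for P
    using f g that endo_on_curve unfolding C_def points_def by auto
  have "h (plus zero zero) = h zero + h zero" by (rule h_add) (rule C)+
  moreover have "plus zero zero = zero" by (auto simp: plus_def zero_def restrict_def)
  ultimately have "h zero = 0" by simp
  moreover have "h (plus one neg) = h one + h neg" by (intro h_add C)
  moreover have "plus one neg = zero"
    by (auto simp: plus_def zero_def one_def neg_def restrict_def fun_eq_iff)
  ultimately have h_neg: "h neg = - 1" using h_one by (simp add: eq_neg_iff_add_eq_0 add.commute)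
  have 1: "g = plus one (compose ?E neg f)"
    by (intro inj C f g) (simp add: h_add h_mult C f g h_one h_neg)
  have 2: "f = plus one (compose ?E neg g)"
    by (intro inj C f g) (simp add: h_add h_mult C f g h_one h_neg)
  have 3: "compose ?E g f = plus (plus one one) one"
    by (intro inj C f g) (simp add: h_add h_mult C f g h_one h_neg w2)
  show ?thesis
  proof (rule that[of f g])
    show "f \<in> ec_endomorphisms (short a b)" "g \<in> ec_endomorphisms (short a b)" using f g C_def by auto
    fix P assume "on_curve (short a b) P"
    then have P: "P \<in> ?E" by (simp add: points_def)
    show "g (f P) = ec_add (short a b) (ec_add (short a b) P P) P"
      using fun_cong[OF 3, of P] P by (simp add: compose_def plus_def one_def)
    show "g P = ec_add (short a b) P (ec_neg (f P))"
      using fun_cong[OF 1, of P] P pts[OF P] by (simp add: compose_def plus_def one_def neg_def)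
    show "f P = ec_add (short a b) P (ec_neg (g P))"
      using fun_cong[OF 2, of P] P pts[OF P] by (simp add: compose_def plus_def one_def neg_def)
  qed
qed
end

section \<open>Rational functions at infinity\<close>

text \<open>
  Rational functions are treated as functions on the field up to finitely many exceptions, with the
  filter of cofinite sets in the role of "for generic x". Thus composition and the
  evaluation on points of the curve need no separate algebraic construction.
\<close>

definition ratfun :: "('a::field_char_0 \<Rightarrow> 'a) \<Rightarrow> bool" where
  "ratfun g \<longleftrightarrow> (\<exists>N D. D \<noteq> 0 \<and> (\<forall>\<^sub>F x in cofinite. g x = poly N x / poly D x))"

text \<open>
  The value at infinity of a rational function, over an arbitrary field of characteristic 0: the
  comparison of leading coefficients replaces the topology.
\<close>

definition has_lim :: "('a::field_char_0 \<Rightarrow> 'a) \<Rightarrow> 'a \<Rightarrow> bool" where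
  "has_lim g l \<longleftrightarrow> (\<exists>N D. D \<noteq> 0 \<and> degree N \<le> degree D \<and> coeff N (degree D) = l * lead_coeff D \<and>
     (\<forall>\<^sub>F x in cofinite. g x = poly N x / poly D x))"

definition has_pole :: "('a::field_char_0 \<Rightarrow> 'a) \<Rightarrow> bool" where
  "has_pole g \<longleftrightarrow> (\<exists>N D. D \<noteq> 0 \<and> degree D < degree N \<and> (\<forall>\<^sub>F x in cofinite. g x = poly N x / poly D x))"

lemma not_eventually_False_cofinite: "\<not> (\<forall>\<^sub>F x :: 'a::field_char_0 in cofinite. False)"
  by (simp add: eventually_cofinite infinite_UNIV_char_0)

lemma eventually_poly_nz: "p \<noteq> 0 \<Longrightarrow> \<forall>\<^sub>F x in cofinite. poly (p :: 'a::field_char_0 poly) x \<noteq> 0"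
  using poly_roots_finite by (simp add: eventually_cofinite)

lemma poly_eqI_cofinite:
  assumes "\<forall>\<^sub>F x in cofinite. poly p x = poly q (x :: 'a::field_char_0)"
  shows "p = q"
proof (rule ccontr)
  assume "p \<noteq> q"
  then have "\<forall>\<^sub>F x in cofinite. poly (p - q) x \<noteq> 0" by (intro eventually_poly_nz) auto
  with assms have "\<forall>\<^sub>F x :: 'a in cofinite. False" by eventually_elim auto
  then show False using not_eventually_False_cofinite by blast
qed

lemma coeff_mult_top:
  assumes "degree p \<le> m" "degree q \<le> n"
  shows "coeff (p * q) (m + n) = coeff p m * coeff q n"
proof -
  have "coeff (p * q) (m + n) = (\<Sum>i\<le>m + n. coeff p i * coeff q (m + n - i))" by (rule coeff_mult)
  also have "\<dots> = (\<Sum>i\<le>m + n. if i = m then coeff p m * coeff q n else 0)"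
  proof (rule sum.cong)
    fix i assume "i \<in> {..m + n}"
    then show "coeff p i * coeff q (m + n - i) = (if i = m then coeff p m * coeff q n else 0)"
      using assms by (cases i m rule: linorder_cases) (auto simp: coeff_eq_0)
  qed simp
  finally show ?thesis by simp
qed

lemma has_lim_ratfun: "has_lim g l \<Longrightarrow> ratfun g"
  unfolding has_lim_def ratfun_def by blast

lemma has_limI:
  assumes "D \<noteq> 0" "degree N \<le> degree D" "coeff N (degree D) = l * lead_coeff D"
    "\<forall>\<^sub>F x in cofinite. g x = poly N x / poly D x"
  shows "has_lim g l"
  using assms unfolding has_lim_def by blast

lemma has_lim_const: "has_lim (\<lambda>x. c) c"
  by (rule has_limI[of 1 "[:c:]"]) auto

lemma has_lim_inverse_x: "has_lim (\<lambda>x. 1 / x) 0"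
  by (rule has_limI[of "[:0, 1:]" 1]) auto

lemma has_lim_cong:
  assumes "has_lim g l" "\<forall>\<^sub>F x in cofinite. g x = h x"
  shows "has_lim h l"
proof -
  obtain N D where *: "D \<noteq> 0" "degree N \<le> degree D" "coeff N (degree D) = l * lead_coeff D"
    "\<forall>\<^sub>F x in cofinite. g x = poly N x / poly D x" using assms unfolding has_lim_def by blast
  from *(4) assms(2) have "\<forall>\<^sub>F x in cofinite. h x = poly N x / poly D x"
    by eventually_elim simp
  then show ?thesis using * has_limI by blast
qed

lemma has_lim_add:
  assumes "has_lim g l" "has_lim h m"
  shows "has_lim (\<lambda>x. g x + h x) (l + m)"
proof -
  obtain N D where 1: "D \<noteq> 0" "degree N \<le> degree D" "coeff N (degree D) = l * lead_coeff D"
    "\<forall>\<^sub>F x in cofinite. g x = poly N x / poly D x" using assms unfolding has_lim_def by blast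
  obtain N' D' where 2: "D' \<noteq> 0" "degree N' \<le> degree D'" "coeff N' (degree D') = m * lead_coeff D'"
    "\<forall>\<^sub>F x in cofinite. h x = poly N' x / poly D' x" using assms unfolding has_lim_def by blast
  have deg: "degree (D * D') = degree D + degree D'" using 1 2 by (simp add: degree_mult_eq)
  show ?thesis
  proof (rule has_limI)
    show "D * D' \<noteq> 0" using 1 2 by simp
    show "degree (N * D' + D * N') \<le> degree (D * D')" unfolding deg
      by (rule degree_add_le; rule order_trans[OF degree_mult_le]) (use 1 2 in auto)
    show "coeff (N * D' + D * N') (degree (D * D')) = (l + m) * lead_coeff (D * D')"
      unfolding deg using 1 2 coeff_mult_top[of N "degree D" D' "degree D'"] coeff_mult_top[of D "degree D" N' "degree D'"]
      by (simp add: lead_coeff_mult algebra_simps coeff_mult_degree_sum)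
    show "\<forall>\<^sub>F x in cofinite. g x + h x = poly (N * D' + D * N') x / poly (D * D') x"
      using 1(4) 2(4) eventually_poly_nz[OF 1(1)] eventually_poly_nz[OF 2(1)]
      by eventually_elim (simp add: add_frac_eq)
  qed
qed

lemma has_lim_mult:
  assumes "has_lim g l" "has_lim h m"
  shows "has_lim (\<lambda>x. g x * h x) (l * m)"
proof -
  obtain N D where 1: "D \<noteq> 0" "degree N \<le> degree D" "coeff N (degree D) = l * lead_coeff D"
    "\<forall>\<^sub>F x in cofinite. g x = poly N x / poly D x" using assms unfolding has_lim_def by blast
  obtain N' D' where 2: "D' \<noteq> 0" "degree N' \<le> degree D'" "coeff N' (degree D') = m * lead_coeff D'"
    "\<forall>\<^sub>F x in cofinite. h x = poly N' x / poly D' x" using assms unfolding has_lim_def by blast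
  have deg: "degree (D * D') = degree D + degree D'" using 1 2 by (simp add: degree_mult_eq)
  show ?thesis
  proof (rule has_limI)
    show "D * D' \<noteq> 0" using 1 2 by simp
    show "degree (N * N') \<le> degree (D * D')" unfolding deg
      by (rule order_trans[OF degree_mult_le]) (use 1 2 in auto)
    show "coeff (N * N') (degree (D * D')) = (l * m) * lead_coeff (D * D')"
      unfolding deg using 1 2 coeff_mult_top[of N "degree D" N' "degree D'"]
      by (simp add: lead_coeff_mult algebra_simps coeff_mult_degree_sum)
    show "\<forall>\<^sub>F x in cofinite. g x * h x = poly (N * N') x / poly (D * D') x"
      using 1(4) 2(4) by eventually_elim simp
  qed
qed

lemma has_lim_inverse:
  assumes "has_lim g l" "l \<noteq> 0"
  shows "has_lim (\<lambda>x. 1 / g x) (1 / l)"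
proof -
  obtain N D where 1: "D \<noteq> 0" "degree N \<le> degree D" "coeff N (degree D) = l * lead_coeff D"
    "\<forall>\<^sub>F x in cofinite. g x = poly N x / poly D x" using assms unfolding has_lim_def by blast
  then have "coeff N (degree D) \<noteq> 0" using assms(2) by simp
  then have deg: "degree N = degree D" using le_degree 1(2) by (metis antisym)
  show ?thesis
    by (rule has_limI[of N D])
       (use 1 deg assms(2) in \<open>auto simp: field_simps elim!: eventually_mono\<close>)
qed

lemma has_lim_uminus: "has_lim g l \<Longrightarrow> has_lim (\<lambda>x. - g x) (- l)"
  using has_lim_mult[OF has_lim_const[of "-1"]] by simp

lemma has_lim_diff: "has_lim g l \<Longrightarrow> has_lim h m \<Longrightarrow> has_lim (\<lambda>x. g x - h x) (l - m)"
  using has_lim_add[of g l "\<lambda>x. - h x" "- m"] has_lim_uminus[of h m] by simp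

lemma has_lim_divide: "has_lim g l \<Longrightarrow> has_lim h m \<Longrightarrow> m \<noteq> 0 \<Longrightarrow> has_lim (\<lambda>x. g x / h x) (l / m)"
  using has_lim_mult[of g l "\<lambda>x. 1 / h x" "1 / m"] has_lim_inverse[of h m] by simp

lemma has_lim_power: "has_lim g l \<Longrightarrow> has_lim (\<lambda>x. g x ^ n) (l ^ n)"
  by (induction n) (auto intro: has_lim_mult has_lim_const[of 1, simplified])

lemma has_lim_unique:
  assumes "has_lim g l" "has_lim g m"
  shows "l = m"
proof -
  obtain N D where 1: "D \<noteq> 0" "degree N \<le> degree D" "coeff N (degree D) = l * lead_coeff D"
    "\<forall>\<^sub>F x in cofinite. g x = poly N x / poly D x" using assms unfolding has_lim_def by blast
  obtain N' D' where 2: "D' \<noteq> 0" "degree N' \<le> degree D'" "coeff N' (degree D') = m * lead_coeff D'"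
    "\<forall>\<^sub>F x in cofinite. g x = poly N' x / poly D' x" using assms unfolding has_lim_def by blast
  have "\<forall>\<^sub>F x in cofinite. poly (N * D') x = poly (D * N') x"
    using 1(4) 2(4) eventually_poly_nz[OF 1(1)] eventually_poly_nz[OF 2(1)]
    by eventually_elim (auto simp: field_simps)
  then have "N * D' = D * N'" by (rule poly_eqI_cofinite)
  then have "coeff (N * D') (degree D + degree D') = coeff (D * N') (degree D + degree D')" by simp
  then show ?thesis
    using 1 2 coeff_mult_top[of N "degree D" D' "degree D'"] coeff_mult_top[of D "degree D" N' "degree D'"]
    by simp
qed

lemma has_lim_eventually_nz:
  assumes "has_lim g l" "l \<noteq> 0"
  shows "\<forall>\<^sub>F x in cofinite. g x \<noteq> 0"
proof -
  obtain N D where 1: "D \<noteq> 0" "degree N \<le> degree D" "coeff N (degree D) = l * lead_coeff D"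
    "\<forall>\<^sub>F x in cofinite. g x = poly N x / poly D x" using assms unfolding has_lim_def by blast
  then have "N \<noteq> 0" using assms(2) by auto
  show ?thesis using 1(4) eventually_poly_nz[OF 1(1)] eventually_poly_nz[OF \<open>N \<noteq> 0\<close>]
    by eventually_elim auto
qed

lemma ratfun_zero_or_nz:
  assumes "ratfun g"
  shows "(\<forall>\<^sub>F x in cofinite. g x = 0) \<or> (\<forall>\<^sub>F x in cofinite. g x \<noteq> 0)"
proof -
  obtain N D where 1: "D \<noteq> 0" "\<forall>\<^sub>F x in cofinite. g x = poly N x / poly D x"
    using assms unfolding ratfun_def by blast
  show ?thesis
  proof (cases "N = 0")
    case True
    then show ?thesis using 1 by simp
  next
    case False
    have "\<forall>\<^sub>F x in cofinite. g x \<noteq> 0"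
      using 1(2) eventually_poly_nz[OF 1(1)] eventually_poly_nz[OF False]
      by eventually_elim auto
    then show ?thesis ..
  qed
qed

lemma ratfun_cases:
  assumes "ratfun g"
  shows "(\<exists>l. has_lim g l) \<or> has_pole g"
proof -
  obtain N D where 1: "D \<noteq> 0" "\<forall>\<^sub>F x in cofinite. g x = poly N x / poly D x"
    using assms unfolding ratfun_def by blast
  show ?thesis
  proof (cases "degree N \<le> degree D")
    case True
    then have "has_lim g (coeff N (degree D) / lead_coeff D)"
      using 1 by (intro has_limI[of D N]) auto
    then show ?thesis by blast
  next
    case False
    then have "has_pole g" using 1 unfolding has_pole_def by (intro exI[of _ N] exI[of _ D]) auto
    then show ?thesis ..
  qed
qed

text \<open>
  A nonconstant rational function takes each of the finitely many exceptional values only finitely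
  often.
\<close>

lemma eventually_at_pole:
  assumes "has_pole g" "\<forall>\<^sub>F x in cofinite. P x"
  shows "\<forall>\<^sub>F x in cofinite. P (g x)"
proof -
  obtain N D where 1: "D \<noteq> 0" "degree D < degree N" "\<forall>\<^sub>F x in cofinite. g x = poly N x / poly D x"
    using assms unfolding has_pole_def by blast
  have "\<forall>\<^sub>F x in cofinite. g x \<noteq> z" for z
  proof -
    have "degree (smult z D) < degree N" using 1(2) by (metis degree_smult_le le_less_trans)
    then have "N - smult z D \<noteq> 0" by auto
    show ?thesis using 1(3) eventually_poly_nz[OF 1(1)] eventually_poly_nz[OF \<open>N - smult z D \<noteq> 0\<close>]
      by eventually_elim (auto simp: field_simps)
  qed
  then have "\<forall>\<^sub>F x in cofinite. \<forall>z\<in>{z. \<not> P z}. g x \<noteq> z"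
    using assms(2) by (intro eventually_ball_finite) (auto simp: eventually_cofinite)
  then show ?thesis by eventually_elim auto
qed

text \<open>
  D^m p(N/D) as a polynomial, for the composition of p with the fraction N/D.
\<close>

definition homogenize :: "nat \<Rightarrow> 'a::comm_ring_1 poly \<Rightarrow> 'a poly \<Rightarrow> 'a poly \<Rightarrow> 'a poly" where
  "homogenize m p N D = (\<Sum>i\<le>m. smult (coeff p i) (N ^ i * D ^ (m - i)))"

lemma poly_homogenize:
  fixes p :: "'a::field poly"
  assumes "degree p \<le> m" "poly D x \<noteq> 0"
  shows "poly (homogenize m p N D) x = poly D x ^ m * poly p (poly N x / poly D x)"
proof -
  have "poly p z = (\<Sum>i\<le>m. coeff p i * z ^ i)" for z
    unfolding poly_altdef by (rule sum.mono_neutral_left) (use assms(1) in \<open>auto simp: coeff_eq_0\<close>)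
  moreover have "poly N x ^ i * poly D x ^ (m - i) = poly D x ^ m * (poly N x / poly D x) ^ i" if "i \<le> m" for i
    using that assms(2) by (simp add: power_divide power_diff field_simps)
  ultimately show ?thesis
    unfolding homogenize_def poly_sum by (auto simp: sum_distrib_left intro!: sum.cong)
qed

lemma homogenize_top:
  fixes p :: "'a::field poly"
  assumes "degree D < degree N"
  shows "degree (homogenize m p N D) \<le> m * degree N"
    and "coeff (homogenize m p N D) (m * degree N) = coeff p m * lead_coeff N ^ m"
proof -
  have N: "N \<noteq> 0" using assms by auto
  have deg: "degree (N ^ i * D ^ (m - i)) \<le> i * degree N + (m - i) * degree D" for i
    by (rule order_trans[OF degree_mult_le]) (intro add_mono degree_power_le[THEN order_trans], auto)
  have lt: "i * degree N + (m - i) * degree D < m * degree N" if "i < m" for i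
  proof -
    have "(m - i) * degree D < (m - i) * degree N" using assms that by simp
    then show ?thesis using that by (metis add_less_cancel_left add_mult_distrib le_add_diff_inverse less_imp_le)
  qed
  show "degree (homogenize m p N D) \<le> m * degree N"
    unfolding homogenize_def
  proof (rule degree_sum_le)
    fix i assume "i \<in> {..m}"
    then have "i * degree N + (m - i) * degree D \<le> m * degree N"
      using lt[of i] by (cases "i = m") auto
    then show "degree (smult (coeff p i) (N ^ i * D ^ (m - i))) \<le> m * degree N"
      using deg[of i] degree_smult_le by (meson order_trans)
  qed simp
  have "coeff (homogenize m p N D) (m * degree N) = (\<Sum>i\<le>m. if i = m then coeff p m * lead_coeff N ^ m else 0)"
    unfolding homogenize_def coeff_sum
  proof (rule sum.cong)
    fix i assume i: "i \<in> {..m}"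
    show "coeff (smult (coeff p i) (N ^ i * D ^ (m - i))) (m * degree N) =
        (if i = m then coeff p m * lead_coeff N ^ m else 0)"
    proof (cases "i = m")
      case True
      have "coeff (N ^ m) (m * degree N) = lead_coeff N ^ m"
        using N by (metis degree_power_eq lead_coeff_power)
      then show ?thesis using True by simp
    next
      case False
      then have "degree (N ^ i * D ^ (m - i)) < m * degree N"
        using i deg[of i] lt[of i] by auto
      then show ?thesis using False by (simp add: coeff_eq_0)
    qed
  qed simp
  then show "coeff (homogenize m p N D) (m * degree N) = coeff p m * lead_coeff N ^ m" by simp
qed

text \<open>
  A function with a pole at infinity maps infinity to itself.
\<close>

lemma has_lim_compose:
  assumes "has_lim r l" "has_pole g"
  shows "has_lim (\<lambda>x. r (g x)) l"
proof -
  obtain U V where 1: "V \<noteq> 0" "degree U \<le> degree V" "coeff U (degree V) = l * lead_coeff V"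
    "\<forall>\<^sub>F x in cofinite. r x = poly U x / poly V x" using assms unfolding has_lim_def by blast
  obtain N D where 2: "D \<noteq> 0" "degree D < degree N" "\<forall>\<^sub>F x in cofinite. g x = poly N x / poly D x"
    using assms unfolding has_pole_def by blast
  have N: "N \<noteq> 0" using 2 by auto
  let ?U = "homogenize (degree V) U N D" and ?V = "homogenize (degree V) V N D"
  have "coeff ?V (degree V * degree N) \<noteq> 0"
    unfolding homogenize_top(2)[OF 2(2)] using 1 N by simp
  then have deg: "degree ?V = degree V * degree N"
    using homogenize_top(1)[OF 2(2), of "degree V" V] le_degree by (metis antisym)
  show ?thesis
  proof (rule has_limI[of ?V ?U])
    show "?V \<noteq> 0" using \<open>coeff ?V (degree V * degree N) \<noteq> 0\<close> by auto
    show "degree ?U \<le> degree ?V" unfolding deg by (rule homogenize_top(1)[OF 2(2)])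
    show "coeff ?U (degree ?V) = l * lead_coeff ?V"
      unfolding deg homogenize_top(2)[OF 2(2)] using 1(3) by simp
    show "\<forall>\<^sub>F x in cofinite. r (g x) = poly ?U x / poly ?V x"
      using eventually_at_pole[OF assms(2) 1(4)] 2(3) eventually_poly_nz[OF 2(1)]
    proof eventually_elim
      case (elim x)
      have "poly ?U x = poly D x ^ degree V * poly U (poly N x / poly D x)"
        "poly ?V x = poly D x ^ degree V * poly V (poly N x / poly D x)"
        using elim(3) 1(2) by (intro poly_homogenize; simp)+
      then show ?case using elim by simp
    qed
  qed
qed

lemma has_pole_if_inverse_lim_0:
  assumes "ratfun g" "has_lim h 0" "\<forall>\<^sub>F x in cofinite. g x ^ 3 * h x = 1"
  shows "has_pole g"
proof (rule ccontr)
  assume "\<not> has_pole g"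
  then obtain l where "has_lim g l" using ratfun_cases[OF assms(1)] by blast
  then have "has_lim (\<lambda>x. g x ^ 3 * h x) (l ^ 3 * 0)"
    by (intro has_lim_mult has_lim_power assms)
  then have "has_lim (\<lambda>x. 1 :: 'a) 0" using has_lim_cong[OF _ assms(3)] by simp
  then show False using has_lim_unique[OF has_lim_const] by force
qed

lemma ratfun_mult: "ratfun g \<Longrightarrow> ratfun h \<Longrightarrow> ratfun (\<lambda>x. g x * h x)"
proof -
  assume "ratfun g" "ratfun h"
  then obtain N D N' D' where 1: "D \<noteq> 0" "\<forall>\<^sub>F x in cofinite. g x = poly N x / poly D x"
    "D' \<noteq> 0" "\<forall>\<^sub>F x in cofinite. h x = poly N' x / poly D' x"
    unfolding ratfun_def by blast
  have "\<forall>\<^sub>F x in cofinite. g x * h x = poly (N * N') x / poly (D * D') x"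
    using 1(2,4) by eventually_elim simp
  then show ?thesis unfolding ratfun_def using 1 by (intro exI[of _ "N * N'"] exI[of _ "D * D'"]) simp
qed

lemma ratfun_inverse: "ratfun g \<Longrightarrow> ratfun (\<lambda>x. 1 / g x)"
proof -
  assume "ratfun g"
  then obtain N D where 1: "D \<noteq> 0" "\<forall>\<^sub>F x in cofinite. g x = poly N x / poly D x"
    unfolding ratfun_def by blast
  show ?thesis
  proof (cases "N = 0")
    case True
    have "\<forall>\<^sub>F x in cofinite. 1 / g x = poly 0 x / poly 1 x"
      using 1(2) by eventually_elim (simp add: True)
    then show ?thesis unfolding ratfun_def by (intro exI[of _ 0] exI[of _ 1]) simp
  next
    case False
    have "\<forall>\<^sub>F x in cofinite. 1 / g x = poly D x / poly N x"
      using 1(2) by eventually_elim simp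
    then show ?thesis unfolding ratfun_def using False by blast
  qed
qed

lemma ratfun_poly: "ratfun (poly p)"
  unfolding ratfun_def by (intro exI[of _ p] exI[of _ 1]) simp

lemma ratfun_cong: "ratfun g \<Longrightarrow> \<forall>\<^sub>F x in cofinite. g x = h x \<Longrightarrow> ratfun h"
proof -
  assume "ratfun g" and eq: "\<forall>\<^sub>F x in cofinite. g x = h x"
  then obtain N D where 1: "D \<noteq> 0" "\<forall>\<^sub>F x in cofinite. g x = poly N x / poly D x"
    unfolding ratfun_def by blast
  have "\<forall>\<^sub>F x in cofinite. h x = poly N x / poly D x" using 1(2) eq by eventually_elim simp
  then show ?thesis unfolding ratfun_def using 1 by blast
qed

section \<open>Endomorphisms near the point at infinity\<close>

lemma has_lim_eq:
  "has_lim g l' \<Longrightarrow> \<forall>\<^sub>F x in cofinite. g x = h x \<Longrightarrow> l' = l \<Longrightarrow> has_lim h l"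
  using has_lim_cong by blast

lemma eventually_nz: "\<forall>\<^sub>F x in cofinite. x \<noteq> (0 :: 'a::field_char_0)"
  using eventually_poly_nz[of "[:0, 1:]"] by simp

lemma divide_eq_mult_divide_square:
  "y ^ 2 = r \<Longrightarrow> r \<noteq> 0 \<Longrightarrow> z / y = y * (z / r)" for y z r :: "'a::field"
  by (drule sym) (simp add: power2_eq_square)

context
  fixes a b :: "'a::{alg_closed_field, field_char_0}"
begin

abbreviation rhs :: "'a \<Rightarrow> 'a" where "rhs x \<equiv> x ^ 3 + a * x + b"

lemma eventually_rhs_nz: "\<forall>\<^sub>F x in cofinite. rhs x \<noteq> 0"
  using eventually_poly_nz[of "curve_poly a b"] by simp

lemma has_lim_rhs: "has_lim (\<lambda>x. rhs x / x ^ 3) 1"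
proof -
  have "has_lim (\<lambda>x. 1 + a * (1 / x) ^ 2 + b * (1 / x) ^ 3) (1 + a * 0 ^ 2 + b * 0 ^ 3)"
    by (intro has_lim_add has_lim_mult has_lim_power has_lim_const has_lim_inverse_x)
  moreover have "\<forall>\<^sub>F x in cofinite. 1 + a * (1 / x) ^ 2 + b * (1 / x) ^ 3 = rhs x / x ^ 3"
    using eventually_nz by eventually_elim (simp add: field_simps power2_eq_square power3_eq_cube)
  ultimately show ?thesis by (rule has_lim_eq) simp
qed

lemma ex_y: "\<exists>y. y ^ 2 = rhs x"
  by (rule nth_root_exists) simp

text \<open>
  The value at the point O at infinity of a function A(x) + y B(x) on the curve. Since y^2 grows like
  x^3, the summand y B(x) vanishes at O exactly if x^2 B(x) has a finite value at infinity.
\<close>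

definition curve_lim :: "('a \<Rightarrow> 'a \<Rightarrow> 'a) \<Rightarrow> 'a \<Rightarrow> bool" where
  "curve_lim g l \<longleftrightarrow> (\<exists>A B m. has_lim A l \<and> has_lim (\<lambda>x. x ^ 2 * B x) m \<and>
     (\<forall>\<^sub>F x in cofinite. \<forall>y. y ^ 2 = rhs x \<longrightarrow> g x y = A x + y * B x))"

lemma curve_limI:
  assumes "has_lim A l" "has_lim (\<lambda>x. x ^ 2 * B x) m"
    "\<forall>\<^sub>F x in cofinite. \<forall>y. y ^ 2 = rhs x \<longrightarrow> g x y = A x + y * B x"
  shows "curve_lim g l"
  unfolding curve_lim_def by (intro exI[of _ A] exI[of _ B] exI[of _ m] conjI assms)

lemma curve_lim_cong:
  assumes "curve_lim g l" "\<forall>\<^sub>F x in cofinite. \<forall>y. y ^ 2 = rhs x \<longrightarrow> g x y = h x y"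
  shows "curve_lim h l"
proof -
  obtain A B m where 1: "has_lim A l" "has_lim (\<lambda>x. x ^ 2 * B x) m"
     "\<forall>\<^sub>F x in cofinite. \<forall>y. y ^ 2 = rhs x \<longrightarrow> g x y = A x + y * B x"
    using assms(1) unfolding curve_lim_def by (elim exE conjE)
  have "\<forall>\<^sub>F x in cofinite. \<forall>y. y ^ 2 = rhs x \<longrightarrow> h x y = A x + y * B x"
    using 1(3) assms(2) by eventually_elim simp
  then show ?thesis by (rule curve_limI[OF 1(1,2)])
qed

lemma curve_lim_const: "curve_lim (\<lambda>x y. c) c"
  by (rule curve_limI[OF has_lim_const[of c], of "\<lambda>x. 0" 0]) (simp_all add: has_lim_const)

lemma curve_lim_add:
  assumes "curve_lim g l" "curve_lim h m"
  shows "curve_lim (\<lambda>x y. g x y + h x y) (l + m)"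
proof -
  obtain A B p where 1: "has_lim A l" "has_lim (\<lambda>x. x ^ 2 * B x) p"
     "\<forall>\<^sub>F x in cofinite. \<forall>y. y ^ 2 = rhs x \<longrightarrow> g x y = A x + y * B x"
    using assms(1) unfolding curve_lim_def by (elim exE conjE)
  obtain C D q where 2: "has_lim C m" "has_lim (\<lambda>x. x ^ 2 * D x) q"
     "\<forall>\<^sub>F x in cofinite. \<forall>y. y ^ 2 = rhs x \<longrightarrow> h x y = C x + y * D x"
    using assms(2) unfolding curve_lim_def by (elim exE conjE)
  have "\<forall>\<^sub>F x in cofinite. \<forall>y. y ^ 2 = rhs x \<longrightarrow> g x y + h x y = (A x + C x) + y * (B x + D x)"
    using 1(3) 2(3) by eventually_elim (simp add: algebra_simps)
  moreover have "has_lim (\<lambda>x. x ^ 2 * (B x + D x)) (p + q)"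
    using has_lim_add[OF 1(2) 2(2)] by (simp add: algebra_simps)
  ultimately show ?thesis unfolding curve_lim_def using has_lim_add[OF 1(1) 2(1)] 
    by (intro exI[of _ "\<lambda>x. A x + C x"] exI[of _ "\<lambda>x. B x + D x"] exI[of _ "p + q"]) simp
qed

lemma has_lim_rhs_mult:
  assumes "has_lim (\<lambda>x. x ^ 2 * B x) p" "has_lim (\<lambda>x. x ^ 2 * D x) q"
  shows "has_lim (\<lambda>x. rhs x * (B x * D x)) 0"
proof -
  have "has_lim (\<lambda>x. (rhs x / x ^ 3) * (1 / x) * ((x ^ 2 * B x) * (x ^ 2 * D x))) (1 * 0 * (p * q))"
    by (intro has_lim_mult has_lim_rhs has_lim_inverse_x assms)
  moreover have "\<forall>\<^sub>F x in cofinite. (rhs x / x ^ 3) * (1 / x) * ((x ^ 2 * B x) * (x ^ 2 * D x)) = rhs x * (B x * D x)"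
    using eventually_nz by eventually_elim (simp add: field_simps power2_eq_square power3_eq_cube)
  ultimately show ?thesis by (rule has_lim_eq) simp
qed

lemma curve_lim_mult:
  assumes "curve_lim g l" "curve_lim h m"
  shows "curve_lim (\<lambda>x y. g x y * h x y) (l * m)"
proof -
  obtain A B p where 1: "has_lim A l" "has_lim (\<lambda>x. x ^ 2 * B x) p"
     "\<forall>\<^sub>F x in cofinite. \<forall>y. y ^ 2 = rhs x \<longrightarrow> g x y = A x + y * B x"
    using assms(1) unfolding curve_lim_def by (elim exE conjE)
  obtain C D q where 2: "has_lim C m" "has_lim (\<lambda>x. x ^ 2 * D x) q"
     "\<forall>\<^sub>F x in cofinite. \<forall>y. y ^ 2 = rhs x \<longrightarrow> h x y = C x + y * D x"
    using assms(2) unfolding curve_lim_def by (elim exE conjE)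
  have *: "(u + y * v) * (w + y * z) = (u * w + y ^ 2 * (v * z)) + y * (u * z + v * w)" for u v w z y :: 'a
    by (simp add: algebra_simps power2_eq_square)
  have "\<forall>\<^sub>F x in cofinite. \<forall>y. y ^ 2 = rhs x \<longrightarrow>
      g x y * h x y = (A x * C x + rhs x * (B x * D x)) + y * (A x * D x + B x * C x)"
    using 1(3) 2(3) by eventually_elim (simp add: *)
  moreover have "has_lim (\<lambda>x. x ^ 2 * (A x * D x + B x * C x)) (l * q + p * m)"
    using has_lim_add[OF has_lim_mult[OF 1(1) 2(2)] has_lim_mult[OF 1(2) 2(1)]] by (simp add: algebra_simps)
  moreover have "has_lim (\<lambda>x. A x * C x + rhs x * (B x * D x)) (l * m)"
    using has_lim_add[OF has_lim_mult[OF 1(1) 2(1)] has_lim_rhs_mult[OF 1(2) 2(2)]] by simp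
  ultimately show ?thesis unfolding curve_lim_def
    by (intro exI[of _ "\<lambda>x. A x * C x + rhs x * (B x * D x)"] exI[of _ "\<lambda>x. A x * D x + B x * C x"]
        exI[of _ "l * q + p * m"]) simp
qed

lemma curve_lim_power: "curve_lim g l \<Longrightarrow> curve_lim (\<lambda>x y. g x y ^ n) (l ^ n)"
  by (induction n) (auto intro: curve_lim_mult curve_lim_const[of 1, simplified])

lemma curve_lim_sum:
  "(\<And>i. i \<in> I \<Longrightarrow> curve_lim (g i) (l i)) \<Longrightarrow> curve_lim (\<lambda>x y. \<Sum>i\<in>I. g i x y) (\<Sum>i\<in>I. l i)"
  by (induction I rule: infinite_finite_induct) (auto intro: curve_lim_add curve_lim_const[of 0, simplified])

lemma curve_lim_inverse_y: "curve_lim (\<lambda>x y. 1 / y) 0"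
proof -
  have "has_lim (\<lambda>x. 1 / (rhs x / x ^ 3) * (1 / x)) (1 / 1 * 0)"
    by (intro has_lim_mult has_lim_inverse has_lim_rhs has_lim_inverse_x) simp
  moreover have "\<forall>\<^sub>F x in cofinite. 1 / (rhs x / x ^ 3) * (1 / x) = x ^ 2 * (1 / rhs x)"
    using eventually_nz eventually_rhs_nz
    by eventually_elim (simp add: divide_simps power2_eq_square power3_eq_cube)
  ultimately have "has_lim (\<lambda>x. x ^ 2 * (1 / rhs x)) 0" by (rule has_lim_eq) simp
  moreover have "\<forall>\<^sub>F x in cofinite. \<forall>y. y ^ 2 = rhs x \<longrightarrow> 1 / y = 0 + y * (1 / rhs x)"
    using eventually_rhs_nz by eventually_elim (metis add_0 divide_eq_mult_divide_square)
  ultimately show ?thesis by (rule curve_limI[OF has_lim_const])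
qed

lemma curve_lim_x_over_y: "curve_lim (\<lambda>x y. x / y) 0"
proof -
  have "has_lim (\<lambda>x. 1 / (rhs x / x ^ 3)) (1 / 1)"
    by (intro has_lim_inverse has_lim_rhs) simp
  moreover have "\<forall>\<^sub>F x in cofinite. 1 / (rhs x / x ^ 3) = x ^ 2 * (x / rhs x)"
    using eventually_nz eventually_rhs_nz
    by eventually_elim (simp add: divide_simps power2_eq_square power3_eq_cube)
  ultimately have "has_lim (\<lambda>x. x ^ 2 * (x / rhs x)) 1" by (rule has_lim_eq) simp
  moreover have "\<forall>\<^sub>F x in cofinite. \<forall>y. y ^ 2 = rhs x \<longrightarrow> x / y = 0 + y * (x / rhs x)"
    using eventually_rhs_nz by eventually_elim (metis add_0 divide_eq_mult_divide_square)
  ultimately show ?thesis by (rule curve_limI[OF has_lim_const])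
qed

text \<open>
  Near O the functions x/y and 1/y are regular and vanish, so a form divided by y^d is regular at O
  with its value at (0 : 1 : 0).
\<close>

lemma curve_lim_form:
  assumes "is_form d g"
  shows "curve_lim (\<lambda>x y. g (x, y, 1) / y ^ d) (g (0, 1, 0))"
proof -
  obtain c where c: "g = ternary_form d c" using assms unfolding is_form_def by blast
  have lim: "curve_lim (\<lambda>x y. \<Sum>i\<le>d. \<Sum>j\<le>d - i. c i j * (x / y) ^ i * 1 ^ j * (1 / y) ^ (d - i - j))
          (\<Sum>i\<le>d. \<Sum>j\<le>d - i. c i j * 0 ^ i * 1 ^ j * 0 ^ (d - i - j))"
    by (intro curve_lim_sum curve_lim_mult curve_lim_power curve_lim_const curve_lim_x_over_y curve_lim_inverse_y)
  have eq: "\<forall>\<^sub>F x in cofinite. \<forall>y. y ^ 2 = rhs x \<longrightarrow>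
      (\<Sum>i\<le>d. \<Sum>j\<le>d - i. c i j * (x / y) ^ i * 1 ^ j * (1 / y) ^ (d - i - j)) = g (x, y, 1) / y ^ d"
    using eventually_rhs_nz
  proof eventually_elim
    case (elim x)
    show ?case
    proof (intro allI impI)
      fix y assume "y ^ 2 = rhs x"
      then have y: "y \<noteq> 0" using elim by auto
      have "c i j * (x / y) ^ i * 1 ^ j * (1 / y) ^ (d - i - j) = c i j * x ^ i * y ^ j * 1 ^ (d - i - j) / y ^ d"
        if "i \<le> d" "j \<le> d - i" for i j
      proof -
        have "y ^ d = y ^ i * y ^ j * y ^ (d - i - j)" using that by (simp flip: power_add)
        then show ?thesis using y by (simp add: power_divide)
      qed
      then show "(\<Sum>i\<le>d. \<Sum>j\<le>d - i. c i j * (x / y) ^ i * 1 ^ j * (1 / y) ^ (d - i - j)) = g (x, y, 1) / y ^ d"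
        unfolding c ternary_form.simps sum_divide_distrib by (intro sum.cong) auto
    qed
  qed
  have "(\<Sum>i\<le>d. \<Sum>j\<le>d - i. c i j * 0 ^ i * 1 ^ j * 0 ^ (d - i - j)) = g (0, 1, 0)"
    unfolding c by simp
  then show ?thesis using curve_lim_cong[OF lim eq] by simp
qed

definition acts :: "('a point \<Rightarrow> 'a point) \<Rightarrow> ('a \<Rightarrow> 'a) \<Rightarrow> ('a \<Rightarrow> 'a) \<Rightarrow> bool" where
  "acts f R S \<longleftrightarrow> ratfun R \<and> ratfun S \<and>
     (\<forall>\<^sub>F x in cofinite. \<forall>y. y ^ 2 = rhs x \<longrightarrow> f (Affine x y) = Affine (R x) (y * S x))"

lemma endo_Infinity:
  assumes ns: "4 * a ^ 3 + 27 * b ^ 2 \<noteq> 0" and f: "f \<in> ec_endomorphisms (short a b)"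
  shows "f Infinity = Infinity"
proof -
  let ?E = "short a b"
  have "f (ec_add ?E Infinity Infinity) = ec_add ?E (f Infinity) (f Infinity)"
    by (rule endo_add[OF f]) auto
  then have "ec_add ?E (f Infinity) Infinity = ec_add ?E (f Infinity) (f Infinity)" by simp
  then have "ec_add ?E (ec_neg (f Infinity)) (f Infinity) = ec_add ?E (ec_neg (f Infinity)) (ec_add ?E (f Infinity) (f Infinity))"
    by simp
  moreover have on_inf: "on_curve ?E (f Infinity)" using endo_on_curve[OF f] by simp
  moreover have neg_add: "ec_add ?E (ec_neg P) P = Infinity" for P
    using ec_add_neg[of a b "ec_neg P"] by simp
  ultimately show ?thesis
    using ec_add_assoc[OF ns, of "ec_neg (f Infinity)" "f Infinity" "f Infinity"] by simp
qed

text \<open>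
  The forms g0, g1, g2 that represent f near O are analysed in the coordinates x/y and z/y. Both
  ratios g0/g1 and g2/g1 are functions A(x) + y B(x) that vanish at O. As f commutes with the
  inversion (x, y) \<mapsto> (x, -y), their parts A are 0. Hence, the image (x', y') of
  (x, y) satisfies x'/y' = y k0(x) and 1/y' = y k2(x). Either k2 is 0 and so is f, or division yields
  R and S. The values at infinity in the claim are those of x^2 k0 and x^2 k2; the first of them is
  the multiplier of f.
\<close>

lemma endo_zero_or_acts:
  assumes ns: "4 * a ^ 3 + 27 * b ^ 2 \<noteq> 0" and f: "f \<in> ec_endomorphisms (short a b)"
  obtains "\<forall>\<^sub>F x in cofinite. \<forall>y. y ^ 2 = rhs x \<longrightarrow> f (Affine x y) = Infinity"
  | R S c e where "acts f R S" "\<forall>\<^sub>F x in cofinite. S x \<noteq> 0"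
      "has_lim (\<lambda>x. R x / (x * S x)) c" "has_lim (\<lambda>x. 1 / (x * S x)) e"
proof -
  let ?E = "short a b"
  have f_inf: "f Infinity = Infinity" by (rule endo_Infinity[OF ns f])
  have f_neg: "f (ec_neg P) = ec_neg (f P)" if "on_curve ?E P" for P
    using endo_add[OF f that, of "ec_neg P"] that f_inf
    by (intro ec_add_eq_Infinity[of a b]) simp
  obtain d F where F: "locally_given ?E f d F" "F (proj_coords Infinity) \<noteq> (0, 0, 0)"
  proof -
    have "Infinity \<in> points ?E" by (simp add: points_def)
    then show ?thesis using that endo_morphism[OF f] unfolding ec_morphism_iff by blast
  qed
  then obtain g0 g1 g2 where g: "is_form d g0" "is_form d g1" "is_form d g2" "F = (\<lambda>v. (g0 v, g1 v, g2 v))"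
  proof -
    have "is_form3 d F" using F(1) unfolding locally_given_def by (rule conjunct1)
    then show ?thesis using that unfolding is_form3_def by (elim exE conjE)
  qed
  have repr: "\<exists>k. g0 (proj_coords Q) = k * fst (proj_coords (f Q)) \<and> g1 (proj_coords Q) = k * fst (snd (proj_coords (f Q)))
      \<and> g2 (proj_coords Q) = k * snd (snd (proj_coords (f Q)))" if "on_curve ?E Q" for Q
  proof -
    have "Q \<in> points ?E" using that by (simp add: points_def del: on_curve.simps)
    then have "\<exists>k. F (proj_coords Q) = smul k (proj_coords (f Q))"
      using F(1)[unfolded locally_given_def] by (elim conjE) (rule bspec)
    then obtain k where k: "F (proj_coords Q) = smul k (proj_coords (f Q))" by (elim exE)
    obtain u Y Z where uvw: "proj_coords (f Q) = (u, Y, Z)" by (cases "proj_coords (f Q)")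
    show ?thesis using k unfolding g(4) uvw by (intro exI[of _ k]) simp
  qed
  obtain \<gamma> where inf: "g0 (0, 1, 0) = 0" "g1 (0, 1, 0) = \<gamma>" "g2 (0, 1, 0) = 0"
    using repr[of Infinity] f_inf by auto
  have \<gamma>: "\<gamma> \<noteq> 0" using F(2) inf unfolding g(4) by auto
  obtain A0 B0 m0 where 0: "has_lim A0 0" "has_lim (\<lambda>x. x ^ 2 * B0 x) m0"
     "\<forall>\<^sub>F x in cofinite. \<forall>y. y ^ 2 = rhs x \<longrightarrow> g0 (x, y, 1) / y ^ d = A0 x + y * B0 x"
    using curve_lim_form[OF g(1)] unfolding inf curve_lim_def by (elim exE conjE)
  obtain A1 B1 m1 where 1: "has_lim A1 \<gamma>" "has_lim (\<lambda>x. x ^ 2 * B1 x) m1"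
     "\<forall>\<^sub>F x in cofinite. \<forall>y. y ^ 2 = rhs x \<longrightarrow> g1 (x, y, 1) / y ^ d = A1 x + y * B1 x"
    using curve_lim_form[OF g(2)] unfolding inf curve_lim_def by (elim exE conjE)
  obtain A2 B2 m2 where 2: "has_lim A2 0" "has_lim (\<lambda>x. x ^ 2 * B2 x) m2"
     "\<forall>\<^sub>F x in cofinite. \<forall>y. y ^ 2 = rhs x \<longrightarrow> g2 (x, y, 1) / y ^ d = A2 x + y * B2 x"
    using curve_lim_form[OF g(3)] unfolding inf curve_lim_def by (elim exE conjE)
  \<comment> \<open>The norm of A1 + y B1: it turns the denominator of g0/g1 and g2/g1 into a function of x.\<close>
  define n where "n = (\<lambda>x. A1 x * A1 x - rhs x * (B1 x * B1 x))"
  have n: "has_lim n (\<gamma> * \<gamma>)"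
    unfolding n_def using has_lim_diff[OF has_lim_mult[OF 1(1) 1(1)] has_lim_rhs_mult[OF 1(2) 1(2)]] by simp
  then have n_nz: "\<forall>\<^sub>F x in cofinite. n x \<noteq> 0" by (rule has_lim_eventually_nz) (use \<gamma> in simp)
  define k0 k2 where "k0 = (\<lambda>x. (A1 x * B0 x - A0 x * B1 x) / n x)" and "k2 = (\<lambda>x. (A1 x * B2 x - A2 x * B1 x) / n x)"
  have lim_k: "has_lim (\<lambda>x. x ^ 2 * ((A1 x * B x - A x * B1 x) / n x)) ((\<gamma> * m - 0 * m1) / (\<gamma> * \<gamma>))"
    if "has_lim A 0" "has_lim (\<lambda>x. x ^ 2 * B x) m" for A B m
  proof -
    have "has_lim (\<lambda>x. (A1 x * (x ^ 2 * B x) - A x * (x ^ 2 * B1 x)) / n x) ((\<gamma> * m - 0 * m1) / (\<gamma> * \<gamma>))"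
      by (intro has_lim_divide has_lim_diff has_lim_mult 1 that n) (use \<gamma> in simp)
    moreover have "(\<lambda>x. (A1 x * (x ^ 2 * B x) - A x * (x ^ 2 * B1 x)) / n x) =
       (\<lambda>x. x ^ 2 * ((A1 x * B x - A x * B1 x) / n x))"
      by (auto simp: algebra_simps)
    ultimately show ?thesis by simp
  qed
  obtain e0 where e0: "has_lim (\<lambda>x. x ^ 2 * k0 x) e0" using lim_k[OF 0(1,2)] unfolding k0_def by blast
  obtain e2 where e2: "has_lim (\<lambda>x. x ^ 2 * k2 x) e2" using lim_k[OF 2(1,2)] unfolding k2_def by blast
  define u0 u2 where "u0 = (\<lambda>x. (A0 x * A1 x - rhs x * (B0 x * B1 x)) / n x)"
    and "u2 = (\<lambda>x. (A2 x * A1 x - rhs x * (B2 x * B1 x)) / n x)"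
  have quot: "(u + y * v) / (s + y * t) = (u * s - r * (v * t)) / w + y * ((s * v - u * t) / w)"
    if "y ^ 2 = r" "w = s * s - r * (t * t)" "w \<noteq> 0" for u v s t w r y :: 'a
  proof -
    have w: "w = (s + y * t) * (s - y * t)" using that by (simp add: algebra_simps power2_eq_square)
    have "(u + y * v) * (s - y * t) = (u * s - r * (v * t)) + y * (s * v - u * t)"
      unfolding that(1)[symmetric] by (simp add: algebra_simps power2_eq_square)
    moreover have "s + y * t \<noteq> 0" "s - y * t \<noteq> 0" using w that(3) by auto
    ultimately show ?thesis using that(3) unfolding w
      by (simp add: divide_simps)
  qed
  have pt: "\<forall>\<^sub>F x in cofinite. \<forall>y. y ^ 2 = rhs x \<longrightarrow>
     fst (snd (proj_coords (f (Affine x y)))) \<noteq> 0 \<and>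
     fst (proj_coords (f (Affine x y))) / fst (snd (proj_coords (f (Affine x y)))) = y * k0 x \<and>
     snd (snd (proj_coords (f (Affine x y)))) / fst (snd (proj_coords (f (Affine x y)))) = y * k2 x"
    using 0(3) 1(3) 2(3) n_nz eventually_rhs_nz
  proof eventually_elim
    case (elim x)
    have ratio: "fst (snd (proj_coords (f (Affine x y)))) \<noteq> 0 \<and>
       fst (proj_coords (f (Affine x y))) / fst (snd (proj_coords (f (Affine x y)))) = u0 x + y * k0 x \<and>
       snd (snd (proj_coords (f (Affine x y)))) / fst (snd (proj_coords (f (Affine x y)))) = u2 x + y * k2 x"
      if y: "y ^ 2 = rhs x" for y
    proof -
      have y0: "y \<noteq> 0" using y elim by auto
      obtain k where k: "g0 (x, y, 1) = k * fst (proj_coords (f (Affine x y)))"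
        "g1 (x, y, 1) = k * fst (snd (proj_coords (f (Affine x y))))"
        "g2 (x, y, 1) = k * snd (snd (proj_coords (f (Affine x y))))"
        using repr[of "Affine x y"] y by auto
      have "n x = (A1 x + y * B1 x) * (A1 x - y * B1 x)"
        unfolding n_def y[symmetric] by (simp add: algebra_simps power2_eq_square)
      then have nz: "A1 x + y * B1 x \<noteq> 0" using elim by auto
      then have g1: "g1 (x, y, 1) \<noteq> 0" using elim(2) y by force
      have "g0 (x, y, 1) / g1 (x, y, 1) = (A0 x + y * B0 x) / (A1 x + y * B1 x)"
        "g2 (x, y, 1) / g1 (x, y, 1) = (A2 x + y * B2 x) / (A1 x + y * B1 x)"
      proof -
        have "u / v = (u / y ^ d) / (v / y ^ d)" for u v using y0 by simp
        then show "g0 (x, y, 1) / g1 (x, y, 1) = (A0 x + y * B0 x) / (A1 x + y * B1 x)"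
          "g2 (x, y, 1) / g1 (x, y, 1) = (A2 x + y * B2 x) / (A1 x + y * B1 x)"
          using elim(1-3) y by metis+
      qed
      then have "g0 (x, y, 1) / g1 (x, y, 1) = u0 x + y * k0 x" "g2 (x, y, 1) / g1 (x, y, 1) = u2 x + y * k2 x"
        using quot[OF y n_def[THEN fun_cong] elim(4)] unfolding u0_def u2_def k0_def k2_def by auto
      then show ?thesis using g1 unfolding k by auto
    qed
    show ?case
    proof (intro allI impI)
      fix y assume y: "y ^ 2 = rhs x"
      then have my: "(- y) ^ 2 = rhs x" by simp
      have neg: "f (Affine x (- y)) = ec_neg (f (Affine x y))" using f_neg[of "Affine x y"] y by simp
      have "fst (proj_coords (ec_neg P)) / fst (snd (proj_coords (ec_neg P))) =
         - (fst (proj_coords P) / fst (snd (proj_coords P)))"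
        "snd (snd (proj_coords (ec_neg P))) / fst (snd (proj_coords (ec_neg P))) =
         - (snd (snd (proj_coords P)) / fst (snd (proj_coords P)))" for P :: "'a point"
        by (cases P; simp)+
      \<comment> \<open>The inversion changes the sign of y and of both ratios, so the parts without y cancel.\<close>
      then have "u0 x + (- y) * k0 x = - (u0 x + y * k0 x)" "u2 x + (- y) * k2 x = - (u2 x + y * k2 x)"
        using ratio[OF y] ratio[OF my] unfolding neg by metis+
      then have "u0 x = 0" "u2 x = 0" by (simp_all add: add_eq_0_iff eq_neg_iff_add_eq_0 flip: mult_2)
      then show "fst (snd (proj_coords (f (Affine x y)))) \<noteq> 0 \<and>
         fst (proj_coords (f (Affine x y))) / fst (snd (proj_coords (f (Affine x y)))) = y * k0 x \<and>
         snd (snd (proj_coords (f (Affine x y)))) / fst (snd (proj_coords (f (Affine x y)))) = y * k2 x"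
        using ratio[OF y] by simp
    qed
  qed
  have ratk: "ratfun k" if "has_lim (\<lambda>x. x ^ 2 * k x) e" for k e
  proof (rule ratfun_cong)
    show "ratfun (\<lambda>x. (x ^ 2 * k x) * (1 / (poly [:0, 0, 1:] x)))"
      by (intro ratfun_mult ratfun_inverse ratfun_poly has_lim_ratfun[OF that])
    show "\<forall>\<^sub>F x in cofinite. (x ^ 2 * k x) * (1 / (poly [:0, 0, 1:] x)) = k x"
      using eventually_nz by eventually_elim (simp add: power2_eq_square)
  qed
  note rk = ratk[OF e0] ratk[OF e2]
  from ratfun_zero_or_nz[OF rk(2)] show ?thesis
  proof
    assume "\<forall>\<^sub>F x in cofinite. k2 x = 0"
    with pt have "\<forall>\<^sub>F x in cofinite. \<forall>y. y ^ 2 = rhs x \<longrightarrow> f (Affine x y) = Infinity"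
    proof eventually_elim
      case (elim x)
      show ?case
      proof (intro allI impI)
        fix y assume "y ^ 2 = rhs x"
        then show "f (Affine x y) = Infinity" using elim by (cases "f (Affine x y)") auto
      qed
    qed
    then show ?thesis by (rule that(1))
  next
    assume k2: "\<forall>\<^sub>F x in cofinite. k2 x \<noteq> 0"
    define R S where "R = (\<lambda>x. k0 x * (1 / k2 x))" and "S = (\<lambda>x. (1 / poly (curve_poly a b) x) * (1 / k2 x))"
    have "\<forall>\<^sub>F x in cofinite. \<forall>y. y ^ 2 = rhs x \<longrightarrow> f (Affine x y) = Affine (R x) (y * S x)"
      using pt k2 eventually_rhs_nz
    proof eventually_elim
      case (elim x)
      show ?case
      proof (intro allI impI)
        fix y assume y: "y ^ 2 = rhs x"
        then have y0: "y \<noteq> 0" using elim by auto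
        show "f (Affine x y) = Affine (R x) (y * S x)"
        proof (cases "f (Affine x y)")
          case Infinity
          then show ?thesis using elim y y0 by auto
        next
          case (Affine u Y)
          have uv: "Y \<noteq> 0" "u / Y = y * k0 x" "1 / Y = y * k2 x"
            using elim(1)[rule_format, OF y] unfolding Affine by simp_all
          have Y: "Y = 1 / (y * k2 x)" unfolding uv(3)[symmetric] by simp
          have "u = y * k0 x * Y" unfolding uv(2)[symmetric] using uv(1) by simp
          then have "u = R x" unfolding Y R_def using y0 by simp
          moreover have "Y = y * S x" unfolding Y S_def poly_curve_poly y[symmetric] using y0
            by (simp add: power2_eq_square)
          ultimately show ?thesis using Affine by simp
        qed
      qed
    qed
    moreover have "ratfun R" "ratfun S" unfolding R_def S_def by (intro ratfun_mult ratfun_inverse ratfun_poly rk)+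
    ultimately have "acts f R S" unfolding acts_def by blast
    moreover have "\<forall>\<^sub>F x in cofinite. S x \<noteq> 0"
      using k2 eventually_rhs_nz by eventually_elim (simp add: S_def)
    moreover have "has_lim (\<lambda>x. R x / (x * S x)) (1 * e0)"
    proof (rule has_lim_cong[OF has_lim_mult[OF has_lim_rhs e0]])
      show "\<forall>\<^sub>F x in cofinite. rhs x / x ^ 3 * (x ^ 2 * k0 x) = R x / (x * S x)"
        using k2 eventually_rhs_nz eventually_nz
        by eventually_elim (simp add: R_def S_def power2_eq_square power3_eq_cube)
    qed
    moreover have "has_lim (\<lambda>x. 1 / (x * S x)) (1 * e2)"
    proof (rule has_lim_cong[OF has_lim_mult[OF has_lim_rhs e2]])
      show "\<forall>\<^sub>F x in cofinite. rhs x / x ^ 3 * (x ^ 2 * k2 x) = 1 / (x * S x)"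
        using k2 eventually_rhs_nz eventually_nz
        by eventually_elim (simp add: S_def power2_eq_square power3_eq_cube)
    qed
    ultimately show ?thesis by (rule that(2))
  qed
qed

end

section \<open>The multiplier of the CM endomorphism\<close>

lemma split_fraction: "s \<noteq> 0 \<Longrightarrow> (r * s - u - v) / (z * s) = r / z - u / (z * s) - v / (z * s)"
  for r s u v z :: "'a::field"
  by (simp add: diff_divide_distrib)

context
  fixes a b :: "'a::{alg_closed_field, field_char_0}"
begin

lemma acts_eventually_eq:
  assumes "\<forall>\<^sub>F x in cofinite. \<forall>y. y ^ 2 = rhs a b x \<longrightarrow> f (Affine x y) = Affine (R x) (y * S x)"
    and "\<forall>\<^sub>F x in cofinite. \<forall>y. y ^ 2 = rhs a b x \<longrightarrow> f (Affine x y) = Affine (R' x) (y * S' x)"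
  shows "\<forall>\<^sub>F x in cofinite. R x = R' x \<and> S x = S' x"
  using assms eventually_rhs_nz[of a b]
proof eventually_elim
  case (elim x)
  obtain y where y: "y ^ 2 = rhs a b x" using ex_y by blast
  then have "y \<noteq> 0" using elim by auto
  moreover have "Affine (R x) (y * S x) = Affine (R' x) (y * S' x)" using elim(1,2) y by metis
  ultimately show ?case by simp
qed

lemma acts_on_curve:
  assumes "acts a b f R S" "\<And>P. on_curve (short a b) P \<Longrightarrow> on_curve (short a b) (f P)"
  shows "\<forall>\<^sub>F x in cofinite. rhs a b x * S x ^ 2 = R x ^ 3 + a * R x + b"
  using assms(1)[unfolded acts_def, THEN conjunct2, THEN conjunct2]
proof eventually_elim
  case (elim x)
  obtain y where y: "y ^ 2 = rhs a b x" using ex_y by blast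
  then have "on_curve (short a b) (Affine (R x) (y * S x))"
    using assms(2)[of "Affine x y"] elim by simp
  then show ?case using y by (simp add: power_mult_distrib)
qed

text \<open>
  The equation of the curve for (R, y S), divided by x^3 S^2, shows that (R/(x S))^3 S and
  (x^3 + a x + b)/x^3 have the same value 1 at infinity, since the other terms vanish there. Then
  1/R^3 is the inverse of the former function times (1/(x S))^2/x and vanishes at infinity.
\<close>

lemma acts_pole:
  assumes f: "acts a b f R S" and S: "\<forall>\<^sub>F x in cofinite. S x \<noteq> 0"
    and k: "has_lim (\<lambda>x. R x / (x * S x)) c" and e: "has_lim (\<lambda>x. 1 / (x * S x)) e"
    and curve: "\<forall>\<^sub>F x in cofinite. rhs a b x * S x ^ 2 = R x ^ 3 + a * R x + b"
  shows "has_lim (\<lambda>x. (R x / (x * S x)) ^ 3 * S x) 1" "has_pole R"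
proof -
  have "has_lim (\<lambda>x. rhs a b x / x ^ 3 - a * ((R x / (x * S x)) * (1 / (x * S x)) * (1 / x))
           - b * ((1 / (x * S x)) ^ 2 * (1 / x))) (1 - a * (c * e * 0) - b * (e ^ 2 * 0))"
    by (intro has_lim_diff has_lim_mult has_lim_power has_lim_const has_lim_rhs has_lim_inverse_x k e)
  moreover have "\<forall>\<^sub>F x in cofinite. rhs a b x / x ^ 3 - a * ((R x / (x * S x)) * (1 / (x * S x)) * (1 / x))
           - b * ((1 / (x * S x)) ^ 2 * (1 / x)) = (R x / (x * S x)) ^ 3 * S x"
    using curve S eventually_nz
  proof eventually_elim
    case (elim x)
    have "(R x / (x * S x)) ^ 3 * S x = R x ^ 3 / (x ^ 3 * S x ^ 2)"
      using elim by (simp add: field_simps power2_eq_square power3_eq_cube)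
    also have "R x ^ 3 = rhs a b x * S x ^ 2 - a * R x - b" using elim by (simp add: algebra_simps)
    also have "(rhs a b x * S x ^ 2 - a * R x - b) / (x ^ 3 * S x ^ 2) =
        rhs a b x / x ^ 3 - (a * R x) / (x ^ 3 * S x ^ 2) - b / (x ^ 3 * S x ^ 2)"
      by (rule split_fraction) (use elim in simp)
    also have "(a * R x) / (x ^ 3 * S x ^ 2) = a * ((R x / (x * S x)) * (1 / (x * S x)) * (1 / x))"
      by (simp add: power2_eq_square power3_eq_cube ac_simps)
    also have "b / (x ^ 3 * S x ^ 2) = b * ((1 / (x * S x)) ^ 2 * (1 / x))"
      by (simp add: power2_eq_square power3_eq_cube ac_simps)
    finally show ?case ..
  qed
  ultimately show lim: "has_lim (\<lambda>x. (R x / (x * S x)) ^ 3 * S x) 1" by (rule has_lim_eq) simp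
  have "has_lim (\<lambda>x. 1 / ((R x / (x * S x)) ^ 3 * S x) * ((1 / (x * S x)) ^ 2 * (1 / x))) (1 / 1 * (e ^ 2 * 0))"
    by (intro has_lim_mult has_lim_power has_lim_inverse has_lim_inverse_x e lim) simp
  then have h: "has_lim (\<lambda>x. 1 / ((R x / (x * S x)) ^ 3 * S x) * ((1 / (x * S x)) ^ 2 * (1 / x))) 0" by simp
  show "has_pole R"
  proof (rule has_pole_if_inverse_lim_0[OF _ h])
    show "ratfun R" using f unfolding acts_def by blast
    show "\<forall>\<^sub>F x in cofinite. R x ^ 3 * (1 / ((R x / (x * S x)) ^ 3 * S x) * ((1 / (x * S x)) ^ 2 * (1 / x))) = 1"
      using has_lim_eventually_nz[OF lim one_neq_zero] S eventually_nz
      by eventually_elim (auto simp: field_simps power2_eq_square power3_eq_cube)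
  qed
qed

text \<open>
  The number c is the multiplier. In the local parameter t = x/y at O the map is t \<mapsto> c t + ..., and
  since x = t^(-2) + ..., its coordinates scale by 1/c^2 and 1/c^3.
\<close>

definition acts_lim :: "('a point \<Rightarrow> 'a point) \<Rightarrow> ('a \<Rightarrow> 'a) \<Rightarrow> ('a \<Rightarrow> 'a) \<Rightarrow> 'a \<Rightarrow> bool" where
  "acts_lim f R S c \<longleftrightarrow> acts a b f R S \<and> c \<noteq> 0 \<and> has_lim (\<lambda>x. R x / x) ((1 / c) ^ 2) \<and> has_lim S ((1 / c) ^ 3)"

lemma acts_limI:
  assumes f: "acts a b f R S" and S: "\<forall>\<^sub>F x in cofinite. S x \<noteq> 0"
    and k: "has_lim (\<lambda>x. R x / (x * S x)) c" and lim: "has_lim (\<lambda>x. (R x / (x * S x)) ^ 3 * S x) 1"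
    and c: "c \<noteq> 0"
  shows "acts_lim f R S c"
proof -
  have "has_lim (\<lambda>x. ((R x / (x * S x)) ^ 3 * S x) / (R x / (x * S x)) ^ 3) (1 / c ^ 3)"
    by (intro has_lim_divide has_lim_power lim k) (use c in simp)
  moreover have "\<forall>\<^sub>F x in cofinite. ((R x / (x * S x)) ^ 3 * S x) / (R x / (x * S x)) ^ 3 = S x"
    using has_lim_eventually_nz[OF k c] by eventually_elim simp
  ultimately have limS: "has_lim S ((1 / c) ^ 3)" by (rule has_lim_eq) (simp add: power_divide)
  have "has_lim (\<lambda>x. (R x / (x * S x)) * S x) (c * (1 / c) ^ 3)"
    by (intro has_lim_mult k limS)
  moreover have "\<forall>\<^sub>F x in cofinite. (R x / (x * S x)) * S x = R x / x"
    using S by eventually_elim simp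
  ultimately have "has_lim (\<lambda>x. R x / x) ((1 / c) ^ 2)"
    by (rule has_lim_eq) (use c in \<open>simp add: power2_eq_square power3_eq_cube\<close>)
  then show ?thesis using f c limS unfolding acts_lim_def by blast
qed

lemma acts_lim_k:
  assumes "acts_lim f R S c"
  shows "has_lim (\<lambda>x. R x / (x * S x)) c"
proof -
  have "has_lim (\<lambda>x. (R x / x) / S x) ((1 / c) ^ 2 / (1 / c) ^ 3)"
    using assms unfolding acts_lim_def by (intro has_lim_divide) auto
  then show ?thesis using assms unfolding acts_lim_def
    by (simp add: power2_eq_square power3_eq_cube)
qed

text \<open>
  The multiplier is the derivative at O, so it is additive. The sum is computed with the chord
  formula, and c1^2 \<noteq> c2^2 ensures that the chord is neither vertical nor a tangent for generic x:
  then R1/x and R2/x have different values at infinity.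
\<close>

lemma acts_lim_add:
  assumes f: "acts_lim f R1 S1 c1" and g: "acts_lim g R2 S2 c2" and c: "c1 ^ 2 \<noteq> c2 ^ 2"
    and h: "\<And>P. on_curve (short a b) P \<Longrightarrow> h P = ec_add (short a b) (f P) (g P)"
  defines "m \<equiv> \<lambda>x. (S2 x - S1 x) / (R2 x - R1 x)"
  defines "R3 \<equiv> \<lambda>x. rhs a b x * m x ^ 2 - R1 x - R2 x"
  defines "S3 \<equiv> \<lambda>x. - (S1 x + m x * (R3 x - R1 x))"
  shows "acts_lim h R3 S3 (c1 + c2)"
proof -
  note f' = f[unfolded acts_lim_def] and g' = g[unfolded acts_lim_def]
  have c0: "c1 \<noteq> 0" "c2 \<noteq> 0" using f' g' by auto
  have s: "c1 + c2 \<noteq> 0" using c by (metis add_eq_0_iff power2_minus add.commute)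
  define u v w where "u = 1 / c1" "v = 1 / c2" "w = 1 / (c1 + c2)"
  have uv: "u * v = w * (u + v)" using c0 s by (simp add: u_v_w_def divide_simps)
  have ne: "v ^ 2 - u ^ 2 \<noteq> 0" using c c0 by (simp add: u_v_w_def power_divide field_simps)
  have lims: "has_lim (\<lambda>x. R1 x / x) (u ^ 2)" "has_lim S1 (u ^ 3)" "has_lim (\<lambda>x. R2 x / x) (v ^ 2)" "has_lim S2 (v ^ 3)"
    using f' g' unfolding u_v_w_def by auto
  have "(u + v - w) * (v ^ 2 - u ^ 2) = v ^ 3 - u ^ 3"
  proof -
    have "(u + v - w) * (v ^ 2 - u ^ 2) = (v - u) * ((u + v) ^ 2 - w * (u + v))"
      by (simp add: algebra_simps power2_eq_square)
    then show ?thesis unfolding uv[symmetric] by (simp add: algebra_simps power2_eq_square power3_eq_cube)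
  qed
  then have mu: "(v ^ 3 - u ^ 3) / (v ^ 2 - u ^ 2) = u + v - w" using ne by (simp add: field_simps)
  have lim_diff: "has_lim (\<lambda>x. R2 x / x - R1 x / x) (v ^ 2 - u ^ 2)" by (intro has_lim_diff lims)
  have Rne: "\<forall>\<^sub>F x in cofinite. R1 x \<noteq> R2 x"
    using has_lim_eventually_nz[OF lim_diff ne] by eventually_elim auto
  have "has_lim (\<lambda>x. (S2 x - S1 x) / (R2 x / x - R1 x / x)) ((v ^ 3 - u ^ 3) / (v ^ 2 - u ^ 2))"
    by (intro has_lim_divide has_lim_diff lims ne)
  moreover have "\<forall>\<^sub>F x in cofinite. (S2 x - S1 x) / (R2 x / x - R1 x / x) = x * m x"
    using eventually_nz by eventually_elim (simp add: m_def flip: diff_divide_distrib)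
  ultimately have lim_m: "has_lim (\<lambda>x. x * m x) (u + v - w)" by (rule has_lim_eq) (rule mu)
  have "has_lim (\<lambda>x. (rhs a b x / x ^ 3) * (x * m x) ^ 2 - R1 x / x - R2 x / x) (1 * (u + v - w) ^ 2 - u ^ 2 - v ^ 2)"
    by (intro has_lim_diff has_lim_mult has_lim_power has_lim_rhs lim_m lims)
  moreover have "\<forall>\<^sub>F x in cofinite. (rhs a b x / x ^ 3) * (x * m x) ^ 2 - R1 x / x - R2 x / x = R3 x / x"
    using eventually_nz
    by eventually_elim (simp add: R3_def diff_divide_distrib power_mult_distrib power2_eq_square power3_eq_cube)
  moreover have "1 * (u + v - w) ^ 2 - u ^ 2 - v ^ 2 = w ^ 2"
  proof -
    have "1 * (u + v - w) ^ 2 - u ^ 2 - v ^ 2 = 2 * (u * v) - 2 * (w * (u + v)) + w ^ 2"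
      by (simp add: algebra_simps power2_eq_square)
    then show ?thesis unfolding uv by simp
  qed
  ultimately have lim_R: "has_lim (\<lambda>x. R3 x / x) (w ^ 2)" by (rule has_lim_eq)
  have "has_lim (\<lambda>x. - (S1 x + (x * m x) * (R3 x / x - R1 x / x))) (- (u ^ 3 + (u + v - w) * (w ^ 2 - u ^ 2)))"
    by (intro has_lim_uminus has_lim_add has_lim_mult has_lim_diff lims lim_m lim_R)
  moreover have "\<forall>\<^sub>F x in cofinite. - (S1 x + (x * m x) * (R3 x / x - R1 x / x)) = S3 x"
    using eventually_nz by eventually_elim (simp add: S3_def flip: diff_divide_distrib)
  moreover have "- (u ^ 3 + (u + v - w) * (w ^ 2 - u ^ 2)) = w ^ 3"
  proof -
    have "w ^ 3 + (u ^ 3 + (u + v - w) * (w ^ 2 - u ^ 2)) = (u + w) * (w * (u + v) - u * v)"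
      by (simp add: algebra_simps power2_eq_square power3_eq_cube)
    then show ?thesis unfolding uv by (simp add: add_eq_0_iff2)
  qed
  ultimately have lim_S: "has_lim S3 (w ^ 3)" by (rule has_lim_eq)
  have ratR: "ratfun R3"
  proof (rule ratfun_cong)
    show "ratfun (\<lambda>x. R3 x / x * poly [:0, 1:] x)"
      by (intro ratfun_mult ratfun_poly has_lim_ratfun[OF lim_R])
    show "\<forall>\<^sub>F x in cofinite. R3 x / x * poly [:0, 1:] x = R3 x"
      using eventually_nz by eventually_elim simp
  qed
  have "\<forall>\<^sub>F x in cofinite. \<forall>y. y ^ 2 = rhs a b x \<longrightarrow> h (Affine x y) = Affine (R3 x) (y * S3 x)"
    using f'[THEN conjunct1, unfolded acts_def, THEN conjunct2, THEN conjunct2]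
      g'[THEN conjunct1, unfolded acts_def, THEN conjunct2, THEN conjunct2] Rne
  proof eventually_elim
    case (elim x)
    show ?case
    proof (intro allI impI)
      fix y assume y: "y ^ 2 = rhs a b x"
      have "h (Affine x y) = ec_add (short a b) (Affine (R1 x) (y * S1 x)) (Affine (R2 x) (y * S2 x))"
        using h[of "Affine x y"] elim y by simp
      also have "(y * S2 x - y * S1 x) / (R2 x - R1 x) = y * m x"
        unfolding m_def by (simp add: right_diff_distrib)
      then have "ec_add (short a b) (Affine (R1 x) (y * S1 x)) (Affine (R2 x) (y * S2 x)) =
        Affine ((y * m x) ^ 2 - R1 x - R2 x) (- (y * S1 x + (y * m x) * ((y * m x) ^ 2 - R1 x - R2 x - R1 x)))"
        using elim(3) by (simp add: Let_def)
      also have "(y * m x) ^ 2 - R1 x - R2 x = R3 x"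
        unfolding R3_def power_mult_distrib y ..
      also have "- (y * S1 x + (y * m x) * (R3 x - R1 x)) = y * S3 x"
        unfolding S3_def by (simp add: algebra_simps)
      finally show "h (Affine x y) = Affine (R3 x) (y * S3 x)" .
    qed
  qed
  then have "acts a b h R3 S3" unfolding acts_def using ratR has_lim_ratfun[OF lim_S] by blast
  then show ?thesis unfolding acts_lim_def using s lim_R lim_S unfolding u_v_w_def by blast
qed

text \<open>
  The tangent formula, written with y^2 replaced by the cubic in x.
\<close>

definition dbl_x :: "'a \<Rightarrow> 'a" where
  "dbl_x x = (3 * x ^ 2 + a) ^ 2 / (4 * rhs a b x) - 2 * x"

definition dbl_y :: "'a \<Rightarrow> 'a" where
  "dbl_y x = - (1 + (3 * x ^ 2 + a) / (2 * rhs a b x) * (dbl_x x - x))"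

lemma acts_lim_double: "acts_lim (\<lambda>P. ec_add (short a b) P P) dbl_x dbl_y 2"
proof -
  have lim1: "has_lim (\<lambda>x. (3 + a * (1 / x) ^ 2)) (3 + a * 0 ^ 2)"
    by (intro has_lim_add has_lim_mult has_lim_power has_lim_const has_lim_inverse_x)
  have "has_lim (\<lambda>x. (3 + a * (1 / x) ^ 2) ^ 2 * (1 / 4) / (rhs a b x / x ^ 3) - 2) ((3 + a * 0 ^ 2) ^ 2 * (1 / 4) / 1 - 2)"
    by (intro has_lim_diff has_lim_divide has_lim_mult has_lim_power lim1 has_lim_rhs has_lim_const) simp
  moreover have "\<forall>\<^sub>F x in cofinite. (3 + a * (1 / x) ^ 2) ^ 2 * (1 / 4) / (rhs a b x / x ^ 3) - 2 = dbl_x x / x"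
    using eventually_nz eventually_rhs_nz[of a b]
  proof eventually_elim
    case (elim x)
    have "3 + a * (1 / x) ^ 2 = (3 * x ^ 2 + a) / x ^ 2" using elim by (simp add: add_divide_distrib power_divide)
    then show ?case using elim unfolding dbl_x_def
      by (simp add: diff_divide_distrib power_divide power2_eq_square power3_eq_cube)
  qed
  ultimately have limR: "has_lim (\<lambda>x. dbl_x x / x) ((1 / 2) ^ 2)" by (rule has_lim_eq) (simp add: power2_eq_square)
  have "has_lim (\<lambda>x. - (1 + (3 + a * (1 / x) ^ 2) * (1 / 2) / (rhs a b x / x ^ 3) * (dbl_x x / x - 1)))
     (- (1 + (3 + a * 0 ^ 2) * (1 / 2) / 1 * ((1 / 2) ^ 2 - 1)))"
    by (intro has_lim_uminus has_lim_add has_lim_mult has_lim_divide has_lim_diff lim1 limR has_lim_rhs has_lim_const) simp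
  moreover have "\<forall>\<^sub>F x in cofinite. - (1 + (3 + a * (1 / x) ^ 2) * (1 / 2) / (rhs a b x / x ^ 3) * (dbl_x x / x - 1)) = dbl_y x"
    using eventually_nz eventually_rhs_nz[of a b]
  proof eventually_elim
    case (elim x)
    have "3 + a * (1 / x) ^ 2 = (3 * x ^ 2 + a) / x ^ 2" using elim by (simp add: add_divide_distrib power_divide)
    moreover have "dbl_x x / x - 1 = (dbl_x x - x) / x" using elim by (simp add: diff_divide_distrib)
    ultimately show ?case using elim unfolding dbl_y_def
      by (simp add: power2_eq_square power3_eq_cube)
  qed
  ultimately have limS: "has_lim dbl_y ((1 / 2) ^ 3)" by (rule has_lim_eq) (simp add: power2_eq_square power3_eq_cube)
  have ratR: "ratfun dbl_x"
  proof (rule ratfun_cong)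
    show "ratfun (\<lambda>x. dbl_x x / x * poly [:0, 1:] x)"
      by (intro ratfun_mult ratfun_poly has_lim_ratfun[OF limR])
    show "\<forall>\<^sub>F x in cofinite. dbl_x x / x * poly [:0, 1:] x = dbl_x x"
      using eventually_nz by eventually_elim simp
  qed
  have "\<forall>\<^sub>F x in cofinite. \<forall>y. y ^ 2 = rhs a b x \<longrightarrow> ec_add (short a b) (Affine x y) (Affine x y) = Affine (dbl_x x) (y * dbl_y x)"
    using eventually_rhs_nz[of a b]
  proof eventually_elim
    case (elim x)
    show ?case
    proof (intro allI impI)
      fix y assume y: "y ^ 2 = rhs a b x"
      then have y0: "y \<noteq> 0" using elim by auto
      define l where "l = (3 * x ^ 2 + a) / (2 * y)"
      have "ec_add (short a b) (Affine x y) (Affine x y) = Affine (l ^ 2 - x - x) (- (y + l * (l ^ 2 - x - x - x)))"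
        using y0 by (simp add: Let_def l_def)
      also have l2: "l ^ 2 - x - x = dbl_x x"
        unfolding dbl_x_def y[symmetric] l_def by (simp add: power_divide power_mult_distrib)
      also have "- (y + l * (dbl_x x - x)) = y * dbl_y x"
      proof -
        define w where "w = (3 * x ^ 2 + a) / (2 * rhs a b x)"
        have "l = y * w"
          unfolding w_def l_def y[symmetric] using y0 by (simp add: power2_eq_square)
        then show ?thesis
          unfolding dbl_y_def w_def[symmetric] by (simp add: algebra_simps)
      qed
      finally show "ec_add (short a b) (Affine x y) (Affine x y) = Affine (dbl_x x) (y * dbl_y x)" .
    qed
  qed
  then show ?thesis unfolding acts_lim_def acts_def using ratR has_lim_ratfun[OF limS] limR limS by simp
qed

lemma acts_lim_id: "acts_lim (\<lambda>P. P) (\<lambda>x. x) (\<lambda>x. 1) 1"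
proof -
  have "has_lim (\<lambda>x :: 'a. x / x) ((1 / 1) ^ 2)"
    by (rule has_lim_eq[OF has_lim_const[of 1]]) (use eventually_nz in \<open>auto elim: eventually_mono\<close>)
  moreover have "ratfun (\<lambda>x :: 'a. x)" by (rule ratfun_cong[OF ratfun_poly[of "[:0, 1 :: 'a:]"]]) simp
  moreover have "has_lim (\<lambda>x :: 'a. 1 :: 'a) ((1 / 1) ^ 3)" using has_lim_const[of 1] by simp
  ultimately show ?thesis unfolding acts_lim_def acts_def using has_lim_ratfun by auto
qed

lemma acts_lim_neg:
  assumes "acts_lim f R S c"
  shows "acts_lim (\<lambda>P. ec_neg (f P)) R (\<lambda>x. - S x) (- c)"
proof -
  have "has_lim (\<lambda>x. - S x) (- ((1 / c) ^ 3))" using assms has_lim_uminus unfolding acts_lim_def by blast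
  then have S: "has_lim (\<lambda>x. - S x) ((1 / - c) ^ 3)" by (simp add: power3_eq_cube)
  have "\<forall>\<^sub>F x in cofinite. \<forall>y. y ^ 2 = rhs a b x \<longrightarrow> ec_neg (f (Affine x y)) = Affine (R x) (y * - S x)"
    using assms[unfolded acts_lim_def, THEN conjunct1, unfolded acts_def, THEN conjunct2, THEN conjunct2]
    by eventually_elim simp
  then show ?thesis using assms S has_lim_ratfun[OF S] unfolding acts_lim_def acts_def by simp
qed

definition tpl_x :: "'a \<Rightarrow> 'a" where
  "tpl_x x = rhs a b x * ((1 - dbl_y x) / (x - dbl_x x)) ^ 2 - dbl_x x - x"

lemma acts_lim_triple: "\<exists>S. acts_lim (\<lambda>P. ec_add (short a b) (ec_add (short a b) P P) P) tpl_x S 3"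
proof -
  have "(2 :: 'a) ^ 2 \<noteq> 1 ^ 2" by simp
  note acts_lim_add[OF acts_lim_double acts_lim_id this, of "\<lambda>P. ec_add (short a b) (ec_add (short a b) P P) P"]
  then show ?thesis unfolding tpl_x_def[abs_def] by auto
qed

text \<open>
  The composition g f = 3 gives c c' = 3, where c and c' are the multipliers of f and g. The relation
  c' = 1 - c follows from g = 1 - f with the addition formula for multipliers, if c^2 \<noteq> 1. If
  c^2 = 1, then c'^2 = 9, and f = 1 - g can be used instead.
\<close>

theorem CM_multiplier:
  assumes ns: "4 * a ^ 3 + 27 * b ^ 2 \<noteq> 0"
    and f: "f \<in> ec_endomorphisms (short a b)" and g: "g \<in> ec_endomorphisms (short a b)"
    and gf: "\<And>P. on_curve (short a b) P \<Longrightarrow> g (f P) = ec_add (short a b) (ec_add (short a b) P P) P"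
    and g_eq: "\<And>P. on_curve (short a b) P \<Longrightarrow> g P = ec_add (short a b) P (ec_neg (f P))"
    and f_eq: "\<And>P. on_curve (short a b) P \<Longrightarrow> f P = ec_add (short a b) P (ec_neg (g P))"
  obtains R S c R' S' where "acts_lim f R S c" "acts_lim g R' S' (1 - c)" "c * (1 - c) = 3"
    "has_pole R" "\<forall>\<^sub>F x in cofinite. R' (R x) = tpl_x x"
proof -
  obtain S3 where tpl: "acts_lim (\<lambda>P. ec_add (short a b) (ec_add (short a b) P P) P) tpl_x S3 3"
    using acts_lim_triple by blast
  have tpl_acts: "\<forall>\<^sub>F x in cofinite. \<forall>y. y ^ 2 = rhs a b x \<longrightarrow> g (f (Affine x y)) = Affine (tpl_x x) (y * S3 x)"
    using tpl[unfolded acts_lim_def, THEN conjunct1, unfolded acts_def, THEN conjunct2, THEN conjunct2]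
    by eventually_elim (use gf in simp)
  have not_inf: False if "\<forall>\<^sub>F x in cofinite. \<forall>y. y ^ 2 = rhs a b x \<longrightarrow> g (f (Affine x y)) = Infinity"
  proof -
    have "\<forall>\<^sub>F x :: 'a in cofinite. False"
      using tpl_acts that
    proof eventually_elim
      case (elim x)
      obtain y where "y ^ 2 = rhs a b x" using ex_y by blast
      then show False using elim by auto
    qed
    then show False using not_eventually_False_cofinite by blast
  qed
  show ?thesis
  proof (rule endo_zero_or_acts[OF ns f])
    assume "\<forall>\<^sub>F x in cofinite. \<forall>y. y ^ 2 = rhs a b x \<longrightarrow> f (Affine x y) = Infinity"
    then have "\<forall>\<^sub>F x in cofinite. \<forall>y. y ^ 2 = rhs a b x \<longrightarrow> g (f (Affine x y)) = Infinity"
      by eventually_elim (simp add: endo_Infinity[OF ns g])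
    then show ?thesis using not_inf by blast
  next
    fix R S c e
    assume fR: "acts a b f R S" "\<forall>\<^sub>F x in cofinite. S x \<noteq> 0" "has_lim (\<lambda>x. R x / (x * S x)) c"
      "has_lim (\<lambda>x. 1 / (x * S x)) e"
    have curve: "\<forall>\<^sub>F x in cofinite. rhs a b x * S x ^ 2 = R x ^ 3 + a * R x + b"
      by (rule acts_on_curve[OF fR(1)]) (rule endo_on_curve[OF f])
    note f_lim = acts_pole[OF fR curve]
    \<comment> \<open>A property of g at generic points (x, y) holds at f(x, y) for generic x, since R has a pole.\<close>
    have at_R: "\<forall>\<^sub>F x in cofinite. \<forall>y. y ^ 2 = rhs a b x \<longrightarrow> P (R x) (f (Affine x y)) (y * S x)"
      if "\<forall>\<^sub>F x in cofinite. \<forall>y. y ^ 2 = rhs a b x \<longrightarrow> P x (Affine x y) y" for P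
      using eventually_at_pole[OF f_lim(2) that] curve fR(1)[unfolded acts_def, THEN conjunct2, THEN conjunct2]
    proof eventually_elim
      case (elim x)
      show ?case
      proof (intro allI impI)
        fix y assume y: "y ^ 2 = rhs a b x"
        then have "(y * S x) ^ 2 = rhs a b (R x)" using elim(2) by (simp add: power_mult_distrib)
        then show "P (R x) (f (Affine x y)) (y * S x)" using elim y by metis
      qed
    qed
    show ?thesis
    proof (rule endo_zero_or_acts[OF ns g])
      assume "\<forall>\<^sub>F x in cofinite. \<forall>y. y ^ 2 = rhs a b x \<longrightarrow> g (Affine x y) = Infinity"
      from at_R[of "\<lambda>x Q y. g Q = Infinity", OF this] show ?thesis using not_inf by blast
    next
      fix R' S' c' e'
      assume gR: "acts a b g R' S'" "\<forall>\<^sub>F x in cofinite. S' x \<noteq> 0" "has_lim (\<lambda>x. R' x / (x * S' x)) c'"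
        "has_lim (\<lambda>x. 1 / (x * S' x)) e'"
      have curve': "\<forall>\<^sub>F x in cofinite. rhs a b x * S' x ^ 2 = R' x ^ 3 + a * R' x + b"
        by (rule acts_on_curve[OF gR(1)]) (rule endo_on_curve[OF g])
      note g_lim = acts_pole[OF gR curve']
      have "\<forall>\<^sub>F x in cofinite. \<forall>y. y ^ 2 = rhs a b x \<longrightarrow> g (f (Affine x y)) = Affine (R' (R x)) (y * S x * S' (R x))"
        using at_R[of "\<lambda>x Q y. g Q = Affine (R' x) (y * S' x)"] gR(1) unfolding acts_def by blast
      then have "\<forall>\<^sub>F x in cofinite. \<forall>y. y ^ 2 = rhs a b x \<longrightarrow> g (f (Affine x y)) = Affine (R' (R x)) (y * (S x * S' (R x)))"
        by (simp only: mult.assoc)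
      from acts_eventually_eq[OF this tpl_acts]
      have comp: "\<forall>\<^sub>F x in cofinite. R' (R x) = tpl_x x \<and> S x * S' (R x) = S3 x" .
      have "has_lim (\<lambda>x. R' (R x) / (R x * S' (R x)) * (R x / (x * S x))) (c' * c)"
        by (intro has_lim_mult fR has_lim_compose[OF gR(3) f_lim(2)])
      moreover have "\<forall>\<^sub>F x in cofinite. R' (R x) / (R x * S' (R x)) * (R x / (x * S x)) = tpl_x x / (x * S3 x)"
        using comp eventually_at_pole[OF f_lim(2) eventually_nz]
      proof eventually_elim
        case (elim x)
        then have "tpl_x x = R' (R x)" "S3 x = S x * S' (R x)" by auto
        then show ?case using elim(2) by (simp add: ac_simps)
      qed
      ultimately have "has_lim (\<lambda>x. tpl_x x / (x * S3 x)) (c' * c)" by (rule has_lim_cong)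
      then have cc: "c' * c = 3" using acts_lim_k[OF tpl] has_lim_unique by blast
      then have c0: "c \<noteq> 0" "c' \<noteq> 0" by auto
      note fl = acts_limI[OF fR(1-3) f_lim(1) c0(1)] and gl = acts_limI[OF gR(1-3) g_lim(1) c0(2)]
      \<comment> \<open>Two formulas for the same map agree for generic x, so their multipliers agree.\<close>
      have trace: "d' = 1 - d" if F: "acts_lim F U V d" and G: "acts_lim G U' V' d'" and d: "d ^ 2 \<noteq> 1"
        and GF: "\<And>P. on_curve (short a b) P \<Longrightarrow> G P = ec_add (short a b) P (ec_neg (F P))" for F G U V U' V' d d'
      proof -
        have "1 ^ 2 \<noteq> (- d) ^ 2" using d by auto
        from acts_lim_add[OF acts_lim_id acts_lim_neg[OF F] this GF]
        obtain U3 V3 where G3: "acts_lim G U3 V3 (1 - d)" by auto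
        have "\<forall>\<^sub>F x in cofinite. U' x = U3 x \<and> V' x = V3 x"
          using acts_eventually_eq G G3 unfolding acts_lim_def acts_def by blast
        then have "\<forall>\<^sub>F x in cofinite. U' x / (x * V' x) = U3 x / (x * V3 x)" by eventually_elim simp
        then have "has_lim (\<lambda>x. U3 x / (x * V3 x)) d'" by (rule has_lim_cong[OF acts_lim_k[OF G]])
        then show ?thesis using has_lim_unique acts_lim_k[OF G3] by blast
      qed
      have c': "c' = 1 - c"
      proof (cases "c ^ 2 = 1")
        case False
        then show ?thesis using trace[OF fl gl False g_eq] by simp
      next
        case True
        have "(c' * c) ^ 2 = 9" using cc by simp
        then have "c' ^ 2 \<noteq> 1" using True by (simp add: power_mult_distrib)
        from trace[OF gl fl this f_eq] show ?thesis by simp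
      qed
      show ?thesis
      proof (rule that)
        show "acts_lim f R S c" by (rule fl)
        show "acts_lim g R' S' (1 - c)" using gl c' by simp
        show "c * (1 - c) = 3" using cc c' by (simp add: mult.commute)
        show "has_pole R" by (rule f_lim(2))
        show "\<forall>\<^sub>F x in cofinite. R' (R x) = tpl_x x" using comp by eventually_elim simp
      qed
    qed
  qed
qed

end

section \<open>The equation forced by complex multiplication\<close>

text \<open>
  Reduction modulo c^2 - c + 3.
\<close>

lemma multiplier_powers:
  fixes c :: "'a::comm_ring_1"
  assumes "c * (1 - c) = 3"
  shows "c ^ 2 = c - 3" "c ^ 4 = 6 - 5 * c" "c ^ 6 = 16 * c - 3"
proof -
  have "c ^ 2 = c - c * (1 - c)" by (simp add: right_diff_distrib power2_eq_square)
  then show c2: "c ^ 2 = c - 3" unfolding assms .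
  have "c ^ 4 = (c ^ 2) ^ 2" by (simp flip: power_mult)
  also have "\<dots> = (c - 3) ^ 2" unfolding c2 ..
  also have "\<dots> = c ^ 2 - 6 * c + 9" by (simp add: power2_eq_square algebra_simps)
  finally show c4: "c ^ 4 = 6 - 5 * c" unfolding c2 by simp
  have "c ^ 6 = c ^ 4 * c ^ 2" by (simp flip: power_add)
  also have "\<dots> = (6 - 5 * c) * (c - 3)" unfolding c4 c2 ..
  also have "\<dots> = 21 * c - 5 * c ^ 2 - 18" by (simp add: power2_eq_square algebra_simps)
  finally show "c ^ 6 = 16 * c - 3" unfolding c2 by simp
qed

lemma coprime_if_no_common_root:
  fixes p q :: "'a::{alg_closed_field, field_gcd} poly"
  assumes "\<And>z. \<not> (poly p z = 0 \<and> poly q z = 0)"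
  shows "coprime p q"
proof (rule ccontr)
  assume "\<not> coprime p q"
  then have "\<not> is_unit (gcd p q)" by (simp add: coprime_iff_gcd_eq_1)
  moreover have "gcd p q \<noteq> 0"
    using assms by auto
  ultimately have "degree (gcd p q) > 0" using is_unit_iff_degree by blast
  then obtain z where "poly (gcd p q) z = 0" using alg_closed_imp_poly_has_root by blast
  then have "poly p z = 0 \<and> poly q z = 0"
    by (meson gcd_dvd1 gcd_dvd2 dvd_trans poly_eq_0_iff_dvd)
  then show False using assms by blast
qed

lemma reduced_fraction:
  fixes R :: "'a::{alg_closed_field, field_char_0} \<Rightarrow> 'a"
  assumes "ratfun R"
  obtains N D where "lead_coeff D = 1" "\<And>z. \<not> (poly N z = 0 \<and> poly D z = 0)"
    "\<forall>\<^sub>F x in cofinite. R x = poly N x / poly D x"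
proof -
  define P where "P = (\<lambda>(N, D). D \<noteq> 0 \<and> (\<forall>\<^sub>F x in cofinite. R x = poly N x / poly D x))"
  obtain ND where "P ND" using assms unfolding ratfun_def P_def by auto
  then obtain M where M: "P M" "\<And>M'. P M' \<Longrightarrow> degree (snd M) \<le> degree (snd M')"
    using ex_has_least_nat[of P ND "\<lambda>M. degree (snd M)"] by blast
  obtain N D where ND: "M = (N, D)" by (cases M)
  have D: "D \<noteq> 0" "\<forall>\<^sub>F x in cofinite. R x = poly N x / poly D x" using M(1) unfolding ND P_def by auto
  have no_root: "\<not> (poly N z = 0 \<and> poly D z = 0)" for z
  proof
    assume "poly N z = 0 \<and> poly D z = 0"
    then obtain N' D' where N': "N = [:- z, 1:] * N'" and D': "D = [:- z, 1:] * D'"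
      unfolding poly_eq_0_iff_dvd dvd_def by blast
    have "D' \<noteq> 0" using D D' by auto
    have "\<forall>\<^sub>F x in cofinite. poly [:- z, 1:] x \<noteq> 0" by (rule eventually_poly_nz) simp
    with D(2) have "\<forall>\<^sub>F x in cofinite. R x = poly N' x / poly D' x"
      by eventually_elim (simp only: N' D' poly_mult nonzero_mult_divide_mult_cancel_left not_False_eq_True)
    then have "P (N', D')" unfolding P_def using \<open>D' \<noteq> 0\<close> by simp
    then have "degree D \<le> degree D'" using M(2) unfolding ND by fastforce
    then show False unfolding D' using \<open>D' \<noteq> 0\<close> by (simp add: degree_mult_eq del: mult_pCons_left)
  qed
  define l where "l = inverse (lead_coeff D)"
  have l: "l \<noteq> 0" using D by (simp add: l_def)
  show ?thesis
  proof (rule that[of "smult l D" "smult l N"])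
    show "lead_coeff (smult l D) = 1" using D by (simp add: l_def)
    show "\<not> (poly (smult l N) z = 0 \<and> poly (smult l D) z = 0)" for z using no_root l by simp
    show "\<forall>\<^sub>F x in cofinite. R x = poly (smult l N) x / poly (smult l D) x"
      using D(2) by eventually_elim (use l in simp)
  qed
qed

lemma homogenize_root:
  fixes p :: "'a::field poly"
  assumes "poly D z = 0"
  shows "poly (homogenize m p N D) z = coeff p m * poly N z ^ m"
proof -
  have "poly (homogenize m p N D) z = (\<Sum>i\<le>m. if i = m then coeff p m * poly N z ^ m else 0)"
    unfolding homogenize_def poly_sum by (rule sum.cong) (use assms in auto)
  then show ?thesis by simp
qed

lemma homogenize_Suc:
  assumes "degree p \<le> m"
  shows "homogenize (Suc m) p N D = D * homogenize m p N (D :: 'a::field poly)"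
proof -
  have "coeff p (Suc m) = 0" using assms by (simp add: coeff_eq_0)
  then have "homogenize (Suc m) p N D = (\<Sum>i\<le>m. smult (coeff p i) (N ^ i * D ^ (Suc m - i)))"
    unfolding homogenize_def by simp
  also have "\<dots> = D * homogenize m p N D"
    unfolding homogenize_def sum_distrib_left
    by (rule sum.cong) (auto simp: Suc_diff_le ac_simps)
  finally show ?thesis .
qed

text \<open>
  V divides W because an irreducible factor of V that is missing in W would occur in f with its
  square.
\<close>

lemma dvd_square_cancel:
  fixes f :: "'a::{alg_closed_field, field_gcd} poly"
  assumes eq: "f * W ^ 2 = V ^ 2 * F" and V: "V \<noteq> 0" and sqfree: "\<And>z. \<not> [:- z, 1:] ^ 2 dvd f"
  obtains T where "W = V * T" "f * T ^ 2 = F"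
proof -
  define g where "g = gcd V W"
  have g: "g \<noteq> 0" using V by (simp add: g_def)
  obtain V1 W1 where VW: "V = g * V1" "W = g * W1" "coprime V1 W1"
    using gcd_coprime_exists[of V W] g unfolding g_def by (metis mult.commute)
  have "g ^ 2 * (f * W1 ^ 2) = g ^ 2 * (V1 ^ 2 * F)"
    using eq unfolding VW by (simp add: power_mult_distrib ac_simps)
  then have eq1: "f * W1 ^ 2 = V1 ^ 2 * F" using g by simp
  then have "V1 ^ 2 dvd f * W1 ^ 2" by simp
  then have dvd: "V1 ^ 2 dvd f" using VW(3) by (simp add: coprime_dvd_mult_left_iff)
  have "is_unit V1"
  proof (rule ccontr)
    assume "\<not> is_unit V1"
    moreover have "V1 \<noteq> 0" using V VW by auto
    ultimately have "degree V1 > 0" by (simp add: is_unit_iff_degree)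
    then obtain z where "poly V1 z = 0" using alg_closed_imp_poly_has_root by blast
    then have "[:- z, 1:] ^ 2 dvd V1 ^ 2" by (simp add: poly_eq_0_iff_dvd dvd_power_same)
    then show False using dvd sqfree dvd_trans by blast
  qed
  then have "V dvd W" unfolding VW(1,2) by (intro mult_dvd_mono) auto
  then obtain T where T: "W = V * T" by blast
  have "V ^ 2 * (f * T ^ 2) = V ^ 2 * F" using eq unfolding T by (simp add: power_mult_distrib ac_simps)
  then show ?thesis using that T V by simp
qed

lemma curve_poly_squarefree:
  fixes a b :: "'a::field_char_0"
  assumes ns: "4 * a ^ 3 + 27 * b ^ 2 \<noteq> 0"
  shows "\<not> [:- z, 1:] ^ 2 dvd curve_poly a b"
proof
  assume "[:- z, 1:] ^ 2 dvd curve_poly a b"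
  then obtain q where q: "curve_poly a b = [:- z, 1:] ^ 2 * q" by blast
  have "poly (pderiv (curve_poly a b)) z = 0"
    unfolding q power2_eq_square mult.assoc pderiv_mult by (simp del: mult_pCons_left)
  then have a: "a = - 3 * z ^ 2"
    by (simp add: curve_poly_def pderiv_pCons algebra_simps power2_eq_square add_eq_0_iff)
  have "poly (curve_poly a b) z = 0" unfolding q by simp
  then have "b = 2 * z ^ 3" unfolding poly_curve_poly a by (simp add: power2_eq_square power3_eq_cube algebra_simps add_eq_0_iff)
  then show False using ns unfolding a by (simp add: power2_eq_square power3_eq_cube)
qed

context
  fixes a b :: "'a::{alg_closed_field, field_char_0, field_gcd}"
begin

text \<open>
  Here psi is the 3-division polynomial, and tnum/psi^2 is the x-coordinate of 3 P in lowest terms.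
  With p = 3 x^2 + a for the derivative of the cubic f, one has psi = 12 x f - p^2, and the
  coordinate simplifies to x - 8 f p/psi + 64 f^3/psi^2.
\<close>

definition tpoly :: "'a poly" where "tpoly = [:a, 0, 3:]"
definition psi :: "'a poly" where "psi = [:0, 12:] * curve_poly a b - tpoly ^ 2"
definition tnum :: "'a poly" where
  "tnum = [:0, 1:] * psi ^ 2 - 8 * (curve_poly a b * (tpoly * psi)) + 64 * curve_poly a b ^ 3"

lemma psi_explicit: "psi = [:- (a ^ 2), 12 * b, 6 * a, 0, 3:]"
  by (simp add: psi_def tpoly_def curve_poly_def power2_eq_square)

lemma psi_nz: "psi \<noteq> 0" by (simp add: psi_explicit)

lemma tpl_x_eq: "\<forall>\<^sub>F x in cofinite. tpl_x a b x = poly tnum x / poly (psi ^ 2) x"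
  using eventually_poly_nz[OF psi_nz] eventually_poly_nz[of "curve_poly a b", simplified poly_curve_poly, OF curve_poly_nz]
proof eventually_elim
  case (elim x)
  define f p s where "f = x ^ 3 + a * x + b" and "p = 3 * x ^ 2 + a" and "s = poly psi x"
  have s: "s = 12 * x * f - p ^ 2" unfolding s_def f_def p_def
    by (simp add: psi_def tpoly_def algebra_simps power2_eq_square power3_eq_cube)
  have nz: "f \<noteq> 0" "s \<noteq> 0" using elim by (auto simp: f_def s_def)
  have dx: "dbl_x a b x = x - s / (4 * f)"
    unfolding dbl_x_def f_def[symmetric] p_def[symmetric] s using nz by (simp add: field_simps)
  have dy: "1 - dbl_y a b x = (16 * f ^ 2 - p * s) / (8 * f ^ 2)"
    unfolding dbl_y_def f_def[symmetric] p_def[symmetric] dx using nz by (simp add: field_simps power2_eq_square)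
  have "(1 - dbl_y a b x) / (x - dbl_x a b x) = (16 * f ^ 2 - p * s) / (2 * f * s)"
    unfolding dy dx using nz by (simp add: field_simps power2_eq_square)
  then have "tpl_x a b x = f * ((16 * f ^ 2 - p * s) / (2 * f * s)) ^ 2 - (x - s / (4 * f)) - x"
    unfolding tpl_x_def f_def[symmetric] dx by simp
  also have "\<dots> = ((16 * f ^ 2 - p * s) ^ 2 + s ^ 3 - 8 * x * f * s ^ 2) / (4 * f * s ^ 2)"
    using nz by (simp add: field_simps power2_eq_square power3_eq_cube)
  also have "(16 * f ^ 2 - p * s) ^ 2 = 256 * f ^ 4 - 32 * f ^ 2 * p * s + p ^ 2 * s ^ 2"
    by (simp add: power2_eq_square algebra_simps numeral_eq_Suc)
  also have "p ^ 2 = 12 * x * f - s" unfolding s by simp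
  also have "256 * f ^ 4 - 32 * f ^ 2 * p * s + (12 * x * f - s) * s ^ 2 + s ^ 3 - 8 * x * f * s ^ 2 =
      (4 * f) * (x * s ^ 2 - 8 * (f * (p * s)) + 64 * f ^ 3)"
    by (simp add: algebra_simps numeral_eq_Suc)
  also have "\<dots> / (4 * f * s ^ 2) = (x * s ^ 2 - 8 * (f * (p * s)) + 64 * f ^ 3) / s ^ 2"
    using nz by simp
  also have "x * s ^ 2 - 8 * (f * (p * s)) + 64 * f ^ 3 = poly tnum x"
    unfolding tnum_def s_def f_def p_def by (simp add: tpoly_def power2_eq_square algebra_simps)
  finally show ?case by (simp add: s_def)
qed

lemma tnum_top: "degree tnum = 9"
proof -
  have f: "degree (curve_poly a b) \<le> 3" "coeff (curve_poly a b) 3 = 1" by (simp_all add: curve_poly_def numeral_eq_Suc)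
  have p: "degree tpoly \<le> 2" "coeff tpoly 2 = 3" by (simp_all add: tpoly_def numeral_eq_Suc)
  have s: "degree psi \<le> 4" "coeff psi 4 = 3" by (simp_all add: psi_explicit numeral_eq_Suc)
  have prod: "degree (u * v) \<le> m + n \<and> coeff (u * v) (m + n) = coeff u m * coeff v n"
    if "degree u \<le> m" "degree v \<le> n" for u v :: "'a poly" and m n
    using coeff_mult_top[OF that] degree_mult_le[of u v] that by simp
  have ss: "degree (psi ^ 2) \<le> 8" "coeff (psi ^ 2) 8 = 9"
    using prod[OF s(1) s(1)] s(2) by (simp_all add: power2_eq_square)
  have xss: "degree ([:0, 1:] * psi ^ 2) \<le> 9" "coeff ([:0, 1:] * psi ^ 2) 9 = 9"
    using prod[of "[:0, 1:]" 1 "psi ^ 2" 8] ss by (simp_all add: numeral_eq_Suc)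
  have ps: "degree (tpoly * psi) \<le> 6" "coeff (tpoly * psi) 6 = 9"
    using prod[OF p(1) s(1)] p s by simp_all
  have fps: "degree (curve_poly a b * (tpoly * psi)) \<le> 9" "coeff (curve_poly a b * (tpoly * psi)) 9 = 9"
    using prod[OF f(1) ps(1)] f ps by simp_all
  have ff: "degree (curve_poly a b * curve_poly a b) \<le> 6" "coeff (curve_poly a b * curve_poly a b) 6 = 1"
    using prod[OF f(1) f(1)] f by simp_all
  have fff: "degree (curve_poly a b ^ 3) \<le> 9" "coeff (curve_poly a b ^ 3) 9 = 1"
    using prod[OF f(1) ff(1)] f ff by (simp_all add: power3_eq_cube mult.assoc)
  have n8: "(8 :: 'a poly) = [:8:]" "(64 :: 'a poly) = [:64:]" by (simp_all add: numeral_poly)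
  have "coeff tnum 9 = 1" unfolding tnum_def n8 using xss fps fff by simp
  moreover have "degree tnum \<le> 9" unfolding tnum_def n8
    by (intro degree_add_le degree_diff_le xss; rule order_trans[OF degree_mult_le]) (use fps fff in auto)
  ultimately show ?thesis by (metis le_antisym le_degree zero_neq_one)
qed

text \<open>
  A common root would be a root of the cubic and of its derivative.
\<close>

lemma tnum_psi_no_common_root:
  assumes ns: "4 * a ^ 3 + 27 * b ^ 2 \<noteq> 0"
  shows "\<not> (poly psi z = 0 \<and> poly tnum z = 0)"
proof
  assume "poly psi z = 0 \<and> poly tnum z = 0"
  then have *: "poly psi z = 0" "poly tnum z = 0" by auto
  then have f: "z ^ 3 + a * z + b = 0" by (simp add: tnum_def)
  have "poly psi z = 12 * z * (z ^ 3 + a * z + b) - (3 * z ^ 2 + a) ^ 2"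
    by (simp add: psi_def tpoly_def power2_eq_square power3_eq_cube algebra_simps)
  then have "(3 * z ^ 2 + a) ^ 2 = 0" unfolding f *(1) by simp
  then have a: "a = - 3 * z ^ 2" by (simp add: add_eq_0_iff2)
  then have "b = 2 * z ^ 3" using f by (simp add: power2_eq_square power3_eq_cube algebra_simps add_eq_0_iff2)
  then show False using ns unfolding a by (simp add: power2_eq_square power3_eq_cube)
qed

text \<open>
  R(x)/x has the value 1/c^2 at infinity, so R has a simple pole there.
\<close>

lemma acts_lim_fraction:
  assumes "acts_lim a b f R S c"
  obtains N D where "lead_coeff D = 1" "\<And>z. \<not> (poly N z = 0 \<and> poly D z = 0)"
    "\<forall>\<^sub>F x in cofinite. R x = poly N x / poly D x" "degree N = Suc (degree D)" "lead_coeff N = (1 / c) ^ 2"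
proof -
  have rat: "ratfun R" and c: "c \<noteq> 0" and lim: "has_lim (\<lambda>x. R x / x) ((1 / c) ^ 2)"
    using assms unfolding acts_lim_def acts_def by auto
  obtain N D where ND: "lead_coeff D = 1" "\<And>z. \<not> (poly N z = 0 \<and> poly D z = 0)"
    "\<forall>\<^sub>F x in cofinite. R x = poly N x / poly D x"
    using reduced_fraction[OF rat] by blast
  obtain N' D' where 1: "D' \<noteq> 0" "degree N' \<le> degree D'" "coeff N' (degree D') = (1 / c) ^ 2 * lead_coeff D'"
    "\<forall>\<^sub>F x in cofinite. R x / x = poly N' x / poly D' x" using lim unfolding has_lim_def by blast
  have D0: "D \<noteq> 0" using ND by auto
  have "\<forall>\<^sub>F x in cofinite. poly (N * D') x = poly ([:0, 1:] * D * N') x"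
    using ND(3) 1(4) eventually_poly_nz[OF 1(1)] eventually_poly_nz[OF D0] eventually_nz
  proof eventually_elim
    case (elim x)
    have "R x = x * (poly N' x / poly D' x)" using elim by (simp flip: elim(2))
    moreover have "poly N x = R x * poly D x" using elim by simp
    ultimately have "poly (N * D') x = (x * (poly N' x / poly D' x) * poly D x) * poly D' x"
      by (simp only: poly_mult)
    also have "\<dots> = x * poly D x * poly N' x" using elim(3) by simp
    finally show ?case by simp
  qed
  then have eq: "N * D' = ([:0, 1:] * D) * N'" by (rule poly_eqI_cofinite)
  have "coeff N' (degree D') \<noteq> 0" using 1 c by simp
  then have degN': "degree N' = degree D'" using 1(2) le_degree by (metis antisym)
  then have lead': "lead_coeff N' = (1 / c) ^ 2 * lead_coeff D'" using 1(3) by simp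
  have N': "N' \<noteq> 0" using \<open>coeff N' (degree D') \<noteq> 0\<close> by auto
  have N0: "N \<noteq> 0" using eq D0 N' by auto
  have "degree (N * D') = degree (([:0, 1:] * D) * N')" using eq by simp
  then have "degree N = Suc (degree D)"
    using N0 D0 N' 1(1) degN' by (simp add: degree_mult_eq del: mult_pCons_left)
  moreover have "lead_coeff (N * D') = lead_coeff (([:0, 1:] * D) * N')" using eq by simp
  then have "lead_coeff N * lead_coeff D' = lead_coeff [:0, 1:] * lead_coeff D * lead_coeff N'"
    by (simp only: lead_coeff_mult)
  then have "lead_coeff N = (1 / c) ^ 2" unfolding lead' using 1(1) ND(1) by simp
  ultimately show ?thesis using that ND by blast
qed

text \<open>
  The cubic on the right side of the equation of the curve, homogenised: D^3 (r^3 + a r + b) for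
  r = N/D.
\<close>

definition cubic_form :: "'a poly \<Rightarrow> 'a poly \<Rightarrow> 'a poly" where
  "cubic_form N D = N ^ 3 + smult a (N * D ^ 2) + smult b (D ^ 3)"

text \<open>
  The point (R, y S) lies on the curve, so the cubic evaluated at R = N/D is the cubic in x times the
  square of a rational function. As D is a square and the cubic is squarefree, the square is that of
  a polynomial after clearing D^3.
\<close>

lemma acts_lim_square:
  assumes ns: "4 * a ^ 3 + 27 * b ^ 2 \<noteq> 0"
    and f: "acts_lim a b f R S c" and on: "\<And>P. on_curve (short a b) P \<Longrightarrow> on_curve (short a b) (f P)"
    and D0: "D \<noteq> 0" and R: "\<forall>\<^sub>F x in cofinite. R x = poly N x / poly D x" and D: "D = d ^ 2"
  obtains T where "curve_poly a b * T ^ 2 = cubic_form N D"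
proof -
  have "ratfun S" using f unfolding acts_lim_def acts_def by blast
  then obtain U V where UV: "V \<noteq> 0" "\<forall>\<^sub>F x in cofinite. S x = poly U x / poly V x" unfolding ratfun_def by blast
  have curve: "\<forall>\<^sub>F x in cofinite. (x ^ 3 + a * x + b) * S x ^ 2 = R x ^ 3 + a * R x + b"
  proof -
    have "acts a b f R S" using f unfolding acts_lim_def by blast
    then show ?thesis by (rule acts_on_curve) (rule on)
  qed
  have "\<forall>\<^sub>F x in cofinite. poly (curve_poly a b * (U * d ^ 3) ^ 2) x = poly (V ^ 2 * cubic_form N D) x"
    using curve UV(2) R eventually_poly_nz[OF UV(1)] eventually_poly_nz[OF D0]
  proof eventually_elim
    case (elim x)
    define n u v e where "n = poly N x" "u = poly U x" "v = poly V x" "e = poly D x"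
    note defs = this
    have nz: "v \<noteq> 0" "e \<noteq> 0" using elim by (auto simp: defs)
    have de: "(poly d x ^ 3) ^ 2 = e ^ 3" unfolding defs D by (simp add: power2_eq_square power3_eq_cube)
    have "(x ^ 3 + a * x + b) * (u / v) ^ 2 = (n / e) ^ 3 + a * (n / e) + b"
      using elim by (simp add: defs)
    then have "(x ^ 3 + a * x + b) * u ^ 2 * e ^ 3 = v ^ 2 * (n ^ 3 + a * (n * e ^ 2) + b * e ^ 3)"
    proof -
      assume 1: "(x ^ 3 + a * x + b) * (u / v) ^ 2 = (n / e) ^ 3 + a * (n / e) + b"
      have "(x ^ 3 + a * x + b) * u ^ 2 * e ^ 3 = ((x ^ 3 + a * x + b) * (u / v) ^ 2) * (v ^ 2 * e ^ 3)"
        using nz by (simp add: power_divide)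
      also have "\<dots> = ((n / e) ^ 3 + a * (n / e) + b) * (v ^ 2 * e ^ 3)" unfolding 1 ..
      also have "\<dots> = v ^ 2 * (n ^ 3 + a * (n * e ^ 2) + b * e ^ 3)"
        using nz by (simp add: power_divide distrib_left distrib_right power2_eq_square power3_eq_cube)
      finally show ?thesis .
    qed
    then show ?case using de
      by (simp add: defs cubic_form_def power_mult_distrib mult.assoc)
  qed
  then have "curve_poly a b * (U * d ^ 3) ^ 2 = V ^ 2 * cubic_form N D" by (rule poly_eqI_cofinite)
  then show ?thesis using dvd_square_cancel[OF _ UV(1) curve_poly_squarefree[OF ns]] that by metis
qed

text \<open>
  Maps of degree 1 are automorphisms. If R has degree 1, then R = x/c^2, and the curve has to satisfy
  a (c^4 - 1) = 0 and b (c^6 - 1) = 0. With c (1 - c) = 3, neither c^4 nor c^6 is 1, so a and b would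
  both be 0.
\<close>

lemma degree_not_1:
  assumes ns: "4 * a ^ 3 + 27 * b ^ 2 \<noteq> 0"
    and f: "acts_lim a b f R S c" and on: "\<And>P. on_curve (short a b) P \<Longrightarrow> on_curve (short a b) (f P)"
    and c: "c * (1 - c) = 3"
    and D: "lead_coeff D = 1" and R: "\<forall>\<^sub>F x in cofinite. R x = poly N x / poly D x"
    and N: "degree N = Suc (degree D)" "lead_coeff N = (1 / c) ^ 2"
  shows "degree D \<noteq> 0"
proof
  assume "degree D = 0"
  then have D1: "D = 1" using D by (metis degree_eq_zeroE lead_coeff_pCons(2) one_pCons)
  then have degN: "degree N = 1" using N by simp
  define \<alpha> \<beta> where "\<alpha> = (1 / c) ^ 2" "\<beta> = coeff N 0"
  have c0: "c \<noteq> 0" using c by auto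
  have \<alpha>: "\<alpha> \<noteq> 0" using c0 by (simp add: \<alpha>_\<beta>_def)
  have Neq: "N = [:\<beta>, \<alpha>:]"
    using degN N(2) by (intro poly_eqI) (auto simp: \<alpha>_\<beta>_def coeff_pCons coeff_eq_0 split: nat.splits)
  obtain T where T: "curve_poly a b * T ^ 2 = cubic_form N D"
    using acts_lim_square[OF ns f on _ R, of 1] D1 by auto
  have cf: "cubic_form N D = [:\<beta>^3 + a * \<beta> + b, 3 * \<alpha> * \<beta>^2 + a * \<alpha>, 3 * \<alpha>^2 * \<beta>, \<alpha>^3:]"
    unfolding cubic_form_def D1 Neq by (simp add: power2_eq_square power3_eq_cube algebra_simps)
  then have "degree (curve_poly a b * T ^ 2) = 3" unfolding T cf using \<alpha> by simp
  moreover have "T \<noteq> 0" using T cf \<alpha> by auto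
  ultimately have "degree T = 0" by (simp add: degree_mult_eq degree_power_eq)
  then obtain t where t: "T = [:t:]" by (rule degree_eq_zeroE)
  have "curve_poly a b * T ^ 2 = [:b * t^2, a * t^2, 0, t^2:]"
    unfolding t curve_poly_def by (simp add: power2_eq_square algebra_simps)
  then have "[:b * t^2, a * t^2, 0, t^2:] = [:\<beta>^3 + a * \<beta> + b, 3 * \<alpha> * \<beta>^2 + a * \<alpha>, 3 * \<alpha>^2 * \<beta>, \<alpha>^3:]"
    unfolding T cf by (rule sym)
  then have e: "b * t^2 = \<beta>^3 + a * \<beta> + b" "a * t^2 = 3 * \<alpha> * \<beta>^2 + a * \<alpha>" "0 = 3 * \<alpha>^2 * \<beta>" "t^2 = \<alpha>^3"
    unfolding pCons_eq_iff by blast+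
  have \<beta>: "\<beta> = 0" using e(3) \<alpha> by simp
  note c4 = multiplier_powers(2)[OF c] and c6 = multiplier_powers(3)[OF c]
  have "a * (\<alpha> ^ 3 - \<alpha>) = 0" "b * (\<alpha> ^ 3 - 1) = 0" using e \<beta> by (simp_all add: algebra_simps)
  moreover have "\<alpha> ^ 3 - \<alpha> \<noteq> 0"
  proof
    assume "\<alpha> ^ 3 - \<alpha> = 0"
    then have "\<alpha> * (\<alpha> ^ 2 - 1) = 0" by (simp add: algebra_simps power2_eq_square power3_eq_cube)
    then have "\<alpha> ^ 2 = 1" using \<alpha> by simp
    then have "1 / c ^ 4 = 1" unfolding \<alpha>_\<beta>_def by (simp add: power_divide flip: power_mult)
    then have "c ^ 4 = 1" by simp
    then have "c = 1" using c4 by simp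
    then show False using c by simp
  qed
  moreover have "\<alpha> ^ 3 - 1 \<noteq> 0"
  proof
    assume "\<alpha> ^ 3 - 1 = 0"
    then have "\<alpha> ^ 3 = 1" by simp
    then have "1 / c ^ 6 = 1" unfolding \<alpha>_\<beta>_def by (simp add: power_divide flip: power_mult)
    then have "c ^ 6 = 1" by simp
    then have "c = 1 / 4" using c6 by (simp add: field_simps)
    then have "c * (1 - c) = 1 / 4 * (1 - 1 / 4)" by (simp only:)
    then show False using c by simp
  qed
  ultimately show False using ns by simp
qed

text \<open>
  Let N1/D1 be the composition of N'/D' with N/D, both parts homogenised with the degree of N'. This
  fraction is in lowest terms and equal to tnum/psi^2, so N1 has the degree of tnum. As D' has a
  smaller degree, D1 is D times a polynomial that is not 0 at the zeros of D. So a zero of D has the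
  same order in D as in psi^2, where its order is even.
\<close>

lemma composition_degrees:
  assumes ns: "4 * a ^ 3 + 27 * b ^ 2 \<noteq> 0"
    and ND: "lead_coeff D = 1" "\<And>z. \<not> (poly N z = 0 \<and> poly D z = 0)"
      "\<forall>\<^sub>F x in cofinite. R x = poly N x / poly D x" "degree N = Suc (degree D)"
    and ND': "lead_coeff D' = 1" "\<And>z. \<not> (poly N' z = 0 \<and> poly D' z = 0)"
      "\<forall>\<^sub>F x in cofinite. R' x = poly N' x / poly D' x" "degree N' = Suc (degree D')"
    and pole: "has_pole R" and comp: "\<forall>\<^sub>F x in cofinite. R' (R x) = tpl_x a b x"
  shows "degree N * degree N' = 9"
    and "poly D z = 0 \<Longrightarrow> [:- z, 1:] ^ 2 dvd D"
proof -
  define m where "m = degree N'"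
  have deg: "degree D' \<le> m" "degree N' \<le> m" using ND'(4) by (auto simp: m_def)
  have D0: "D \<noteq> 0" "D' \<noteq> 0" "N \<noteq> 0" "N' \<noteq> 0" using ND ND' by auto
  let ?N = "homogenize m N' N D" and ?D = "homogenize m D' N D"
  have hN: "poly ?N x = poly D x ^ m * poly N' (poly N x / poly D x)" if "poly D x \<noteq> 0" for x
    using poly_homogenize[OF deg(2) that] .
  have hD: "poly ?D x = poly D x ^ m * poly D' (poly N x / poly D x)" if "poly D x \<noteq> 0" for x
    using poly_homogenize[OF deg(1) that] .
  have root_N: "poly ?N z \<noteq> 0" if "poly D z = 0" for z
    using homogenize_root[OF that, of m N' N] ND(2)[of z] that D0 by (simp add: m_def)
  have no_common: "\<not> (poly ?N z = 0 \<and> poly ?D z = 0)" for z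
  proof (cases "poly D z = 0")
    case True
    then show ?thesis using root_N by blast
  next
    case False
    then show ?thesis using hN hD ND'(2) by simp
  qed
  have "\<forall>\<^sub>F x in cofinite. poly D' (R x) \<noteq> 0"
    by (rule eventually_at_pole[OF pole eventually_poly_nz[OF D0(2)]])
  then have "\<forall>\<^sub>F x in cofinite. poly (?N * psi ^ 2) x = poly (tnum * ?D) x"
    using eventually_at_pole[OF pole ND'(3)] ND(3) comp tpl_x_eq eventually_poly_nz[OF D0(1)] eventually_poly_nz[OF psi_nz]
  proof eventually_elim
    case (elim x)
    define w where "w = poly N x / poly D x"
    have w: "R x = w" using elim by (simp add: w_def)
    have "poly N' w / poly D' w = poly tnum x / poly (psi ^ 2) x" using elim(2,4,5) unfolding w by simp
    then have "poly N' w * poly (psi ^ 2) x = poly tnum x * poly D' w"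
      using elim(1,7) unfolding w by (simp add: frac_eq_eq)
    then show ?case using hN[OF elim(6)] hD[OF elim(6)] by (simp add: w_def)
  qed
  then have eq: "?N * psi ^ 2 = tnum * ?D" by (rule poly_eqI_cofinite)
  have cop: "coprime ?N ?D" "coprime tnum (psi ^ 2)"
    using coprime_if_no_common_root[OF no_common] coprime_if_no_common_root[of tnum "psi ^ 2"] tnum_psi_no_common_root[OF ns]
    by (auto simp: poly_power)
  have "?N dvd tnum * ?D" using eq by (metis dvd_triv_left)
  then have 1: "?N dvd tnum" using cop(1) by (simp add: coprime_dvd_mult_left_iff)
  have "tnum dvd ?N * psi ^ 2" using eq by simp
  then have 2: "tnum dvd ?N" using cop(2) by (simp add: coprime_dvd_mult_left_iff)
  have nz: "tnum \<noteq> 0" using tnum_top by auto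
  then have "?N \<noteq> 0" using 1 by auto
  then have "degree ?N = 9" using 1 2 nz dvd_imp_degree_le tnum_top by (metis le_antisym)
  moreover have "degree ?N = m * degree N"
  proof -
    have lt: "degree D < degree N" using ND by simp
    have "coeff ?N (m * degree N) \<noteq> 0"
      unfolding homogenize_top(2)[OF lt] using D0 by (simp add: m_def)
    then show ?thesis using homogenize_top(1)[OF lt, of m N'] le_degree by (metis le_antisym)
  qed
  ultimately show "degree N * degree N' = 9" by (simp add: m_def mult.commute)
  show "[:- z, 1:] ^ 2 dvd D" if z: "poly D z = 0"
  proof -
    define G where "G = homogenize (degree D') D' N D"
    have "m = Suc (degree D')" using ND'(4) by (simp add: m_def)
    then have hom: "?D = D * G" unfolding G_def using homogenize_Suc[of D' "degree D'" N D] by simp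
    have "poly G z \<noteq> 0"
      unfolding G_def homogenize_root[OF z] using ND(2)[of z] z D0 by simp
    moreover have "poly ?D z = 0" unfolding hom using z by simp
    then have "poly psi z = 0" using eq root_N[OF z] by (metis mult_eq_0_iff poly_mult poly_power power_eq_0_iff mult_zero_right)
    moreover from this have "poly tnum z \<noteq> 0" using tnum_psi_no_common_root[OF ns] by blast
    ultimately have tG: "poly (tnum * G) z \<noteq> 0" by simp
    have "coprime ([:- z, 1:] ^ 2) (tnum * G)"
      by (rule coprime_if_no_common_root) (use tG in \<open>auto simp: poly_power\<close>)
    moreover have "[:- z, 1:] ^ 2 dvd psi ^ 2" using \<open>poly psi z = 0\<close>
      by (intro dvd_power_same) (simp add: poly_eq_0_iff_dvd)
    then have "[:- z, 1:] ^ 2 dvd ?N * psi ^ 2" by simp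
    then have "[:- z, 1:] ^ 2 dvd (tnum * G) * D" unfolding eq hom by (simp only: ac_simps)
    ultimately show ?thesis by (simp add: coprime_dvd_mult_right_iff)
  qed
qed

text \<open>
  The only factorisation of 9 without a factor 1 is 3 * 3. The denominator of R then has degree 2, and
  it has no simple root.
\<close>

lemma degree_3:
  assumes ns: "4 * a ^ 3 + 27 * b ^ 2 \<noteq> 0"
    and f: "acts_lim a b f R S c" and onf: "\<And>P. on_curve (short a b) P \<Longrightarrow> on_curve (short a b) (f P)"
    and g: "acts_lim a b g R' S' (1 - c)" and ong: "\<And>P. on_curve (short a b) P \<Longrightarrow> on_curve (short a b) (g P)"
    and c: "c * (1 - c) = 3" and pole: "has_pole R" and comp: "\<forall>\<^sub>F x in cofinite. R' (R x) = tpl_x a b x"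
  obtains N z where "degree N = 3" "lead_coeff N = (1 / c) ^ 2" "poly N z \<noteq> 0"
    "\<forall>\<^sub>F x in cofinite. R x = poly N x / poly ([:- z, 1:] ^ 2) x"
proof -
  obtain N D where ND: "lead_coeff D = 1" "\<And>z. \<not> (poly N z = 0 \<and> poly D z = 0)"
    "\<forall>\<^sub>F x in cofinite. R x = poly N x / poly D x" "degree N = Suc (degree D)" "lead_coeff N = (1 / c) ^ 2"
    using acts_lim_fraction[OF f] by blast
  obtain N' D' where ND': "lead_coeff D' = 1" "\<And>z. \<not> (poly N' z = 0 \<and> poly D' z = 0)"
    "\<forall>\<^sub>F x in cofinite. R' x = poly N' x / poly D' x" "degree N' = Suc (degree D')" "lead_coeff N' = (1 / (1 - c)) ^ 2"
    using acts_lim_fraction[OF g] by blast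
  note comp_deg = composition_degrees[OF ns ND(1-4) ND'(1-4) pole comp]
  have "degree D \<noteq> 0" by (rule degree_not_1[OF ns f onf c ND(1,3-5)])
  moreover have "degree D' \<noteq> 0"
  proof (rule degree_not_1[OF ns g ong _ ND'(1,3-5)])
    have "1 - (1 - c) = c" by simp
    then show "(1 - c) * (1 - (1 - c)) = 3" using c by (simp only: mult.commute)
  qed
  ultimately have "degree N \<ge> 2" "degree N' \<ge> 2" using ND(4) ND'(4) by auto
  have degN: "degree N = 3"
  proof -
    have "degree N \<le> 4"
    proof (rule ccontr)
      assume "\<not> degree N \<le> 4"
      then have "5 * 2 \<le> degree N * degree N'" using \<open>degree N' \<ge> 2\<close> by (intro mult_le_mono) auto
      then show False using comp_deg(1) by simp
    qed
    then have "degree N = 2 \<or> degree N = 3 \<or> degree N = 4" using \<open>degree N \<ge> 2\<close> by auto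
    then show ?thesis using comp_deg(1) by (elim disjE) (simp_all, presburger+)
  qed
  then have degD: "degree D = 2" using ND(4) by simp
  then obtain z where z: "poly D z = 0" using alg_closed_imp_poly_has_root by (metis zero_less_numeral)
  then obtain K where K: "D = [:- z, 1:] ^ 2 * K" using comp_deg(2) by blast
  have D0: "D \<noteq> 0" using ND(1) by auto
  then have "K \<noteq> 0" using K by auto
  have "degree D = 2 + degree K" 
  proof -
    have "[:- z, 1:] ^ 2 \<noteq> (0 :: 'a poly)" by simp
    from degree_mult_eq[OF this \<open>K \<noteq> 0\<close>] show ?thesis unfolding K degree_linear_power .
  qed
  then obtain k where k: "K = [:k:]" using degD by (metis add_cancel_left_right degree_eq_zeroE)
  have "lead_coeff D = k" unfolding K lead_coeff_mult lead_coeff_power k by simp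
  then have "k = 1" using ND(1) by simp
  then have "D = [:- z, 1:] ^ 2" unfolding K k by simp
  then show ?thesis using that[of N z] degN ND z by auto
qed

text \<open>
  The pullback of the invariant differential dx/y under (R, y S) is dR/(y S), which has to be c dx/y:
  R' = c S. Instead of the general theory, one counts degrees. Let F = f T^2 be the homogenised
  cubic at N and D = l^2 with l = x - z. Then T divides F and its derivative. Since the
  cubic of the curve has simple roots, T divides the numerator V of R'. Both have degree 3, so
  V = k T with a constant k, and the leading coefficients give k^2 = c^2.
\<close>

lemma isogeny_equation:
  assumes ns: "4 * a ^ 3 + 27 * b ^ 2 \<noteq> 0"
    and f: "acts_lim a b f R S c" and on: "\<And>P. on_curve (short a b) P \<Longrightarrow> on_curve (short a b) (f P)"
    and N: "degree N = 3" "lead_coeff N = (1 / c) ^ 2" "poly N z \<noteq> 0"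
    and R: "\<forall>\<^sub>F x in cofinite. R x = poly N x / poly ([:- z, 1:] ^ 2) x"
  shows "curve_poly a b * (pderiv N * [:- z, 1:] - 2 * N) ^ 2 = smult (c ^ 2) (cubic_form N ([:- z, 1:] ^ 2))"
proof -
  define l where "l = [:- z, 1:]"
  define D where "D = l ^ 2"
  define \<alpha> where "\<alpha> = (1 / c) ^ 2"
  have c0: "c \<noteq> 0" using f unfolding acts_lim_def by blast
  have \<alpha>: "\<alpha> \<noteq> 0" using c0 by (simp add: \<alpha>_def)
  have D0: "D \<noteq> 0" by (simp add: D_def l_def)
  have degl: "degree l = 1" "lead_coeff l = 1" by (simp_all add: l_def)
  have degD: "degree D = 2" unfolding D_def using degl by (metis degree_linear_power l_def)
  have dl: "pderiv l = 1" by (simp add: l_def pderiv_pCons)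
  have dD: "pderiv D = 2 * l" unfolding D_def power2_eq_square pderiv_mult dl by simp
  obtain T where T: "curve_poly a b * T ^ 2 = cubic_form N D"
    using acts_lim_square[OF ns f on D0 R[folded l_def D_def] D_def] by blast
  define F where "F = cubic_form N D"
  define V where "V = pderiv N * l - 2 * N"
  define G1 G2 where "G1 = 3 * N ^ 2 + smult a (D ^ 2)" and "G2 = smult (2 * a) (N * D) + smult (3 * b) (D ^ 2)"
  have smult_const: "smult k p = [:k:] * p" for k and p :: "'a poly" by simp
  have N0: "N \<noteq> 0" using N(1) by auto
  have degN3: "degree (N ^ 3) = 9" using N0 N(1) by (simp add: degree_power_eq)
  have leadN3: "lead_coeff (N ^ 3) = \<alpha> ^ 3" by (simp only: lead_coeff_power N(2) \<alpha>_def)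
  have rest: "degree (smult a (N * D ^ 2) + smult b (D ^ 3)) < 9"
  proof -
    have "degree (N * D ^ 2) \<le> 7" using degree_mult_le[of N "D ^ 2"] degree_power_le[of D 2] N degD by simp
    moreover have "degree (D ^ 3) \<le> 6" using degree_power_le[of D 3] degD by simp
    ultimately have "degree (smult a (N * D ^ 2) + smult b (D ^ 3)) \<le> 7"
      by (intro degree_add_le) (auto intro: order_trans[OF degree_smult_le])
    then show ?thesis by simp
  qed
  have Fsum: "F = N ^ 3 + (smult a (N * D ^ 2) + smult b (D ^ 3))" by (simp add: F_def cubic_form_def)
  have degF: "degree F = 9" unfolding Fsum using rest degN3 by (simp add: degree_add_eq_left)
  have leadF: "lead_coeff F = \<alpha> ^ 3" unfolding degF 
    unfolding Fsum coeff_add coeff_eq_0[OF rest, unfolded coeff_add] using leadN3[unfolded degN3] by simp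
  have T0: "T \<noteq> 0" using T degF unfolding F_def by auto
  have degT: "degree T = 3"
  proof -
    have "degree (curve_poly a b * T ^ 2) = 3 + 2 * degree T" using T0 by (simp add: degree_mult_eq degree_power_eq)
    then show ?thesis unfolding T using degF unfolding F_def by simp
  qed
  have leadT: "lead_coeff T ^ 2 = \<alpha> ^ 3"
  proof -
    have "lead_coeff (curve_poly a b) = 1" by (simp add: curve_poly_def)
    then have "lead_coeff (curve_poly a b * T ^ 2) = lead_coeff T ^ 2" by (simp only: lead_coeff_mult lead_coeff_power mult_1)
    then show ?thesis unfolding T using leadF unfolding F_def by simp
  qed
  have TF: "T dvd F" unfolding F_def T[symmetric] by (simp add: power2_eq_square)
  have TF': "T dvd pderiv F"
  proof -
    have "pderiv F = T * (curve_poly a b * pderiv T + pderiv (curve_poly a b * T))"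
      unfolding F_def T[symmetric] power2_eq_square
      by (simp only: pderiv_mult mult.assoc[symmetric]) (simp add: algebra_simps)
    then show ?thesis by simp
  qed
  \<comment> \<open>G1 and G2 are the partial derivatives of the cubic form; F3 is the identity of Euler and F' the
    chain rule.\<close>
  have F3: "3 * F = G1 * N + G2 * D" unfolding F_def cubic_form_def G1_def G2_def smult_const
  proof -
    have gen: "3 * (n ^ 3 + A * (n * e ^ 2) + B * e ^ 3) =
        (3 * n ^ 2 + A * e ^ 2) * n + ((2 * A) * (n * e) + (3 * B) * e ^ 2) * e" for n A e B :: "'a poly"
      by (simp add: algebra_simps power2_eq_square power3_eq_cube)
    have "[:2 * a:] = 2 * [:a:]" "[:3 * b:] = 3 * [:b:]" by (simp_all add: numeral_poly)
    then show "3 * (N ^ 3 + [:a:] * (N * D\<^sup>2) + [:b:] * D ^ 3) = (3 * N\<^sup>2 + [:a:] * D\<^sup>2) * N + ([:2 * a:] * (N * D) + [:3 * b:] * D\<^sup>2) * D"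
      using gen[of N "[:a:]" D "[:b:]"] by (simp only:)
  qed
  have F': "pderiv F = G1 * pderiv N + G2 * pderiv D"
  proof -
    have gen: "n * (n * n' + n * n') + n * n * n' + (A * (n * (e * e' + e * e') + e * e * n') + n * (e * e) * 0)
        + (B * (e * (e * e' + e * e') + e * e * e') + e * (e * e) * 0) =
        (3 * n ^ 2 + A * e ^ 2) * n' + ((2 * A) * (n * e) + (3 * B) * e ^ 2) * e'" for n n' A e e' B :: "'a poly"
      by (simp add: algebra_simps power2_eq_square)
    have "[:2 * a:] = 2 * [:a:]" "[:3 * b:] = 3 * [:b:]" by (simp_all add: numeral_poly)
    moreover have "pderiv [:a:] = 0" "pderiv [:b:] = 0" by (simp_all add: pderiv_pCons)
    moreover have "pderiv F = pderiv (N * (N * N) + [:a:] * (N * (D * D)) + [:b:] * (D * (D * D)))"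
      unfolding F_def cubic_form_def smult_const by (simp only: power2_eq_square power3_eq_cube mult.assoc)
    ultimately show ?thesis
      unfolding G1_def G2_def smult_const using gen[of N "pderiv N" "[:a:]" D "pderiv D" "[:b:]"]
      by (simp only: pderiv_add pderiv_mult)
  qed
  \<comment> \<open>The numerator of the derivative of N/D over D^2, before the common factor l is cancelled.\<close>
  define W where "W = pderiv N * D - N * pderiv D"
  have WV: "W = l * V" unfolding W_def V_def dD unfolding D_def by (simp add: algebra_simps power2_eq_square)
  have "G1 * W = pderiv F * D - 3 * F * pderiv D" unfolding F' F3 W_def by (simp add: algebra_simps)
  then have d1: "T dvd G1 * W" using TF TF' by simp
  have "G2 * W = 3 * F * pderiv N - pderiv F * N" unfolding F' F3 W_def by (simp add: algebra_simps)
  then have d2: "T dvd G2 * W" using TF TF' by simp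
  have ND: "\<not> (poly N x = 0 \<and> poly D x = 0)" for x using N(3) by (auto simp: D_def l_def)
  \<comment> \<open>A common root would give a multiple root of the cubic of the curve.\<close>
  have cop: "coprime T (gcd G1 G2)"
  proof (rule coprime_if_no_common_root)
    fix x
    show "\<not> (poly T x = 0 \<and> poly (gcd G1 G2) x = 0)"
    proof
      assume *: "poly T x = 0 \<and> poly (gcd G1 G2) x = 0"
      then have "poly G1 x = 0" "poly G2 x = 0" by (meson gcd_dvd1 gcd_dvd2 dvd_trans poly_eq_0_iff_dvd)+
      moreover have "poly F x = 0" using * TF by (auto elim!: dvdE)
      ultimately have e: "3 * poly N x ^ 2 + a * poly D x ^ 2 = 0" "2 * a * (poly N x * poly D x) + 3 * b * poly D x ^ 2 = 0"
        "poly N x ^ 3 + a * (poly N x * poly D x ^ 2) + b * poly D x ^ 3 = 0"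
        unfolding G1_def G2_def F_def cubic_form_def by simp_all
      show False
      proof (cases "poly D x = 0")
        case True
        then show False using e(3) ND by auto
      next
        case False
        define w where "w = poly N x / poly D x"
        have Nw: "poly N x = w * poly D x" using False by (simp add: w_def)
        have "poly D x ^ 2 * (3 * w ^ 2 + a) = 0" "poly D x ^ 3 * (w ^ 3 + a * w + b) = 0"
          using e unfolding Nw by (simp_all add: algebra_simps power2_eq_square power3_eq_cube)
        then have a: "a = - 3 * w ^ 2" and "w ^ 3 + a * w + b = 0" using False by (simp_all add: add_eq_0_iff2)
        then have "b = 2 * w ^ 3" by (simp add: power2_eq_square power3_eq_cube algebra_simps add_eq_0_iff2)
        then show False using ns unfolding a by (simp add: power2_eq_square power3_eq_cube)
      qed
    qed
  qed
  obtain u v where uv: "u * G1 + v * G2 = gcd G1 G2" using bezout_coefficients_fst_snd by blast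
  have "T dvd u * (G1 * W) + v * (G2 * W)" using d1 d2 by simp
  also have "u * (G1 * W) + v * (G2 * W) = gcd G1 G2 * W" unfolding uv[symmetric] by (simp add: algebra_simps)
  finally have "T dvd W" using cop by (simp add: coprime_dvd_mult_right_iff)
  moreover have "coprime T l"
  proof (rule coprime_if_no_common_root)
    fix x
    show "\<not> (poly T x = 0 \<and> poly l x = 0)"
    proof
      assume *: "poly T x = 0 \<and> poly l x = 0"
      then have "poly F x = 0" using TF by (auto elim!: dvdE)
      then have "poly N x = 0" using * unfolding F_def cubic_form_def D_def by simp
      then show False using * ND by (simp add: D_def)
    qed
  qed
  ultimately have "T dvd V" unfolding WV by (simp add: coprime_dvd_mult_right_iff)
  then obtain K where K: "V = T * K" by blast
  \<comment> \<open>The top coefficient of N' l is 3 \<alpha>, that of 2 N is 2 \<alpha>.\<close>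
  have coeffV: "coeff V 3 = \<alpha>" and degV: "degree V \<le> 3"
  proof -
    have dN: "degree (pderiv N) \<le> 2" "coeff (pderiv N) 2 = 3 * \<alpha>"
      using N by (simp_all add: degree_pderiv coeff_pderiv \<alpha>_def numeral_eq_Suc)
    have "coeff (pderiv N * l) (2 + 1) = 3 * \<alpha>"
      using coeff_mult_top[OF dN(1), of l 1] degl dN(2) by simp
    moreover have two: "2 * N = smult 2 N" by (simp add: numeral_poly)
    ultimately show "coeff V 3 = \<alpha>" unfolding V_def two using N by (simp add: \<alpha>_def)
    show "degree V \<le> 3" unfolding V_def two
      using degree_mult_le[of "pderiv N" l] dN degl N by (intro degree_diff_le) (auto intro: order_trans[OF degree_smult_le])
  qed
  have "V \<noteq> 0" using coeffV \<alpha> by auto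
  then have "K \<noteq> 0" using K by auto
  then have "degree T + degree K \<le> 3" using degV K T0 by (simp add: degree_mult_eq)
  then have "degree K = 0" using degT by simp
  then obtain k where k: "K = [:k:]" by (rule degree_eq_zeroE)
  then have Vk: "V = smult k T" using K by simp
  then have "\<alpha> = k * lead_coeff T" using coeffV degT by simp
  then have "\<alpha> ^ 2 = k ^ 2 * \<alpha> ^ 3" using leadT by (simp add: power_mult_distrib)
  then have "k ^ 2 * \<alpha> = 1" using \<alpha> by (simp add: power2_eq_square power3_eq_cube mult.assoc)
  then have "k ^ 2 = c ^ 2" unfolding \<alpha>_def using c0 by (simp add: power_divide)
  then have "curve_poly a b * V ^ 2 = smult (c ^ 2) F"
    unfolding Vk F_def T[symmetric] by (simp add: smult_power)
  then show ?thesis unfolding V_def F_def D_def l_def .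
qed

text \<open>
  After the substitution x = u + z, with P(u) = c^2 N(u + z), the identity reads
    f(u + z) (u P'(u) - 2 P(u))^2 = P(u)^3 + a c^4 P(u) u^4 + b c^6 u^6.
  Here u P' - 2 P has no quadratic term. The coefficients of u^8, u^7 and u^6 express P by z and the
  curve, and those of u^0 and u^1 give P(0) = 4 f(z) and P'(0) = 2 f'(z).
  Elimination of z leaves the relation between a and b, with the factor c^6 = 16 c - 3 \<noteq> 0.
\<close>

lemma isogeny_coefficients:
  assumes c: "c * (1 - c) = 3"
    and N: "degree N = 3" "lead_coeff N = (1 / c) ^ 2" "poly N z \<noteq> 0"
    and eq: "curve_poly a b * (pderiv N * [:- z, 1:] - 2 * N) ^ 2 = smult (c ^ 2) (cubic_form N ([:- z, 1:] ^ 2))"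
  shows "539 * a ^ 3 + 3456 * b ^ 2 = 0"
proof -
  have c0: "c \<noteq> 0" using c by auto
  define P where "P = pcompose (smult (c ^ 2) N) [:z, 1:]"
  define C B e where "C = coeff P 0" "B = coeff P 1" "e = coeff P 2"
  have "degree P = 3" unfolding P_def using N(1) c0 by (simp add: degree_pcompose)
  have "lead_coeff P = 1"
    unfolding P_def using c0 by (subst lead_coeff_comp) (simp_all add: N(2)[unfolded N(1)] N(1) power_divide)
  then have P: "P = [:C, B, e, 1:]"
    using \<open>degree P = 3\<close>
    by (intro poly_eqI) (auto simp: C_B_e_def coeff_pCons coeff_eq_0 numeral_eq_Suc split: nat.splits)
  have C0: "C \<noteq> 0"
  proof -
    have "C = poly P 0" by (simp add: P)
    also have "\<dots> = c ^ 2 * poly N z" unfolding P_def by (simp add: poly_pcompose)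
    finally show ?thesis using N(3) c0 by simp
  qed
  define f0 f1 f2 where "f0 = z ^ 3 + a * z + b" "f1 = 3 * z ^ 2 + a" "f2 = 3 * z"
  define left_side where "left_side = [:f0, f1, f2, 1:] * [:- 2 * C, - B, 0, 1:] ^ 2"
  define right_side where "right_side = P ^ 3 + smult (a * c ^ 4) (P * [:0, 0, 0, 0, 1:]) + smult (b * c ^ 6) [:0, 0, 0, 0, 0, 0, 1:]"
  have "left_side = right_side"
  proof (rule poly_eq_poly_eq_iff[THEN iffD1], rule ext)
    fix u
    have dP: "poly (pderiv P) u = c ^ 2 * poly (pderiv N) (u + z)"
      unfolding P_def by (simp add: pderiv_pcompose pderiv_smult pderiv_pCons poly_pcompose add.commute)
    have Pu: "poly P u = c ^ 2 * poly N (u + z)"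
      unfolding P_def by (simp add: poly_pcompose add.commute)
    have 0: "poly (curve_poly a b * (pderiv N * [:- z, 1:] - 2 * N) ^ 2) (u + z) =
      poly (smult (c ^ 2) (cubic_form N ([:- z, 1:] ^ 2))) (u + z)" unfolding eq ..
    have 1: "((u + z) ^ 3 + a * (u + z) + b) * (poly (pderiv N) (u + z) * u - 2 * poly N (u + z)) ^ 2 =
        c ^ 2 * (poly N (u + z) ^ 3 + a * (poly N (u + z) * (u ^ 2) ^ 2) + b * (u ^ 2) ^ 3)"
    proof -
      have "(u + z) * p - z * p = p * u" for p by (simp add: algebra_simps)
      then show ?thesis using 0 by (simp add: cubic_form_def)
    qed
    have "((u + z) ^ 3 + a * (u + z) + b) * (poly (pderiv P) u * u - 2 * poly P u) ^ 2 =
       c ^ 4 * (((u + z) ^ 3 + a * (u + z) + b) * (poly (pderiv N) (u + z) * u - 2 * poly N (u + z)) ^ 2)"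
      unfolding dP Pu by (simp add: algebra_simps power2_eq_square numeral_eq_Suc)
    also have "\<dots> = poly P u ^ 3 + a * c ^ 4 * (poly P u * u ^ 4) + b * c ^ 6 * u ^ 6"
      unfolding 1 Pu by (simp add: algebra_simps power2_eq_square numeral_eq_Suc)
    also have "\<dots> = poly right_side u" by (simp add: right_side_def numeral_eq_Suc algebra_simps)
    also have "poly (pderiv P) u * u - 2 * poly P u = poly [:- 2 * C, - B, 0, 1:] u"
      unfolding P by (simp add: pderiv_pCons algebra_simps)
    also have "(u + z) ^ 3 + a * (u + z) + b = poly [:f0, f1, f2, 1:] u"
      unfolding f0_f1_f2_def by (simp add: algebra_simps power2_eq_square power3_eq_cube)
    finally show "poly left_side u = poly right_side u" unfolding left_side_def by (simp only: poly_mult poly_power)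
  qed
  then have coeffs: "coeff left_side i = coeff right_side i" for i by simp
  have "f2 = 3 * e" using coeffs[of 8] unfolding left_side_def right_side_def P
    by (simp add: numeral_eq_Suc power2_eq_square algebra_simps)
  then have e: "e = z" by (simp add: f0_f1_f2_def)
  have "f1 - 2 * B = 3 * B + 3 * e ^ 2 + a * c ^ 4" using coeffs[of 7] unfolding left_side_def right_side_def P
    by (simp add: numeral_eq_Suc power2_eq_square algebra_simps)
  then have B5: "5 * B = a - a * c ^ 4" unfolding e f0_f1_f2_def by (simp add: algebra_simps)
  have "f0 - 2 * B * f2 - 4 * C = e ^ 3 + 6 * e * B + 3 * C + a * c ^ 4 * e + b * c ^ 6"
    using coeffs[of 6] unfolding left_side_def right_side_def P
    by (simp add: numeral_eq_Suc power2_eq_square algebra_simps)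
  then have C7: "7 * C = a * z + b - 12 * z * B - a * c ^ 4 * z - b * c ^ 6"
    unfolding e f0_f1_f2_def by (simp add: algebra_simps)
  have "f0 * (4 * C ^ 2) = C ^ 3" using coeffs[of 0] unfolding left_side_def right_side_def P
    by (simp add: power2_eq_square power3_eq_cube mult.commute)
  then have "(f0 * 4 - C) * C ^ 2 = 0" by (simp add: power2_eq_square power3_eq_cube algebra_simps)
  then have C4: "C = 4 * f0" using C0 by (simp add: mult.commute)
  have "f1 * (4 * C ^ 2) + f0 * (4 * C * B) = 3 * C ^ 2 * B" using coeffs[of 1] unfolding left_side_def right_side_def P
    by (simp add: power2_eq_square power3_eq_cube algebra_simps)
  then have "C * C * (4 * f1 + B - 3 * B) = 0" using C4
    by (simp add: power2_eq_square algebra_simps)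
  then have B2: "B = 2 * f1" using C0 by simp
  \<comment> \<open>As 1 - c^4 = 5 (c - 1), the equation for 5 B becomes B = a (c - 1).\<close>
  note pw = multiplier_powers[OF c]
  have "5 * (B - a * (c - 1)) = 0" using B5 unfolding pw(2) by (simp add: algebra_simps)
  then have B: "B = a * (c - 1)" by simp
  have z2: "6 * z ^ 2 = a * (c - 3)" using B2 unfolding B f0_f1_f2_def by (simp add: algebra_simps)
  have "6 * z ^ 3 = 6 * z ^ 2 * z" by (simp add: power2_eq_square power3_eq_cube)
  then have z3: "6 * z ^ 3 = a * (c - 3) * z" unfolding z2 .
  have "28 * (z ^ 3 + a * z + b) = a * z + b - 12 * z * (a * (c - 1)) - a * (6 - 5 * c) * z - b * (16 * c - 3)"
    using C7 unfolding C4 f0_f1_f2_def B pw(2,3) by (simp add: algebra_simps)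
  then have triple: "3 * (28 * (z ^ 3 + a * z + b)) = 3 * (a * z + b - 12 * z * (a * (c - 1)) - a * (6 - 5 * c) * z - b * (16 * c - 3))"
    by (rule arg_cong)
  have "14 * (6 * z ^ 3) + 84 * (a * z + b) = 3 * (28 * (z ^ 3 + a * z + b))" by (simp add: algebra_simps)
  then have "14 * (6 * z ^ 3) + 84 * (a * z + b) = 3 * (a * z + b - 12 * z * (a * (c - 1)) - a * (6 - 5 * c) * z - b * (16 * c - 3))"
    unfolding triple .
  then have z1: "7 * (a * z) * (5 * c + 3) = - (24 * b * (2 * c + 3))"
    unfolding z3 eq_neg_iff_add_eq_0 by (simp add: algebra_simps)
  have "49 * a ^ 2 * (6 * z ^ 2) * (5 * c + 3) ^ 2 = 6 * (7 * (a * z) * (5 * c + 3)) ^ 2"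
    by (simp add: power_mult_distrib)
  also have "\<dots> = 3456 * b ^ 2 * (2 * c + 3) ^ 2" unfolding z1 by (simp add: power_mult_distrib)
  finally have "49 * a ^ 2 * (6 * z ^ 2) * (5 * c + 3) ^ 2 = 3456 * b ^ 2 * (2 * c + 3) ^ 2" .
  then have e0: "49 * a ^ 3 * ((c - 3) * (5 * c + 3) ^ 2) = 3456 * b ^ 2 * (2 * c + 3) ^ 2"
    unfolding z2 by (simp add: power2_eq_square power3_eq_cube mult.assoc)
  have q1: "(5 * c + 3) ^ 2 = 55 * c - 66"
  proof -
    have "(5 * c + 3) ^ 2 = 25 * c ^ 2 + 30 * c + 9" by (simp add: power2_eq_square algebra_simps)
    then show ?thesis unfolding pw(1) by simp
  qed
  have q2: "(c - 3) * (55 * c - 66) = - (11 * (16 * c - 3))"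
  proof -
    have "(c - 3) * (55 * c - 66) = 55 * c ^ 2 - 231 * c + 198" by (simp add: power2_eq_square algebra_simps)
    then show ?thesis unfolding pw(1) by simp
  qed
  have q3: "(2 * c + 3) ^ 2 = 16 * c - 3"
  proof -
    have "(2 * c + 3) ^ 2 = 4 * c ^ 2 + 12 * c + 9" by (simp add: power2_eq_square algebra_simps)
    then show ?thesis unfolding pw(1) by simp
  qed
  have e1: "49 * a ^ 3 * - (11 * (16 * c - 3)) = 3456 * b ^ 2 * (16 * c - 3)"
    using e0 unfolding q1 q2 q3 .
  have "k * (539 * a ^ 3 + 3456 * b ^ 2) = 3456 * b ^ 2 * k - 49 * a ^ 3 * - (11 * k)" for k
    by (simp add: algebra_simps)
  from this[of "16 * c - 3"] have "(16 * c - 3) * (539 * a ^ 3 + 3456 * b ^ 2) = 0" unfolding e1 diff_self .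
  moreover have "16 * c - 3 \<noteq> 0" using pw(3) c0 by (metis power_not_zero)
  ultimately show ?thesis by (simp only: mult_eq_0_iff) blast
qed

theorem CM_curve_equation:
  assumes ns: "4 * a ^ 3 + 27 * b ^ 2 \<noteq> 0"
    and h: "h \<in> ring_iso (End_ring (short a b)) (ring_of_integers (quadratic_field (- 11)))"
  shows "539 * a ^ 3 + 3456 * b ^ 2 = 0"
proof -
  obtain f g where fg: "f \<in> ec_endomorphisms (short a b)" "g \<in> ec_endomorphisms (short a b)"
    "\<And>P. on_curve (short a b) P \<Longrightarrow> g (f P) = ec_add (short a b) (ec_add (short a b) P P) P"
    "\<And>P. on_curve (short a b) P \<Longrightarrow> g P = ec_add (short a b) P (ec_neg (f P))"
    "\<And>P. on_curve (short a b) P \<Longrightarrow> f P = ec_add (short a b) P (ec_neg (g P))"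
    using CM_endomorphisms[OF ns h] by blast
  obtain R S c R' S' where m: "acts_lim a b f R S c" "acts_lim a b g R' S' (1 - c)" "c * (1 - c) = 3"
    "has_pole R" "\<forall>\<^sub>F x in cofinite. R' (R x) = tpl_x a b x"
    using CM_multiplier[OF ns fg] by blast
  note on = endo_on_curve[OF fg(1)] endo_on_curve[OF fg(2)]
  obtain N z where N: "degree N = 3" "lead_coeff N = (1 / c) ^ 2" "poly N z \<noteq> 0"
    "\<forall>\<^sub>F x in cofinite. R x = poly N x / poly ([:- z, 1:] ^ 2) x"
    using degree_3[OF ns m(1) on(1) m(2) on(2) m(3-5)] by blast
  show ?thesis
    by (rule isogeny_coefficients[OF m(3) N(1-3) isogeny_equation[OF ns m(1) on(1) N]])
qed

end

section \<open>Roots of quadratics and cubics modulo a prime\<close>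

lemma dvd_linear_combination:
  "P dvd x \<Longrightarrow> P dvd y \<Longrightarrow> z = k * x * u + m * y * v \<Longrightarrow> P dvd z"
  for x y z :: "'a::comm_semiring_1"
  by (metis dvd_add dvd_mult dvd_mult2)

lemma ex_mod_solution:
  fixes P :: int
  assumes "Factorial_Ring.prime P" "\<not> P dvd k"
  shows "\<exists>w\<in>{0..<P}. P dvd k * w - c"
proof -
  have "coprime k P" using assms by (metis coprime_commute prime_imp_coprime)
  then obtain u where u: "[k * u = 1] (mod P)" using cong_solve_coprime_int by blast
  then have "P dvd k * u - 1" by (simp add: cong_iff_dvd_diff)
  moreover have "P dvd (u * c) mod P - u * c" by (metis mod_eq_dvd_iff mod_mod_trivial)
  ultimately have "P dvd (k * u - 1) * c + k * ((u * c) mod P - u * c)"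
    by (intro dvd_add dvd_mult dvd_mult2)
  then have "P dvd k * ((u * c) mod P) - c" by (simp add: algebra_simps)
  moreover have "(u * c) mod P \<in> {0..<P}" using assms(1) by (simp add: prime_gt_0_int)
  ultimately show ?thesis by blast
qed

text \<open>
  Being 0 modulo P counts as a square, which excludes vanishing discriminants.
\<close>

definition nonresidue :: "int \<Rightarrow> int \<Rightarrow> bool" where
  "nonresidue P t \<longleftrightarrow> (\<forall>x. \<not> P dvd x ^ 2 - t)"

lemma nonresidue_cong:
  assumes "nonresidue P t" "P dvd t - u"
  shows "nonresidue P u"
  unfolding nonresidue_def
proof
  fix x
  show "\<not> P dvd x ^ 2 - u"
  proof
    assume "P dvd x ^ 2 - u"
    then have "P dvd (x ^ 2 - u) - (t - u)" using assms(2) by (rule dvd_diff)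
    then show False using assms(1) unfolding nonresidue_def by simp
  qed
qed

lemma nonresidue_mult_square:
  assumes "Factorial_Ring.prime P" "nonresidue P t" "\<not> P dvd k"
  shows "nonresidue P (k ^ 2 * t)"
  unfolding nonresidue_def
proof
  fix x
  show "\<not> P dvd x ^ 2 - k ^ 2 * t"
  proof
    assume x: "P dvd x ^ 2 - k ^ 2 * t"
    obtain w where w: "P dvd k * w - x" using ex_mod_solution[OF assms(1,3)] by blast
    have "k ^ 2 * (w ^ 2 - t) = (k * w - x) * (k * w + x) + (x ^ 2 - k ^ 2 * t)"
      by (simp add: algebra_simps power2_eq_square)
    then have "P dvd k ^ 2 * (w ^ 2 - t)" using w x by simp
    then have "P dvd w ^ 2 - t"
      using assms(1,3) by (simp add: prime_dvd_mult_iff prime_dvd_power_iff)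
    then show False using assms(2) unfolding nonresidue_def by blast
  qed
qed

lemma nonresidue_mult_squareD: "nonresidue P (k ^ 2 * t) \<Longrightarrow> nonresidue P t"
  unfolding nonresidue_def
proof
  fix x assume *: "\<forall>x. \<not> P dvd x ^ 2 - k ^ 2 * t"
  show "\<not> P dvd x ^ 2 - t"
  proof
    assume "P dvd x ^ 2 - t"
    then have "P dvd k ^ 2 * (x ^ 2 - t)" by simp
    also have "k ^ 2 * (x ^ 2 - t) = (k * x) ^ 2 - k ^ 2 * t" by (simp add: algebra_simps power_mult_distrib)
    finally show False using * by blast
  qed
qed

lemma residue_diff_eq:
  fixes P :: int
  assumes "x \<in> {0..<P}" "y \<in> {0..<P}" "P dvd x - y"
  shows "x = y"
  using assms by (metis atLeastLessThan_iff mod_eq_dvd_iff mod_pos_pos_trivial)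

text \<open>
  A counting argument that avoids finite extension fields. The cubic
  (x - \<rho>) (x^2 + \<rho> x + \<sigma>) = x^3 + (\<sigma> - \<rho>^2) x - \<rho> \<sigma> has the discriminant (2 \<rho>^2 + \<sigma>)^2 (\<rho>^2 - 4 \<sigma>).
  So \<Phi> maps the set B of pairs (\<rho>, \<sigma>) with an irreducible quadratic factor to the set A of cubics
  whose discriminant is not a square. It is injective, as such a cubic has only one root. Conversely,
  the injection \<Theta> of A into B shows that B has at least as many elements: with \<beta> = \<alpha> w the
  discriminant -4 \<alpha>^3 - 27 \<beta>^2 is \<alpha>^2 (-4 \<alpha> - 27 w^2), and -4 \<alpha> - 27 w^2 = w^2 - 4 (\<alpha> + 7 w^2); for
  \<alpha> = 0 one takes w = \<beta>. Hence, \<Phi> is onto A, and every cubic in A has a root.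
\<close>

lemma cubic_root_mod_prime:
  fixes P a b :: int
  assumes P: "Factorial_Ring.prime P" and disc: "nonresidue P (- 4 * a ^ 3 - 27 * b ^ 2)"
  shows "\<exists>x. P dvd x ^ 3 + a * x + b"
proof -
  define F where "F = {0..<P}"
  define A where "A = {(\<alpha>, \<beta>). \<alpha> \<in> F \<and> \<beta> \<in> F \<and> nonresidue P (- 4 * \<alpha> ^ 3 - 27 * \<beta> ^ 2)}"
  define B where "B = {(\<rho>, \<sigma>). \<rho> \<in> F \<and> \<sigma> \<in> F \<and> nonresidue P (\<rho> ^ 2 - 4 * \<sigma>)}"
  have P0: "P > 0" using P prime_gt_0_int by blast
  have modF: "x mod P \<in> F" for x using P0 by (simp add: F_def)
  have mod_dvd: "P dvd x mod P - x" for x by (metis mod_eq_dvd_iff mod_mod_trivial)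
  have fin: "finite A" "finite B"
    by (rule finite_subset[of _ "F \<times> F"]; force simp: A_def B_def F_def)+
  define \<Phi> where "\<Phi> = (\<lambda>(\<rho>, \<sigma>). ((\<sigma> - \<rho> ^ 2) mod P, (- \<rho> * \<sigma>) mod P))"
  have \<Phi>: "\<Phi> (\<rho>, \<sigma>) \<in> A" if "(\<rho>, \<sigma>) \<in> B" for \<rho> \<sigma>
  proof -
    have nr: "nonresidue P (\<rho> ^ 2 - 4 * \<sigma>)" using that by (simp add: B_def)
    have "\<not> P dvd 2 * \<rho> ^ 2 + \<sigma>"
    proof
      assume "P dvd 2 * \<rho> ^ 2 + \<sigma>"
      then have "P dvd 4 * (2 * \<rho> ^ 2 + \<sigma>)" by (rule dvd_mult)
      also have "4 * (2 * \<rho> ^ 2 + \<sigma>) = (3 * \<rho>) ^ 2 - (\<rho> ^ 2 - 4 * \<sigma>)" by (simp add: power2_eq_square)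
      finally show False using nr unfolding nonresidue_def by blast
    qed
    from nonresidue_mult_square[OF P nr this]
    have nr2: "nonresidue P ((2 * \<rho> ^ 2 + \<sigma>) ^ 2 * (\<rho> ^ 2 - 4 * \<sigma>))" .
    define \<alpha> \<beta> where "\<alpha> = (\<sigma> - \<rho> ^ 2) mod P" "\<beta> = (- \<rho> * \<sigma>) mod P"
    have d: "P dvd \<alpha> - (\<sigma> - \<rho> ^ 2)" "P dvd \<beta> - (- \<rho> * \<sigma>)" unfolding \<alpha>_\<beta>_def by (rule mod_dvd)+
    have eq: "(2 * \<rho> ^ 2 + \<sigma>) ^ 2 * (\<rho> ^ 2 - 4 * \<sigma>) - (- 4 * \<alpha> ^ 3 - 27 * \<beta> ^ 2) =
        4 * (\<alpha> - (\<sigma> - \<rho> ^ 2)) * (\<alpha> ^ 2 + \<alpha> * (\<sigma> - \<rho> ^ 2) + (\<sigma> - \<rho> ^ 2) ^ 2) + 27 * (\<beta> - (- \<rho> * \<sigma>)) * (\<beta> + (- \<rho> * \<sigma>))"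
      by (simp add: algebra_simps power2_eq_square power3_eq_cube)
    have "P dvd (2 * \<rho> ^ 2 + \<sigma>) ^ 2 * (\<rho> ^ 2 - 4 * \<sigma>) - (- 4 * \<alpha> ^ 3 - 27 * \<beta> ^ 2)"
      by (rule dvd_linear_combination[OF d eq])
    from nonresidue_cong[OF nr2 this] show ?thesis
      unfolding A_def \<Phi>_def \<alpha>_\<beta>_def using modF by simp
  qed
  have \<Phi>_inj: "inj_on \<Phi> B"
  proof (rule inj_onI, clarify)
    fix \<rho> \<sigma> \<rho>' \<sigma>'
    assume B: "(\<rho>, \<sigma>) \<in> B" "(\<rho>', \<sigma>') \<in> B" and eq: "\<Phi> (\<rho>, \<sigma>) = \<Phi> (\<rho>', \<sigma>')"
    have d: "P dvd (\<sigma> - \<rho> ^ 2) - (\<sigma>' - \<rho>' ^ 2)" "P dvd (- \<rho> * \<sigma>) - (- \<rho>' * \<sigma>')"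
      using eq unfolding \<Phi>_def by (simp_all add: mod_eq_dvd_iff)
    have "(\<rho>' - \<rho>) * (\<rho>' ^ 2 + \<rho> * \<rho>' + \<sigma>) =
       ((\<sigma> - \<rho> ^ 2) - (\<sigma>' - \<rho>' ^ 2)) * \<rho>' + ((- \<rho> * \<sigma>) - (- \<rho>' * \<sigma>'))"
      by (simp add: algebra_simps power2_eq_square)
    then have "P dvd (\<rho>' - \<rho>) * (\<rho>' ^ 2 + \<rho> * \<rho>' + \<sigma>)" using d by simp
    then consider "P dvd \<rho>' - \<rho>" | "P dvd \<rho>' ^ 2 + \<rho> * \<rho>' + \<sigma>" using P by (auto simp: prime_dvd_mult_iff)
    then show "\<rho> = \<rho>' \<and> \<sigma> = \<sigma>'"
    proof cases
      case 1
      then have \<rho>: "\<rho>' = \<rho>" using residue_diff_eq B unfolding B_def F_def by blast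
      then have "P dvd \<sigma> - \<sigma>'" using d by simp
      then have "\<sigma> = \<sigma>'" using residue_diff_eq B unfolding B_def F_def by blast
      then show ?thesis using \<rho> by simp
    next
      case 2
      then have "P dvd 4 * (\<rho>' ^ 2 + \<rho> * \<rho>' + \<sigma>)" by (rule dvd_mult)
      also have "4 * (\<rho>' ^ 2 + \<rho> * \<rho>' + \<sigma>) = (2 * \<rho>' + \<rho>) ^ 2 - (\<rho> ^ 2 - 4 * \<sigma>)"
        by (simp add: algebra_simps power2_eq_square)
      finally show ?thesis using B unfolding B_def nonresidue_def by blast
    qed
  qed
  define quot where "quot = (\<lambda>\<alpha> \<beta>. SOME w. w \<in> {0..<P} \<and> P dvd \<alpha> * w - \<beta>)"
  define \<Theta> where "\<Theta> = (\<lambda>(\<alpha>, \<beta>). let w = (if \<alpha> = 0 then \<beta> else quot \<alpha> \<beta>) in (w, (\<alpha> + 7 * w ^ 2) mod P))"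
  have quot: "quot \<alpha> \<beta> \<in> F" "P dvd \<alpha> * quot \<alpha> \<beta> - \<beta>" if "\<alpha> \<in> F" "\<alpha> \<noteq> 0" for \<alpha> \<beta>
  proof -
    have "\<not> P dvd \<alpha>" using that unfolding F_def by (auto dest: zdvd_imp_le)
    then have "\<exists>w. w \<in> {0..<P} \<and> P dvd \<alpha> * w - \<beta>" using ex_mod_solution[OF P] by blast
    from someI_ex[OF this] show "quot \<alpha> \<beta> \<in> F" "P dvd \<alpha> * quot \<alpha> \<beta> - \<beta>"
      unfolding quot_def F_def by auto
  qed
  have \<Theta>: "\<Theta> ` A \<subseteq> B"
  proof (rule image_subsetI)
    fix p assume "p \<in> A"
    then obtain \<alpha> \<beta> where p: "p = (\<alpha>, \<beta>)" and AB: "(\<alpha>, \<beta>) \<in> A" by (cases p) auto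
    define w where "w = (if \<alpha> = 0 then \<beta> else quot \<alpha> \<beta>)"
    have wF: "w \<in> F" using AB quot unfolding w_def A_def by auto
    have nr: "nonresidue P (- 4 * \<alpha> ^ 3 - 27 * \<beta> ^ 2)" using AB by (simp add: A_def)
    have "nonresidue P (- 4 * \<alpha> - 27 * w ^ 2)"
    proof (cases "\<alpha> = 0")
      case True
      then show ?thesis using nr by (simp add: w_def)
    next
      case False
      then have d: "P dvd \<alpha> * w - \<beta>" using quot AB unfolding w_def A_def by auto
      have eq: "(- 4 * \<alpha> ^ 3 - 27 * \<beta> ^ 2) - \<alpha> ^ 2 * (- 4 * \<alpha> - 27 * w ^ 2) = 27 * (\<alpha> * w - \<beta>) * (\<alpha> * w + \<beta>)"
        by (simp add: algebra_simps power2_eq_square power3_eq_cube)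
      have "P dvd (- 4 * \<alpha> ^ 3 - 27 * \<beta> ^ 2) - \<alpha> ^ 2 * (- 4 * \<alpha> - 27 * w ^ 2)"
        unfolding eq by (rule dvd_mult2, rule dvd_mult, rule d)
      from nonresidue_mult_squareD[OF nonresidue_cong[OF nr this]] show ?thesis .
    qed
    moreover have "P dvd (- 4 * \<alpha> - 27 * w ^ 2) - (w ^ 2 - 4 * ((\<alpha> + 7 * w ^ 2) mod P))"
    proof -
      have "(- 4 * \<alpha> - 27 * w ^ 2) - (w ^ 2 - 4 * ((\<alpha> + 7 * w ^ 2) mod P)) =
        4 * ((\<alpha> + 7 * w ^ 2) mod P - (\<alpha> + 7 * w ^ 2))" by simp
      then show ?thesis using mod_dvd[of "\<alpha> + 7 * w ^ 2"] by (metis dvd_mult)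
    qed
    ultimately have "nonresidue P (w ^ 2 - 4 * ((\<alpha> + 7 * w ^ 2) mod P))" by (rule nonresidue_cong)
    then have "(w, (\<alpha> + 7 * w ^ 2) mod P) \<in> B" unfolding B_def using wF modF by simp
    then show "\<Theta> p \<in> B" unfolding p \<Theta>_def w_def Let_def by simp
  qed
  have \<Theta>_inj: "inj_on \<Theta> A"
  proof (rule inj_onI, clarify)
    fix \<alpha> \<beta> \<alpha>' \<beta>'
    assume A: "(\<alpha>, \<beta>) \<in> A" "(\<alpha>', \<beta>') \<in> A" and eq: "\<Theta> (\<alpha>, \<beta>) = \<Theta> (\<alpha>', \<beta>')"
    define w where "w = (if \<alpha> = 0 then \<beta> else quot \<alpha> \<beta>)"
    define w' where "w' = (if \<alpha>' = 0 then \<beta>' else quot \<alpha>' \<beta>')"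
    have w: "w = w'" "(\<alpha> + 7 * w ^ 2) mod P = (\<alpha>' + 7 * w' ^ 2) mod P"
      using eq unfolding \<Theta>_def Let_def prod.case w_def[symmetric] w'_def[symmetric] prod.inject by blast+
    then have "P dvd \<alpha> - \<alpha>'" by (simp add: mod_eq_dvd_iff)
    then have \<alpha>: "\<alpha> = \<alpha>'" using residue_diff_eq A unfolding A_def F_def by blast
    show "\<alpha> = \<alpha>' \<and> \<beta> = \<beta>'"
    proof (cases "\<alpha> = 0")
      case True
      then show ?thesis using w \<alpha> unfolding w_def w'_def by simp
    next
      case False
      have "quot \<alpha> \<beta> = w" using False by (simp add: w_def)
      moreover have "quot \<alpha> \<beta>' = w" using False w(1) \<alpha> by (simp add: w'_def)
      moreover have "\<alpha> \<in> F" using A unfolding A_def by simp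
      ultimately have "P dvd \<alpha> * w - \<beta>" "P dvd \<alpha> * w - \<beta>'"
        using quot(2)[of \<alpha> \<beta>] quot(2)[of \<alpha> \<beta>'] False by simp_all
      then have "P dvd (\<alpha> * w - \<beta>') - (\<alpha> * w - \<beta>)" by (rule dvd_diff[rotated])
      then have "\<beta> = \<beta>'" using residue_diff_eq A unfolding A_def F_def by auto
      then show ?thesis using \<alpha> by simp
    qed
  qed
  have "card A \<le> card B" using card_inj_on_le[OF \<Theta>_inj \<Theta> fin(2)] .
  moreover have sub: "\<Phi> ` B \<subseteq> A" using \<Phi> by auto
  ultimately have "\<Phi> ` B = A" using card_image[OF \<Phi>_inj] card_seteq[OF fin(1) sub] by simp
  moreover have "(a mod P, b mod P) \<in> A"
  proof -
    have d: "P dvd a mod P - a" "P dvd b mod P - b" by (rule mod_dvd)+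
    have eq: "(- 4 * a ^ 3 - 27 * b ^ 2) - (- 4 * (a mod P) ^ 3 - 27 * (b mod P) ^ 2) =
      4 * (a mod P - a) * ((a mod P) ^ 2 + (a mod P) * a + a ^ 2) + 27 * (b mod P - b) * (b mod P + b)"
      by (simp add: algebra_simps power2_eq_square power3_eq_cube)
    have "P dvd (- 4 * a ^ 3 - 27 * b ^ 2) - (- 4 * (a mod P) ^ 3 - 27 * (b mod P) ^ 2)"
      by (rule dvd_linear_combination[OF d eq])
    from nonresidue_cong[OF disc this] show ?thesis unfolding A_def using modF by simp
  qed
  ultimately obtain \<rho> \<sigma> where "(a mod P, b mod P) = \<Phi> (\<rho>, \<sigma>)" by (metis imageE surj_pair)
  then have d: "P dvd a - (\<sigma> - \<rho> ^ 2)" "P dvd b - (- \<rho> * \<sigma>)"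
    unfolding \<Phi>_def prod.case prod.inject mod_eq_dvd_iff by blast+
  have eq: "\<rho> ^ 3 + a * \<rho> + b = (a - (\<sigma> - \<rho> ^ 2)) * \<rho> + (b - (- \<rho> * \<sigma>))"
    by (simp add: algebra_simps power2_eq_square power3_eq_cube)
  have "P dvd \<rho> ^ 3 + a * \<rho> + b" unfolding eq by (intro dvd_add dvd_mult2 d)
  then show ?thesis by blast
qed

text \<open>
  The discriminants are -11 * 2^2 for the quadratic and -11 * 594^2 for the cubic, where
  594 = 2 * 3^3 * 11 is invertible modulo P.
\<close>

lemma torsion_root_mod_prime:
  fixes P :: int
  assumes P: "Factorial_Ring.prime P" "P > 11"
  shows "(\<exists>h. P dvd h ^ 2 - 22 * h + 132) \<or> (\<exists>h. P dvd h ^ 3 - 264 * h + 1694)"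
proof (cases "nonresidue P (- 11)")
  case False
  then obtain x where "P dvd x ^ 2 + 11" unfolding nonresidue_def by auto
  moreover have "(x + 11) ^ 2 - 22 * (x + 11) + 132 = x ^ 2 + 11" by (simp add: power2_eq_square algebra_simps)
  ultimately have "P dvd (x + 11) ^ 2 - 22 * (x + 11) + 132" by (simp only:)
  then show ?thesis by blast
next
  case True
  have "\<not> P dvd 594"
  proof
    assume "P dvd 594"
    also have "(594 :: int) = 2 * (3 * (3 * (3 * 11)))" by simp
    finally have "P dvd 2 \<or> P dvd 3 \<or> P dvd 11" unfolding prime_dvd_mult_iff[OF P(1)] by blast
    then show False using P(2) by (auto dest: zdvd_imp_le)
  qed
  from nonresidue_mult_square[OF P(1) True this]
  have "nonresidue P (- 4 * (- 264) ^ 3 - 27 * 1694 ^ 2)" by simp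
  from cubic_root_mod_prime[OF P(1) this] show ?thesis by simp
qed

section \<open>Curves over the rationals\<close>

instance alg_closure :: (field) field_gcd ..

lemma poly_map_to_ac [simp]: "poly (map_poly to_ac p) (to_ac x) = to_ac (poly p x)"
  by (induction p) (simp_all add: map_poly_pCons)

lemma map_poly_to_ac_mult: "map_poly to_ac (p * q) = map_poly to_ac p * map_poly to_ac q"
  by (rule poly_eqI) (simp add: coeff_map_poly coeff_mult to_ac_sum)

lemma map_poly_to_ac_add: "map_poly to_ac (p + q) = map_poly to_ac p + map_poly to_ac q"
  by (rule poly_eqI) (simp add: coeff_map_poly)

lemma degree_map_to_ac [simp]: "degree (map_poly to_ac p) = degree p"
  by (rule degree_map_poly) simp

text \<open>
  By a Bezout identity over the small field, the greatest common divisor of q and d vanishes at every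
  root of q in the closure. A cofactor that is not constant would make one of these roots double.
\<close>

lemma dvd_if_roots:
  fixes q d :: "'a::{field_char_0, field_gcd} poly"
  assumes q: "q \<noteq> 0" and roots: "\<And>z. poly (map_poly to_ac q) z = 0 \<Longrightarrow> poly (map_poly to_ac d) z = 0"
    and sqfree: "\<And>z. \<not> [:- z, 1:] ^ 2 dvd map_poly to_ac q"
  shows "q dvd d"
proof -
  define g where "g = gcd q d"
  obtain q' where q': "q = g * q'" unfolding g_def by (meson dvdE gcd_dvd1)
  obtain u v where uv: "u * q + v * d = g" unfolding g_def using bezout_coefficients_fst_snd by blast
  have "degree q' = 0"
  proof (rule ccontr)
    assume "degree q' \<noteq> 0"
    then obtain z where z: "poly (map_poly to_ac q') z = 0"
      using alg_closed_imp_poly_has_root[of "map_poly to_ac q'"] by auto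
    then have qz: "poly (map_poly to_ac q) z = 0" unfolding q' map_poly_to_ac_mult by simp
    then have "poly (map_poly to_ac g) z = 0"
      unfolding uv[symmetric] map_poly_to_ac_add map_poly_to_ac_mult using roots by simp
    then have "[:- z, 1:] * [:- z, 1:] dvd map_poly to_ac q"
      unfolding q' map_poly_to_ac_mult using z by (intro mult_dvd_mono) (simp_all only: poly_eq_0_iff_dvd)
    then show False using sqfree by (simp only: power2_eq_square)
  qed
  then have "is_unit q'" using q q' by (metis is_unit_iff_degree mult_zero_right)
  then have "q dvd g" unfolding q' by (simp only: mult_unit_dvd_iff dvd_refl)
  then show ?thesis unfolding g_def using dvd_trans gcd_dvd2 by blast
qed

lemma geometric_short [simp]:
  "shift_r (geometric E) = to_ac (shift_r E)" "short_a (geometric E) = to_ac (short_a E)"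
  "short_b (geometric E) = to_ac (short_b E)"
  by (simp_all add: geometric_def shift_r_def short_a_def short_b_def weierstrass.map_sel)

lemma CM_short_equation:
  assumes E: "elliptic_curve E" and CM: "has_CM_by E (ring_of_integers (quadratic_field (- 11)))"
  shows "4 * short_a E ^ 3 + 27 * short_b E ^ 2 \<noteq> 0" "539 * short_a E ^ 3 + 3456 * short_b E ^ 2 = 0"
proof -
  let ?a = "short_a E" and ?b = "short_b E"
  show ns: "4 * ?a ^ 3 + 27 * ?b ^ 2 \<noteq> 0"
    using E unfolding elliptic_curve_def discriminant_short by simp
  have "to_ac (4 * ?a ^ 3 + 27 * ?b ^ 2) \<noteq> 0" using ns by (simp only: to_ac_eq_0_iff not_False_eq_True)
  then have ns': "4 * to_ac ?a ^ 3 + 27 * to_ac ?b ^ 2 \<noteq> 0" by simp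
  interpret iso: ec_linear_iso "short (to_ac ?a) (to_ac ?b)" "geometric E" "of_short (geometric E)"
    "to_short (geometric E)" "lin_of_short (geometric E)" "lin_short (geometric E)"
    using ec_linear_iso_short[of "geometric E"] by simp
  obtain h where h: "h \<in> ring_iso (End_ring (geometric E)) (ring_of_integers (quadratic_field (- 11)))"
    using CM unfolding has_CM_by_def is_ring_iso_def by blast
  have "h \<circ> iso.conj_endo \<in> ring_iso (End_ring (short (to_ac ?a) (to_ac ?b))) (ring_of_integers (quadratic_field (- 11)))"
    using iso.conj_endo_ring_iso h unfolding ring_iso_def
    by (auto intro: ring_hom_trans bij_betw_trans)
  from CM_curve_equation[OF ns' this]
  have "to_ac (539 * ?a ^ 3 + 3456 * ?b ^ 2) = 0" by simp
  then show "539 * ?a ^ 3 + 3456 * ?b ^ 2 = 0" by (simp only: to_ac_eq_0_iff)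
qed

text \<open>
  The equation says that a^3/b^2 = (-264)^3/1694^2. So the curve is a quadratic twist of
  y^2 = x^3 - 264 x + 1694, and s is found from b/a = -(77/12) s.
\<close>

lemma CM_short_parameter:
  fixes a b :: rat
  assumes ns: "4 * a ^ 3 + 27 * b ^ 2 \<noteq> 0" and eq: "539 * a ^ 3 + 3456 * b ^ 2 = 0"
  obtains s where "s \<noteq> 0" "a = - 264 * s ^ 2" "b = 1694 * s ^ 3"
proof -
  have a0: "a \<noteq> 0" using ns eq by auto
  then have b0: "b \<noteq> 0" using eq by auto
  define s where "s = - (12 / 77) * (b / a)"
  have b2: "b ^ 2 = - (539 / 3456) * a ^ 3" using eq by simp
  have s2: "s ^ 2 = (144 / 5929) * (b ^ 2 / a ^ 2)" by (simp add: s_def power_mult_distrib power_divide)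
  also have "\<dots> = - a / 264" unfolding b2 using a0 by (simp add: power2_eq_square power3_eq_cube)
  finally have s2: "s ^ 2 = - a / 264" .
  have "s ^ 3 = s ^ 2 * s" by (simp add: power2_eq_square power3_eq_cube)
  also have "\<dots> = - a / 264 * s" unfolding s2 ..
  also have "\<dots> = b / 1694" unfolding s_def using a0 by simp
  finally have "s ^ 3 = b / 1694" .
  then show ?thesis using s2 b0 a0 by (intro that[of s]) (auto simp: s_def)
qed

section \<open>Torsion points and poles of Lattes maps\<close>

lemma ec_mult_Infinity: "ec_mult E k Infinity = Infinity"
  unfolding ec_mult_def by (induction k) auto

lemma ec_mult_cycle:
  assumes "(ec_add E P ^^ m) Infinity = Infinity" "m dvd k"
  shows "ec_mult E k P = Infinity"
proof -
  obtain j where "k = m * j" using assms(2) by blast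
  moreover have "(((ec_add E P) ^^ m) ^^ j) Infinity = Infinity" by (induction j) (use assms(1) in auto)
  ultimately show ?thesis unfolding ec_mult_def by (simp only: funpow_mult)
qed

lemma torsion_transport:
  fixes E :: "'a::field_char_0 weierstrass"
  assumes P: "on_curve (short (short_a E) (short_b E)) P"
    and tors: "(ec_add (short (short_a E) (short_b E)) P ^^ m) Infinity = Infinity" and k: "m dvd k"
  shows "ec_mult E k (of_short E P) = Infinity"
proof (rule ec_mult_cycle[OF _ k])
  have on: "on_curve E (of_short E P)" using on_curve_to_short[of E "of_short E P"] P by simp
  have "to_short E ((ec_add E (of_short E P) ^^ j) Infinity) = (ec_add (short (short_a E) (short_b E)) P ^^ j) Infinity
      \<and> on_curve E ((ec_add E (of_short E P) ^^ j) Infinity)" for j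
  proof (induction j)
    case (Suc j)
    let ?Q = "(ec_add E (of_short E P) ^^ j) Infinity"
    have add: "to_short E (ec_add E (of_short E P) ?Q) = ec_add (short (short_a E) (short_b E)) P (to_short E ?Q)"
      using to_short_add[OF on, of ?Q] Suc by simp
    moreover have "on_curve (short (short_a E) (short_b E)) (to_short E ?Q)"
      using Suc on_curve_to_short by blast
    then have "on_curve E (ec_add E (of_short E P) ?Q)"
      using on_curve_add[OF P] add on_curve_to_short by metis
    ultimately show ?case using Suc by simp
  qed simp
  from this[of m] tors have "to_short E ((ec_add E (of_short E P) ^^ m) Infinity) = Infinity" by simp
  then show "(ec_add E (of_short E P) ^^ m) Infinity = Infinity"
    by (metis of_short.simps(1) of_short_to_short)
qed

lemma two_torsion:
  fixes a b :: "'a::field_char_0"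
  assumes "u ^ 3 + a * u + b = 0"
  shows "on_curve (short a b) (Affine u 0)" "(ec_add (short a b) (Affine u 0) ^^ 2) Infinity = Infinity"
  using assms by (simp_all add: numeral_2_eq_2)

text \<open>
  The vanishing of the 3-division polynomial says that the tangent at the point is an inflection
  tangent: x(2 P) = x(P), so 2 P = -P.
\<close>

lemma three_torsion:
  fixes a b :: "'a::field_char_0"
  assumes y: "y ^ 2 = u ^ 3 + a * u + b" "y \<noteq> 0"
    and psi: "3 * u ^ 4 + 6 * a * u ^ 2 + 12 * b * u - a ^ 2 = 0"
  shows "on_curve (short a b) (Affine u y)" "(ec_add (short a b) (Affine u y) ^^ 3) Infinity = Infinity"
proof -
  show on: "on_curve (short a b) (Affine u y)" using y by simp
  define l where "l = (3 * u ^ 2 + a) / (2 * y)"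
  have "(3 * u ^ 2 + a) ^ 2 = 12 * u * (u ^ 3 + a * u + b)"
    using psi by (simp add: algebra_simps power2_eq_square numeral_eq_Suc)
  then have l2: "l ^ 2 = 3 * u" unfolding l_def y(1)[symmetric] using y(2)
    by (simp add: power_divide power_mult_distrib)
  have "ec_add (short a b) (Affine u y) (Affine u y) = Affine (l ^ 2 - u - u) (- (y + l * (l ^ 2 - u - u - u)))"
    using y by (simp add: Let_def l_def)
  then have "ec_add (short a b) (Affine u y) (Affine u y) = ec_neg (Affine u y)" unfolding l2 by simp
  then have "ec_add (short a b) (Affine u y) (ec_add (short a b) (Affine u y) (Affine u y)) = Infinity"
    using ec_add_neg by metis
  then show "(ec_add (short a b) (Affine u y) ^^ 3) Infinity = Infinity"
    by (simp add: numeral_3_eq_3 del: ec_add.simps(3))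
qed

text \<open>
  The denominator of L in lowest terms vanishes, because L has to send the x-coordinate to infinity.
\<close>

lemma lattes_pole:
  assumes L: "is_lattes_map E k L" and P: "on_curve (geometric E) (Affine z y)"
    and tors: "ec_mult (geometric E) k (Affine z y) = Infinity"
  shows "poly (map_poly to_ac (snd (quot_of_fract L))) z = 0"
proof -
  have "proj (ec_mult (geometric E) k (Affine z y)) = eval_geometric L (proj (Affine z y))"
    using L P unfolding is_lattes_map_def points_def by blast
  then have "eval_geometric L (Finite z) = At_Infinity" using tors by simp
  then show ?thesis unfolding eval_geometric_def by (auto simp: case_prod_beta split: if_splits)
qed

text \<open>
  The multiple of the point at infinity is the point at infinity again.
\<close>

lemma lattes_degree:
  assumes L: "is_lattes_map E k L"
  shows "degree (snd (quot_of_fract L)) < degree (fst (quot_of_fract L))"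
proof -
  obtain n d where nd: "quot_of_fract L = (n, d)" by (cases "quot_of_fract L")
  have d: "d \<noteq> 0" using snd_quot_of_fract_nonzero[of L] nd by simp
  have "proj (ec_mult (geometric E) k Infinity) = eval_geometric L (proj Infinity)"
    using L unfolding is_lattes_map_def points_def by auto
  then have "eval_geometric L At_Infinity = At_Infinity" by (simp add: ec_mult_Infinity)
  then have "coeff d (max (degree n) (degree d)) = 0"
    unfolding eval_geometric_def nd by (auto simp: Let_def coeff_map_poly split: if_splits)
  then show ?thesis using d unfolding nd by (metis fst_conv leading_coeff_0_iff max.absorb2 max_def not_le snd_conv)
qed

lemma clear_denominators:
  fixes u :: "rat poly"
  shows "\<exists>M U. M > 0 \<and> map_poly of_int U = smult (of_int M) u"
proof (induction u)
  case 0
  show ?case by (intro exI[of _ 1] exI[of _ 0]) simp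
next
  case (pCons c u)
  then obtain M U where MU: "M > 0" "map_poly of_int U = smult (of_int M) u" by blast
  obtain p q where c: "quotient_of c = (p, q)" by (cases "quotient_of c")
  then have q: "q > 0" "c = of_int p / of_int q" using quotient_of_denom_pos quotient_of_div by blast+
  have "map_poly of_int (pCons (p * M) (smult q U)) = smult (of_int (q * M)) (pCons c u)"
  proof -
    have "map_poly of_int (smult q U) = smult (of_int q) (map_poly of_int U :: rat poly)"
      by (rule poly_eqI) (simp add: coeff_map_poly)
    then show ?thesis using q MU by (simp add: map_poly_pCons)
  qed
  then show ?case using q MU by (intro exI[of _ "q * M"] exI[of _ "pCons (p * M) (smult q U)"]) simp
qed

lemma poly_map_of_int [simp]: "poly (map_poly of_int p) (of_int x) = (of_int (poly p x) :: rat)"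
  by (induction p) (simp_all add: map_poly_pCons)

lemma poly_map_to_ac_shift:
  "poly (map_poly to_ac (pcompose d [:c, 1:])) u = poly (map_poly to_ac d) (u + to_ac c)"
  by (induction d) (simp_all add: pcompose_pCons map_poly_to_ac_add map_poly_to_ac_mult map_poly_pCons algebra_simps
      del: mult_pCons_left)

lemma two_torsion_dvd_denominator:
  assumes L: "is_lattes_map E k L" and ns: "4 * short_a E ^ 3 + 27 * short_b E ^ 2 \<noteq> 0" and k: "2 dvd k"
  shows "curve_poly (short_a E) (short_b E) dvd pcompose (snd (quot_of_fract L)) [:- shift_r E, 1:]"
proof (rule dvd_if_roots)
  let ?a = "short_a E" and ?b = "short_b E"
  have map: "map_poly to_ac (curve_poly ?a ?b) = curve_poly (to_ac ?a) (to_ac ?b)"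
    by (simp add: curve_poly_def map_poly_pCons)
  have "to_ac (4 * ?a ^ 3 + 27 * ?b ^ 2) \<noteq> 0" using ns by (simp only: to_ac_eq_0_iff not_False_eq_True)
  then have "4 * to_ac ?a ^ 3 + 27 * to_ac ?b ^ 2 \<noteq> 0" by simp
  then show "\<not> [:- z, 1:] ^ 2 dvd map_poly to_ac (curve_poly ?a ?b)" for z
    unfolding map by (rule curve_poly_squarefree)
  fix u assume "poly (map_poly to_ac (curve_poly ?a ?b)) u = 0"
  then have "u ^ 3 + to_ac ?a * u + to_ac ?b = 0" unfolding map by simp
  note tors = two_torsion[OF this]
  have on: "on_curve (geometric E) (of_short (geometric E) (Affine u 0))"
    using on_curve_to_short[of "geometric E" "of_short (geometric E) (Affine u 0)"] tors(1) by simp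
  have "ec_mult (geometric E) k (of_short (geometric E) (Affine u 0)) = Infinity"
    by (rule torsion_transport[OF _ _ k]) (use tors in simp_all)
  from lattes_pole[OF L on[unfolded of_short.simps] this[unfolded of_short.simps]]
  show "poly (map_poly to_ac (pcompose (snd (quot_of_fract L)) [:- shift_r E, 1:])) u = 0"
    unfolding poly_map_to_ac_shift by simp
qed simp

text \<open>
  The quadratic divides the 3-division polynomial, with cofactor 3 (x^2 + 22 s x - 176 s^2). It has no
  root in common with the cubic of the curve, so its roots belong to points of order exactly 3.
\<close>

lemma three_torsion_dvd_denominator:
  assumes L: "is_lattes_map E k L" and s: "s \<noteq> 0" "short_a E = - 264 * s ^ 2" "short_b E = 1694 * s ^ 3" and k: "3 dvd k"
  shows "[:132 * s ^ 2, - 22 * s, 1:] dvd pcompose (snd (quot_of_fract L)) [:- shift_r E, 1:]"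
proof (rule dvd_if_roots)
  let ?a = "short_a E" and ?b = "short_b E" and ?s = "to_ac s"
  have map: "map_poly to_ac [:132 * s ^ 2, - 22 * s, 1:] = [:132 * ?s ^ 2, - 22 * ?s, 1:]"
    by (simp add: map_poly_pCons)
  have s0: "?s \<noteq> 0" using s by simp
  have s2: "?s * ?s \<noteq> 0" using s0 by simp
  show "\<not> [:- z, 1:] ^ 2 dvd map_poly to_ac [:132 * s ^ 2, - 22 * s, 1:]" for z
  proof
    assume "[:- z, 1:] ^ 2 dvd map_poly to_ac [:132 * s ^ 2, - 22 * s, 1:]"
    then obtain q where q: "[:132 * ?s ^ 2, - 22 * ?s, 1:] = [:- z, 1:] * ([:- z, 1:] * q)"
      unfolding map power2_eq_square[of "[:- z, 1:]"] by (metis dvdE mult.assoc)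
    have "poly (pderiv [:132 * ?s ^ 2, - 22 * ?s, 1:]) z = 0"
      unfolding q pderiv_mult by (simp del: mult_pCons_left)
    then have "z = 11 * ?s" by (simp add: pderiv_pCons)
    moreover have "poly [:132 * ?s ^ 2, - 22 * ?s, 1:] z = 0" unfolding q by simp
    ultimately have "11 * (?s * ?s) = 0" by (simp add: power2_eq_square algebra_simps)
    then show False using s2 by simp
  qed
  fix u assume "poly (map_poly to_ac [:132 * s ^ 2, - 22 * s, 1:]) u = 0"
  then have u: "u ^ 2 = 22 * ?s * u - 132 * ?s ^ 2" unfolding map by (simp add: power2_eq_square algebra_simps)
  have ab: "to_ac ?a = - 264 * ?s ^ 2" "to_ac ?b = 1694 * ?s ^ 3" unfolding s by simp_all
  obtain y where y: "y ^ 2 = u ^ 3 + to_ac ?a * u + to_ac ?b"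
    using ex_y by blast
  have "3 * u ^ 4 + 6 * to_ac ?a * u ^ 2 + 12 * to_ac ?b * u - to_ac ?a ^ 2 =
     3 * (u ^ 2 - (22 * ?s * u - 132 * ?s ^ 2)) * (u ^ 2 + 22 * ?s * u - 176 * ?s ^ 2)"
    unfolding ab by (simp add: algebra_simps power2_eq_square numeral_eq_Suc)
  then have psi: "3 * u ^ 4 + 6 * to_ac ?a * u ^ 2 + 12 * to_ac ?b * u - to_ac ?a ^ 2 = 0" unfolding u by simp
  have y0: "y \<noteq> 0"
  proof
    assume "y = 0"
    have "u ^ 3 + to_ac ?a * u + to_ac ?b = (u ^ 2 - (22 * ?s * u - 132 * ?s ^ 2)) * (u + 22 * ?s) + 22 * ?s ^ 2 * (4 * u - 55 * ?s)"
      unfolding ab by (simp add: algebra_simps power2_eq_square numeral_eq_Suc)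
    then have "22 * ?s ^ 2 * (4 * u - 55 * ?s) = 0" using y \<open>y = 0\<close> unfolding u by simp
    then have "4 * u = 55 * ?s" using s0 by simp
    moreover have "(4 * u) ^ 2 = 88 * ?s * (4 * u) - 2112 * ?s ^ 2" using u by (simp add: power_mult_distrib)
    ultimately have "(55 * ?s) ^ 2 = 88 * ?s * (55 * ?s) - 2112 * ?s ^ 2" by simp
    then have "297 * (?s * ?s) = 0" by (simp add: power2_eq_square)
    then show False using s2 by simp
  qed
  note tors = three_torsion[OF y y0 psi]
  have on: "on_curve (geometric E) (of_short (geometric E) (Affine u y))"
    using on_curve_to_short[of "geometric E" "of_short (geometric E) (Affine u y)"] tors(1) by simp
  have "ec_mult (geometric E) k (of_short (geometric E) (Affine u y)) = Infinity"
    by (rule torsion_transport[OF _ _ k]) (use tors in simp_all)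
  from lattes_pole[OF L on[unfolded of_short.simps] this[unfolded of_short.simps]]
  show "poly (map_poly to_ac (pcompose (snd (quot_of_fract L)) [:- shift_r E, 1:])) u = 0"
    unfolding poly_map_to_ac_shift by simp
qed simp

text \<open>
  Divisibility over the rationals, evaluated at integers: the denominators of the cofactor are
  cleared once and for all by M, and only primes that divide M can be lost in the reduction.
\<close>

lemma pole_mod_prime:
  assumes "q dvd pcompose (map_poly of_int d) [:- r, 1:]"
  obtains M :: int where "M > 0"
    "\<And>x. \<exists>t. of_int (M * poly d x) = poly q (of_int x + r :: rat) * of_int t"
proof -
  obtain w where w: "pcompose (map_poly of_int d) [:- r, 1:] = q * w" using assms by blast
  obtain M U where MU: "M > 0" "map_poly of_int U = smult (of_int M) (pcompose w [:r, 1:])"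
    using clear_denominators by blast
  have "of_int (M * poly d x) = poly q (of_int x + r) * of_int (poly U x)" for x
  proof -
    have "poly (pcompose (map_poly of_int d) [:- r, 1:]) (of_int x + r) = of_int (poly d x)"
      by (simp add: poly_pcompose)
    then have "of_int (poly d x) = poly q (of_int x + r) * poly w (of_int x + r)" unfolding w by simp
    moreover have "of_int (poly U x) = of_int M * poly w (of_int x + r)"
      using arg_cong[OF MU(2), of "\<lambda>p. poly p (of_int x)"] by (simp add: poly_pcompose add.commute)
    ultimately show ?thesis by simp
  qed
  then show ?thesis using that[OF MU(1)] by blast
qed

text \<open>
  The reduction modulo p uses a form n/d with integer coefficients. Over the rationals n and d
  agree with the numerator and the denominator in lowest terms up to a common factor.
\<close>

lemma primitive_form_denominator:
  assumes nd: "primitive_form L n d"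
  shows "snd (quot_of_fract L) dvd map_poly of_int d"
    and "degree (snd (quot_of_fract L)) < degree (fst (quot_of_fract L)) \<Longrightarrow> degree d < degree n"
proof -
  obtain n0 d0 where q: "quot_of_fract L = (n0, d0)" by (cases "quot_of_fract L")
  have d0: "d0 \<noteq> 0" using snd_quot_of_fract_nonzero[of L] q by simp
  have cop: "coprime n0 d0" using coprime_quot_of_fract[of L] q by simp
  have L: "L = to_fract n0 / to_fract d0" using quot_to_fract_quot_of_fract[of L] q by (simp add: quot_to_fract_def Fract_conv_to_fract)
  define nq dq :: "rat poly" where "nq = map_poly of_int n" "dq = map_poly of_int d"
  have d: "d \<noteq> 0" "L = to_fract nq / to_fract dq" using nd unfolding primitive_form_def nq_dq_def by auto
  have dq: "dq \<noteq> 0" using d(1) unfolding nq_dq_def by (simp add: poly_eq_iff coeff_map_poly)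
  have "to_fract (n0 * dq) = to_fract (nq * d0)"
    using L d(2) d0 dq by (simp add: field_simps)
  then have eq: "n0 * dq = nq * d0" by (simp only: to_fract_eq_iff)
  then have "d0 dvd n0 * dq" by simp
  then show "snd (quot_of_fract L) dvd map_poly of_int d"
    using cop unfolding q nq_dq_def by (simp add: coprime_dvd_mult_right_iff coprime_commute)
  assume "degree (snd (quot_of_fract L)) < degree (fst (quot_of_fract L))"
  then have deg: "degree d0 < degree n0" unfolding q by simp
  then have n0: "n0 \<noteq> 0" by auto
  then have nq: "nq \<noteq> 0" using eq dq by auto
  have "degree n0 + degree dq = degree nq + degree d0"
    using arg_cong[OF eq, of degree] n0 nq d0 dq by (simp add: degree_mult_eq)
  moreover have "degree nq = degree n" "degree dq = degree d" unfolding nq_dq_def by (rule degree_map_poly, simp)+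
  ultimately show "degree d < degree n" using deg by simp
qed

lemma pcompose_dvd: "p dvd q \<Longrightarrow> pcompose p r dvd pcompose q (r :: 'a::comm_ring_1 poly)"
  by (auto simp: pcompose_mult elim!: dvdE)

theorem proposition11:
  fixes E :: "rat weierstrass" and k :: nat and L :: "rat poly fract"
  assumes "elliptic_curve E"
    and "has_CM_by E (ring_of_integers (quadratic_field (-11)))"
    and "k > 0"
    and "is_lattes_map E k L"
    and "6 dvd k"
  shows "\<not> arithmetically_exceptional L"
proof
  assume "arithmetically_exceptional L"
  then obtain n d where nd: "primitive_form L n d" and
    inf: "infinite {p. Factorial_Ring.prime p \<and> good_reduction p n d \<and> bij_betw (P1_map_mod p n d) (P1_mod p) (P1_mod p)}"
    unfolding arithmetically_exceptional_def by blast
  note ns = CM_short_equation(1)[OF assms(1,2)]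
  obtain s where s: "s \<noteq> 0" "short_a E = - 264 * s ^ 2" "short_b E = 1694 * s ^ 3"
    using CM_short_parameter[OF CM_short_equation[OF assms(1,2)]] by blast
  define r where "r = shift_r E"
  have k: "2 dvd k" "3 dvd k" using assms(5) by (auto elim!: dvd_trans[rotated])
  have dvd: "pcompose (snd (quot_of_fract L)) [:- r, 1:] dvd pcompose (map_poly of_int d) [:- r, 1:]"
    by (rule pcompose_dvd[OF primitive_form_denominator(1)[OF nd]])
  obtain M2 where M2: "M2 > 0"
    "\<And>x. \<exists>t. of_int (M2 * poly d x) = poly (curve_poly (short_a E) (short_b E)) (of_int x + r) * of_int t"
    using pole_mod_prime[OF dvd_trans[OF two_torsion_dvd_denominator[OF assms(4) ns k(1)] dvd[unfolded r_def]]]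
    unfolding r_def by blast
  obtain M3 where M3: "M3 > 0"
    "\<And>x. \<exists>t. of_int (M3 * poly d x) = poly [:132 * s ^ 2, - 22 * s, 1:] (of_int x + r) * of_int t"
    using pole_mod_prime[OF dvd_trans[OF three_torsion_dvd_denominator[OF assms(4) s k(2)] dvd[unfolded r_def]]]
    unfolding r_def by blast
  obtain m r1 s1 :: int where m: "m > 0" "r = of_int r1 / of_int m" "s = of_int s1 / of_int m"
  proof -
    obtain p q where 1: "quotient_of r = (p, q)" by (cases "quotient_of r")
    obtain p' q' where 2: "quotient_of s = (p', q')" by (cases "quotient_of s")
    have "q > 0" "r = of_int p / of_int q" "q' > 0" "s = of_int p' / of_int q'"
      using quotient_of_denom_pos[OF 1] quotient_of_div[OF 1] quotient_of_denom_pos[OF 2] quotient_of_div[OF 2] by auto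
    then show ?thesis by (intro that[of "q * q'" "p * q'" "p' * q"]) auto
  qed
  have s1: "s1 \<noteq> 0" using s(1) m by auto
  \<comment> \<open>Beyond this bound a prime divides neither M2 and M3, which clear the cofactors, nor the common
    denominator m of r and s.\<close>
  define bound where "bound = nat (11 + M2 + M3 + m + \<bar>s1\<bar>)"
  obtain p where p: "p > bound" "Factorial_Ring.prime p" "bij_betw (P1_map_mod p n d) (P1_mod p) (P1_mod p)"
    using inf unfolding infinite_nat_iff_unbounded by blast
  define P where "P = int p"
  have P: "Factorial_Ring.prime P" using p(2) by (simp add: P_def)
  have big: "P > 11 + M2 + M3 + m + \<bar>s1\<bar>" using p(1) unfolding bound_def P_def by linarith
  have not_dvd: "\<not> P dvd M2" "\<not> P dvd M3" "\<not> P dvd m"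
    using big M2(1) M3(1) m(1) by (auto dest!: zdvd_imp_le)
  have root: "\<exists>x\<in>{0..<P}. P dvd poly d x"
  proof -
    \<comment> \<open>A residue x with x + r = s h modulo P, for r = r1/m and s = s1/m.\<close>
    have shift: "\<exists>x\<in>{0..<P}. P dvd (m * x + r1) - s1 * h" for h
      using ex_mod_solution[OF P not_dvd(3), of "s1 * h - r1"] by (simp only: diff_diff_eq2)
    have arg: "of_int x + r = (of_int (m * x + r1) / of_int m :: rat)" for x
      using m(1) unfolding m(2) by (simp add: add_divide_distrib)
    have "P > 11" using big M2(1) M3(1) m(1) by linarith
    then consider h where "P dvd h ^ 2 - 22 * h + 132" | h where "P dvd h ^ 3 - 264 * h + 1694"
      using torsion_root_mod_prime[OF P] by blast
    then show ?thesis
    proof cases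
      case (1 h)
      obtain x where x: "x \<in> {0..<P}" "P dvd (m * x + r1) - s1 * h" using shift by blast
      define y where "y = m * x + r1"
      have eq: "y ^ 2 - 22 * s1 * y + 132 * s1 ^ 2 = 1 * (y - s1 * h) * (y + s1 * h - 22 * s1) + s1 ^ 2 * (h ^ 2 - 22 * h + 132) * 1"
        by (simp add: algebra_simps power2_eq_square)
      have dv: "P dvd y ^ 2 - 22 * s1 * y + 132 * s1 ^ 2"
        by (rule dvd_linear_combination[OF _ 1 eq]) (use x(2) y_def in simp)
      obtain t where t: "of_int (M3 * poly d x) = poly [:132 * s ^ 2, - 22 * s, 1:] (of_int x + r) * of_int t" using M3(2) by blast
      have "poly [:132 * s ^ 2, - 22 * s, 1:] (of_int x + r) = of_int (y ^ 2 - 22 * s1 * y + 132 * s1 ^ 2) / of_int (m ^ 2)"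
        unfolding arg y_def[symmetric] m(3) using m(1) by (simp add: field_simps power2_eq_square)
      then have "of_int (m ^ 2 * (M3 * poly d x)) = (of_int ((y ^ 2 - 22 * s1 * y + 132 * s1 ^ 2) * t) :: rat)"
        using t m(1) by simp
      then have "m ^ 2 * (M3 * poly d x) = (y ^ 2 - 22 * s1 * y + 132 * s1 ^ 2) * t" by (simp only: of_int_eq_iff)
      then have "P dvd m ^ 2 * (M3 * poly d x)" using dv by simp
      then have "P dvd poly d x" using P not_dvd by (simp add: prime_dvd_mult_iff prime_dvd_power_iff)
      then show ?thesis using x by blast
    next
      case (2 h)
      obtain x where x: "x \<in> {0..<P}" "P dvd (m * x + r1) - s1 * h" using shift by blast
      define y where "y = m * x + r1"
      have eq: "y ^ 3 - 264 * s1 ^ 2 * y + 1694 * s1 ^ 3 =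
         1 * (y - s1 * h) * (y ^ 2 + y * (s1 * h) + (s1 * h) ^ 2 - 264 * s1 ^ 2) + s1 ^ 3 * (h ^ 3 - 264 * h + 1694) * 1"
        by (simp add: algebra_simps power2_eq_square power3_eq_cube)
      have dv: "P dvd y ^ 3 - 264 * s1 ^ 2 * y + 1694 * s1 ^ 3"
        by (rule dvd_linear_combination[OF _ 2 eq]) (use x(2) y_def in simp)
      obtain t where t: "of_int (M2 * poly d x) = poly (curve_poly (short_a E) (short_b E)) (of_int x + r) * of_int t" using M2(2) by blast
      have "poly (curve_poly (short_a E) (short_b E)) (of_int x + r) = of_int (y ^ 3 - 264 * s1 ^ 2 * y + 1694 * s1 ^ 3) / of_int (m ^ 3)"
        unfolding arg y_def[symmetric] s(2,3) m(3) using m(1) by (simp add: field_simps power2_eq_square power3_eq_cube)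
      then have "of_int (m ^ 3 * (M2 * poly d x)) = (of_int ((y ^ 3 - 264 * s1 ^ 2 * y + 1694 * s1 ^ 3) * t) :: rat)"
        using t m(1) by simp
      then have "m ^ 3 * (M2 * poly d x) = (y ^ 3 - 264 * s1 ^ 2 * y + 1694 * s1 ^ 3) * t" by (simp only: of_int_eq_iff)
      then have "P dvd m ^ 3 * (M2 * poly d x)" using dv by simp
      then have "P dvd poly d x" using P not_dvd by (simp add: prime_dvd_mult_iff prime_dvd_power_iff)
      then show ?thesis using x by blast
    qed
  qed
  then obtain x where x: "x \<in> {0..<int p}" "int p dvd poly d x" unfolding P_def by blast
  \<comment> \<open>The coefficient of d in the common degree is 0, so infinity is mapped to infinity.\<close>
  have "degree d < degree n" by (rule primitive_form_denominator(2)[OF nd lattes_degree[OF assms(4)]])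
  then have "coeff d (max (degree n) (degree d)) = 0" by (simp add: coeff_eq_0)
  then have "P1_map_mod p n d At_Infinity = At_Infinity" by (simp add: Let_def)
  moreover have "P1_map_mod p n d (Finite x) = At_Infinity" using x by simp
  moreover have "At_Infinity \<in> P1_mod p" "Finite x \<in> P1_mod p" using x by (auto simp: P1_mod_def)
  ultimately show False using p(3) unfolding bij_betw_def inj_on_def by (metis P1.distinct(1))
qed

end
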